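(* Let $(\Omega,\mathcal F,P)$ be a probability space, $m\ge 0$ an integer, $\Theta\subseteq\mathbb R^m$, and for each $T\ge1$ let $\{\epsilon_{i,T}(\gamma):1\le i\le T\}$, $\gamma\in\Theta$, be random variables. Let $h=h_T>0$ be a deterministic sequence with $h\to0$ and $Th\to\infty$, let $K:\mathbb R\to\mathbb R$, $K_h(u)=K(u/h)/h$, fix an integer $j\ge0$ and set $$\hat\Psi(x,\gamma)=T^{-1}\sum_{i=1}^T\epsilon_{i,T}(\gamma)K_h(i/T-x)\Big(\frac{i/T-x}{h}\Big)^j,\qquad x\in[0,1],\ \gamma\in\Theta.$$ Assume (A.1), (A.2), (A.3) (defined in the context) hold, with $s>2$. Fix $c>0$ and define $$\theta=\frac{\beta(s-2)-m(s-1)(1+2c)-2s+1}{\beta s+m(s-1)+1}.$$ Let $d_T=T^r$ with $r=\min\{c,(1-\theta)/(2\lambda)\}$ and $\Theta_T=\{\gamma\in\mathbb R^m:\|\gamma\|\le d_T\}$. Suppose that $$\beta>\frac{m(s-1)(1+2c)+2s-1}{s-2}\qquad\text{and}\qquad \frac{\ln T}{T^\theta h}\to0 \ (T\to\infty).$$ If in addition there is a constant $C>0$ such that $$\sup_{T\ge1}\sup_{1\le i\le T}E\Big(\sup_{\gamma\in\Theta_T}|\epsilon_{i,T}(\gamma)|^s\Big)\le C(1+d_T^\lambda),\qquad \sup_{T\ge1}\sup_{1\le i\le T}E\Big(\sup_{\gamma\in\Theta_T}|\xi_{i,T}(\gamma)|^s\Big)\le C(1+d_T^\lambda),$$ then $$\sup_{\gamma\in\Theta_T}\sup_{x\in[0,1]}\big|\hat\Psi(x,\gamma)-E\hat\Psi(x,\gamma)\big|=O_p\Big(d_T^\lambda\sqrt{\tfrac{\ln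 T}{Th}}\Big).$$
   Context: Mixing coefficients: for $T\ge1$, $\gamma\in\Theta$, $0\le k<T$, $\alpha_{\gamma,T}(k)=\sup_{1\le l\le T-k}\sup\{|P(A\cap B)-P(A)P(B)|: B\in\mathcal F_{T,1}^l(\gamma),A\in\mathcal F_{T,l+k}^T(\gamma)\}$, where $\mathcal F_{T,i}^l(\gamma)=\sigma(\epsilon_{r,T}(\gamma): i\le r\le l)$; by convention $\alpha_{\gamma,T}(k)=1/4$ for $k\le0$ and $\alpha_{\gamma,T}(k)=0$ for $k\ge T$. (A.1) There are finite constants $A>0$ and $\beta>2$, not depending on $i,\gamma,T$, with $\alpha_{\gamma,T}(i)\le A i^{-\beta}$ for all $i\ge1$, $T$, $\gamma$. (A.2) $|K(u)|\le\bar K<\infty$ and $\int_{\mathbb R}|K(u)|^sdu\le\bar\mu<\infty$ for some $s>2$; there are constants $1\le\Lambda_1,L_1<\infty$ with $K(u)=0$ for $|u|>L_1$ and $|K(u)-K(u')|\le\Lambda_1|u-u'|$ for all $u,u'\in\mathbb R$. (A.3) For each $T\ge1$ and $1\le i\le T$ there is a nonnegative random function $\xi_{i,T}(\gamma)$ such that almost surely $|\epsilon_{i,T}(\gamma')-\epsilon_{i,T}(\gamma)|\le\xi_{i,T}(\gamma)\|\gamma'-\gamma\|$ for all $\gamma,\gamma'\in\Theta$ with $\|\gamma'-\gamma\|\le h$; and there are finite constants $s>2$, $\lambda\ge0$, $\bar C_1,\bar C_2>0$ with $\sup_{T\ge1}\sup_{1\le i\le T}E|\epsilon_{i,T}(\gamma)|^s\le\bar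 C_1(1+\|\gamma\|^\lambda)$ and $\sup_{T\ge1}\sup_{1\le i\le T}E|\xi_{i,T}(\gamma)|^s\le\bar C_2(1+\|\gamma\|^\lambda)$ for all $\gamma\in\Theta$. (The exponent $s$ is the same throughout.) $\|\cdot\|$ is the Euclidean norm. If $\lambda=0$, $(1-\theta)/(2\lambda)$ is read as $+\infty$, so $r=c$. Suprema over $\gamma\in\Theta_T$ range over $\gamma\in\Theta$ with $\|\gamma\|\le d_T$. $X_T=O_p(a_T)$ means: for every $\delta>0$ there is $M<\infty$ with $P(|X_T|>Ma_T)\le\delta$ for all sufficiently large $T$. *)

theory Defs
  imports "HOL-Probability.Probability"
begin

text \<open>Parameter vectors in R^m are represented as functions nat => real
  vanishing at indices >= m (this also covers m = 0).\<close>

definition vecs :: "nat \<Rightarrow> (nat \<Rightarrow> real) set" where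
  "vecs m = {g. \<forall>i\<ge>m. g i = 0}"

definition enorm :: "nat \<Rightarrow> (nat \<Rightarrow> real) \<Rightarrow> real" where
  "enorm m g = sqrt (\<Sum>i<m. (g i)^2)"

text \<open>Real power with the mathematical convention 0^0 = 1.\<close>
definition rpow :: "real \<Rightarrow> real \<Rightarrow> real" where
  "rpow x a = (if a = 0 then 1 else x powr a)"

definition Fsig :: "'a measure \<Rightarrow> (nat \<Rightarrow> 'a \<Rightarrow> real) \<Rightarrow> nat \<Rightarrow> nat \<Rightarrow> 'a set set" where
  "Fsig M X i l = sigma_sets (space M) (\<Union>r\<in>{i..l}. {X r -` B \<inter> space M | B. B \<in> sets borel})"

definition mixing_coef :: "'a measure \<Rightarrow> (nat \<Rightarrow> 'a \<Rightarrow> real) \<Rightarrow> nat \<Rightarrow> int \<Rightarrow> real" where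
  "mixing_coef M X T k =
     (if k \<le> 0 then 1/4 else if k \<ge> int T then 0 else
      (SUP l\<in>{1..T - nat k}. SUP AB \<in> Fsig M X (l + nat k) T \<times> Fsig M X 1 l.
          \<bar>measure M (fst AB \<inter> snd AB) - measure M (fst AB) * measure M (snd AB)\<bar>))"

definition Psi_hat :: "(real \<Rightarrow> real) \<Rightarrow> (nat \<Rightarrow> real) \<Rightarrow> (nat \<Rightarrow> nat \<Rightarrow> (nat \<Rightarrow> real) \<Rightarrow> 'a \<Rightarrow> real)
     \<Rightarrow> nat \<Rightarrow> nat \<Rightarrow> real \<Rightarrow> (nat \<Rightarrow> real) \<Rightarrow> 'a \<Rightarrow> real" where
  "Psi_hat K h eps j T x g \<omega> =
     (1 / real T) * (\<Sum>i=1..T. eps T i g \<omega> * (K ((real i / real T - x) / h T) / h T)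
        * ((real i / real T - x) / h T) ^ j)"

text \<open>Outer probability (the suprema below need not be measurable).\<close>
definition outer_prob :: "'a measure \<Rightarrow> 'a set \<Rightarrow> real" where
  "outer_prob M S = Inf {measure M A | A. A \<in> sets M \<and> S \<subseteq> A}"

end

theory Submission
  imports Defs
begin

text \<open>
  Split \<open>\<epsilon>\<close> at the level \<open>\<tau> = (a h) powr (- 1 / (s - 1))\<close> with \<open>a = sqrt (ln T / (T h))\<close>. This is
  larger than the level \<open>a powr (- 1 / (s - 1))\<close> that is natural for fixed \<open>x\<close>: the tail
  \<open>\<bar>\<epsilon>\<bar> powr s * \<tau> powr (1 - s)\<close> has mean of order \<open>a h\<close>, which survives the crude bound \<open>\<bar>K_h\<bar> \<le> C / h\<close>
  and hence the supremum over \<open>x\<close>. Parameters are replaced by a net of mesh \<open>a h\<close> with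
  centres in \<open>\<Theta>_T\<close>, so only finite maxima have to be measurable.

  For one net point the \<open>O(T h)\<close> terms in the kernel window are grouped into alternating blocks of length
  \<open>b = 1 / (a \<tau>)\<close>. Davydov's inequality bounds the block variances by \<open>O(b)\<close>, and an exponential
  supermartingale argument gives a tail of order \<open>exp (- y ln T) + T h (a \<tau>) powr (1 + \<beta>)\<close>. The exponent
  \<open>\<theta>\<close> is exactly what makes \<open>T h (a \<tau>) powr (1 + \<beta>)\<close> times the number of net points vanish.
\<close>

section \<open>Covariance inequalities under strong mixing\<close>

text \<open>Parameters and \<open>x\<close> range over uncountable sets, so each uniform estimate
  must be carried by finitely many random variables. For this reason the Lipschitz modulus
  \<open>xi\<close> is evaluated at the net point and never at the running parameter.

  Moving \<open>x\<close> to a net point changes the kernel weights by \<open>O(a)\<close>. Bounding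
  the truncated errors by \<open>\<tau>\<close> at that stage would lose a factor
  \<open>\<tau>\<close>; instead a second family of window sums, those of the truncated absolute
  values, is kept close to its mean, which is of order \<open>T h D\<close>.

  Here \<open>D\<close> is the power \<open>lam\<close> of the radius \<open>d_T\<close>. Moments
  enter through \<open>B = c * D\<close>, variances through \<open>B\<^sup>2\<close>; the
  exponential inequality is applied at \<open>t = a / (2 D)\<close>, which turns
  \<open>D\<^sup>2\<close> into a deviation of order \<open>D a\<close>, the claimed rate.

  The net has about \<open>d_T powr m * (1 / (a h)) powr (m + 1)\<close> points. Multiplied by
  \<open>T h (a \<tau>) powr (1 + \<beta>)\<close>, and up to powers of \<open>ln T\<close>, this is
  a power of \<open>1 / (T powr \<theta> h)\<close> when \<open>r = c\<close>. The lower bound on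
  \<open>\<beta>\<close> enters through \<open>\<beta> (1 - 2 / s) > 1\<close>, the summability of
  the Davydov covariances.\<close>

lemma indicator_staircase:
  fixes x :: real
  assumes "0 \<le> x" "x \<le> 1" "n \<ge> 1"
  shows "\<bar>x - (\<Sum>i=1..n. indicator {y. real i / real n \<le> y} x) / real n\<bar> \<le> 1 / real n"
proof -
  \<comment> \<open>The sum counts the thresholds \<open>i / n\<close> that do not exceed
    \<open>x\<close>, so it equals the floor of \<open>n x\<close>.\<close>
  have "(\<Sum>i=1..n. indicator {y. real i / real n \<le> y} x) = (\<Sum>i\<in>{1..n}. of_bool (i \<le> nat \<lfloor>real n * x\<rfloor>) :: real)"
  proof (rule sum.cong)
    fix i assume i: "i \<in> {1..n}"
    have "real i / real n \<le> x \<longleftrightarrow> real i \<le> real n * x"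
      using assms by (simp add: field_simps)
    also have "\<dots> \<longleftrightarrow> i \<le> nat \<lfloor>real n * x\<rfloor>"
      by (metis assms(1) floor_of_nat le_nat_floor nat_mono of_nat_le_iff le_nat_iff floor_mono of_nat_0_le_iff
           mult_nonneg_nonneg nat_int of_nat_floor order_trans)
    finally show "indicator {y. real i / real n \<le> y} x = (of_bool (i \<le> nat \<lfloor>real n * x\<rfloor>) :: real)"
      by (simp add: indicator_def)
  qed simp
  also have "\<dots> = real (card ({1..n} \<inter> {i. i \<le> nat \<lfloor>real n * x\<rfloor>}))"
    by (simp add: Int_def)
  also have "{1..n} \<inter> {i. i \<le> nat \<lfloor>real n * x\<rfloor>} = {1..nat \<lfloor>real n * x\<rfloor>}"
  proof -
    have "nat \<lfloor>real n * x\<rfloor> \<le> n"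
      using assms by (metis floor_of_nat floor_mono mult_left_le nat_int nat_mono of_nat_0_le_iff)
    then show ?thesis by auto
  qed
  finally have "(\<Sum>i=1..n. indicator {y. real i / real n \<le> y} x) = (of_int \<lfloor>real n * x\<rfloor> :: real)"
    using assms by (simp)
  moreover have "\<bar>real n * x - of_int \<lfloor>real n * x\<rfloor>\<bar> \<le> 1" by linarith
  moreover have "x - S / real n = (real n * x - S) / real n" for S
    using assms by (simp add: field_simps)
  ultimately show ?thesis
    by (simp add: divide_right_mono)
qed

context prob_space begin

lemma expectation_diff_le_AE:
  fixes f g e :: "'a \<Rightarrow> real"
  assumes "integrable M f" "integrable M g" "integrable M e" "AE \<omega> in M. \<bar>f \<omega> - g \<omega>\<bar> \<le> e \<omega>"
  shows "\<bar>expectation f - expectation g\<bar> \<le> expectation e"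
proof -
  have "\<bar>expectation f - expectation g\<bar> = \<bar>expectation (\<lambda>\<omega>. f \<omega> - g \<omega>)\<bar>" using assms by simp
  also have "\<dots> \<le> expectation (\<lambda>\<omega>. \<bar>f \<omega> - g \<omega>\<bar>)" using integral_norm_bound[of M "\<lambda>\<omega>. f \<omega> - g \<omega>"] by simp
  also have "\<dots> \<le> expectation e" using assms by (intro integral_mono_AE) auto
  finally show ?thesis .
qed

text \<open>A discrete form of Hoeffding's covariance formula: once both variables are replaced by
  staircases of superlevel indicators, their covariance is an average of \<open>n\<^sup>2\<close>
  event covariances, each at most \<open>\<alpha>\<close>. Hence the constant is 1, and only
  superlevel sets have to be tested.\<close>

lemma cov_le_unit:
  fixes X Y :: "'a \<Rightarrow> real"
  assumes X[measurable]: "random_variable borel X" and Y[measurable]: "random_variable borel Y"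
    and bX: "\<And>\<omega>. \<omega> \<in> space M \<Longrightarrow> 0 \<le> X \<omega> \<and> X \<omega> \<le> 1"
    and bY: "\<And>\<omega>. \<omega> \<in> space M \<Longrightarrow> 0 \<le> Y \<omega> \<and> Y \<omega> \<le> 1"
    and mix: "\<And>u v. \<bar>prob ({\<omega>\<in>space M. u \<le> X \<omega>} \<inter> {\<omega>\<in>space M. v \<le> Y \<omega>})
               - prob {\<omega>\<in>space M. u \<le> X \<omega>} * prob {\<omega>\<in>space M. v \<le> Y \<omega>}\<bar> \<le> \<alpha>"
  shows "\<bar>expectation (\<lambda>\<omega>. X \<omega> * Y \<omega>) - expectation X * expectation Y\<bar> \<le> \<alpha>"
proof -
  \<comment> \<open>The error \<open>4 / n\<close> is \<open>2 / n\<close> for the mean of the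
    product plus \<open>2 / n\<close> for the product of the means.\<close>
  have step: "\<bar>expectation (\<lambda>\<omega>. X \<omega> * Y \<omega>) - expectation X * expectation Y\<bar> \<le> \<alpha> + 4 / real n"
    if n: "n \<ge> 1" for n
  proof -
    define I where "I i x = (indicator {y. real i / real n \<le> y} x :: real)" for i x
    have I[measurable]: "I i \<in> borel_measurable borel" for i
      unfolding I_def by measurable
    define X' where "X' \<omega> = (\<Sum>i=1..n. I i (X \<omega>)) / real n" for \<omega>
    define Y' where "Y' \<omega> = (\<Sum>i=1..n. I i (Y \<omega>)) / real n" for \<omega>
    have I01: "0 \<le> I i x" "I i x \<le> 1" for i x unfolding I_def by (auto simp: indicator_def)
    have dX: "\<bar>X \<omega> - X' \<omega>\<bar> \<le> 1 / n" if "\<omega> \<in> space M" for \<omega>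
      unfolding X'_def I_def using indicator_staircase[of "X \<omega>" n] bX[OF that] n by auto
    have dY: "\<bar>Y \<omega> - Y' \<omega>\<bar> \<le> 1 / n" if "\<omega> \<in> space M" for \<omega>
      unfolding Y'_def I_def using indicator_staircase[of "Y \<omega>" n] bY[OF that] n by auto
    have X'01: "0 \<le> X' \<omega>" "X' \<omega> \<le> 1" for \<omega>
      unfolding X'_def using n sum_bounded_above[of "{1..n}" "\<lambda>i. I i (X \<omega>)" 1] I01
      by (auto intro!: divide_nonneg_nonneg sum_nonneg simp: divide_le_eq)
    have Y'01: "0 \<le> Y' \<omega>" "Y' \<omega> \<le> 1" for \<omega>
      unfolding Y'_def using n sum_bounded_above[of "{1..n}" "\<lambda>i. I i (Y \<omega>)" 1] I01
      by (auto intro!: divide_nonneg_nonneg sum_nonneg simp: divide_le_eq)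
    have mX'[measurable]: "random_variable borel X'" unfolding X'_def by measurable
    have mY'[measurable]: "random_variable borel Y'" unfolding Y'_def by measurable
    have iI: "integrable M (\<lambda>\<omega>. I i (X \<omega>))" "integrable M (\<lambda>\<omega>. I i (Y \<omega>))" 
       "integrable M (\<lambda>\<omega>. I i (X \<omega>) * I j (Y \<omega>))" for i j
      using I01 by (auto intro!: integrable_const_bound[of _ 1] simp: mult_le_one)
    have eX: "expectation (\<lambda>\<omega>. I i (X \<omega>)) = prob {\<omega>\<in>space M. real i / n \<le> X \<omega>}" for i
    proof -
      have "expectation (\<lambda>\<omega>. I i (X \<omega>)) = expectation (indicator {\<omega>\<in>space M. real i / n \<le> X \<omega>})"
        by (rule Bochner_Integration.integral_cong) (auto simp: I_def indicator_def)
      then show ?thesis by simp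
    qed
    have eY: "expectation (\<lambda>\<omega>. I i (Y \<omega>)) = prob {\<omega>\<in>space M. real i / n \<le> Y \<omega>}" for i
    proof -
      have "expectation (\<lambda>\<omega>. I i (Y \<omega>)) = expectation (indicator {\<omega>\<in>space M. real i / n \<le> Y \<omega>})"
        by (rule Bochner_Integration.integral_cong) (auto simp: I_def indicator_def)
      then show ?thesis by simp
    qed
    have eXY: "expectation (\<lambda>\<omega>. I i (X \<omega>) * I j (Y \<omega>)) =
        prob ({\<omega>\<in>space M. real i / n \<le> X \<omega>} \<inter> {\<omega>\<in>space M. real j / n \<le> Y \<omega>})" for i j
    proof -
      have "expectation (\<lambda>\<omega>. I i (X \<omega>) * I j (Y \<omega>))
         = expectation (indicator ({\<omega>\<in>space M. real i / n \<le> X \<omega>} \<inter> {\<omega>\<in>space M. real j / n \<le> Y \<omega>}))"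
        by (rule Bochner_Integration.integral_cong) (auto simp: I_def indicator_def)
      then show ?thesis by simp
    qed
    have EX': "expectation X' = (\<Sum>i=1..n. expectation (\<lambda>\<omega>. I i (X \<omega>))) / n"
      unfolding X'_def using iI by (simp add: Bochner_Integration.integral_sum)
    have EY': "expectation Y' = (\<Sum>i=1..n. expectation (\<lambda>\<omega>. I i (Y \<omega>))) / n"
      unfolding Y'_def using iI by (simp add: Bochner_Integration.integral_sum)
    have "expectation (\<lambda>\<omega>. X' \<omega> * Y' \<omega>) = expectation (\<lambda>\<omega>. (\<Sum>i=1..n. \<Sum>j=1..n. I i (X \<omega>) * I j (Y \<omega>)) / (real n * real n))"
      unfolding X'_def Y'_def by (simp add: sum_product)
    also have "\<dots> = (\<Sum>i=1..n. \<Sum>j=1..n. expectation (\<lambda>\<omega>. I i (X \<omega>) * I j (Y \<omega>))) / (real n * real n)"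
      using iI by (simp add: Bochner_Integration.integral_sum)
    finally have EXY': "expectation (\<lambda>\<omega>. X' \<omega> * Y' \<omega>) = \<dots>" .
    have "expectation (\<lambda>\<omega>. X' \<omega> * Y' \<omega>) - expectation X' * expectation Y' =
       (\<Sum>i=1..n. \<Sum>j=1..n. expectation (\<lambda>\<omega>. I i (X \<omega>) * I j (Y \<omega>))
           - expectation (\<lambda>\<omega>. I i (X \<omega>)) * expectation (\<lambda>\<omega>. I j (Y \<omega>))) / (real n * real n)"
      unfolding EXY' EX' EY' by (simp add: sum_product sum_subtractf diff_divide_distrib)
    moreover have "\<bar>\<Sum>i=1..n. \<Sum>j=1..n. expectation (\<lambda>\<omega>. I i (X \<omega>) * I j (Y \<omega>))
           - expectation (\<lambda>\<omega>. I i (X \<omega>)) * expectation (\<lambda>\<omega>. I j (Y \<omega>))\<bar> \<le> (\<Sum>i=1..n. \<Sum>j=1..n. \<alpha>)"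
      unfolding eX eY eXY by (rule order_trans[OF sum_abs], rule sum_mono, rule order_trans[OF sum_abs], rule sum_mono) (rule mix)
    ultimately have c': "\<bar>expectation (\<lambda>\<omega>. X' \<omega> * Y' \<omega>) - expectation X' * expectation Y'\<bar> \<le> \<alpha>"
      using n by (simp add: divide_le_eq mult_ac)
    have bnd: "\<bar>expectation f - expectation g\<bar> \<le> e"
      if "integrable M f" "integrable M g" "\<And>\<omega>. \<omega> \<in> space M \<Longrightarrow> \<bar>f \<omega> - g \<omega>\<bar> \<le> e" for f g :: "'a \<Rightarrow> real" and e
      using expectation_diff_le_AE[of f g "\<lambda>_. e"] that by (auto simp: prob_space)
    have iX: "integrable M X" "integrable M Y" "integrable M X'" "integrable M Y'"
      using bX bY X'01 Y'01 by (auto intro!: integrable_const_bound[of _ 1])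
    have iXY: "integrable M (\<lambda>\<omega>. X \<omega> * Y \<omega>)" "integrable M (\<lambda>\<omega>. X' \<omega> * Y' \<omega>)"
      using bX bY X'01 Y'01 by (auto intro!: integrable_const_bound[of _ 1] AE_I2 simp: mult_le_one)
    have prod: "\<bar>x * y - x' * y'\<bar> \<le> 2 / n" if "\<bar>x - x'\<bar> \<le> 1 / n" "\<bar>y - y'\<bar> \<le> 1 / n" "\<bar>x\<bar> \<le> 1" "\<bar>y'\<bar> \<le> 1" for x y x' y' :: real
    proof -
      have "x * y - x' * y' = x * (y - y') + (x - x') * y'" by (simp add: algebra_simps)
      then have "\<bar>x * y - x' * y'\<bar> \<le> \<bar>x\<bar> * \<bar>y - y'\<bar> + \<bar>x - x'\<bar> * \<bar>y'\<bar>" by (metis abs_mult abs_triangle_ineq)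
      also have "\<dots> \<le> 1 * (1 / n) + (1 / n) * 1" using that by (intro add_mono mult_mono) auto
      finally show ?thesis by simp
    qed
    have 1: "\<bar>expectation (\<lambda>\<omega>. X \<omega> * Y \<omega>) - expectation (\<lambda>\<omega>. X' \<omega> * Y' \<omega>)\<bar> \<le> 2 / n"
      by (rule bnd[OF iXY], rule prod) (use dX dY bX Y'01 in auto)
    have EX1: "\<bar>expectation X\<bar> \<le> 1" 
      using bX iX by (auto simp: abs_le_iff intro!: integral_le_const order_trans[of "-1" 0] integral_nonneg_AE AE_I2)
    have EY1: "\<bar>expectation Y'\<bar> \<le> 1" 
      using Y'01 iX by (auto simp: abs_le_iff intro!: integral_le_const order_trans[of "-1" 0] integral_nonneg_AE AE_I2)
    have 2: "\<bar>expectation X * expectation Y - expectation X' * expectation Y'\<bar> \<le> 2 / n"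
      by (rule prod) (use bnd[of X X'] bnd[of Y Y'] dX dY iX EX1 EY1 in auto)
    from 1 2 c' show ?thesis by linarith
  qed
  show ?thesis
  proof (rule field_le_epsilon)
    fix e :: real assume "e > 0"
    obtain n :: nat where n: "real n > 4 / e" using reals_Archimedean2 by blast
    with \<open>e > 0\<close> have "n \<ge> 1" by (metis divide_pos_pos less_one linorder_not_le not_less_iff_gr_or_eq of_nat_0 zero_less_numeral order.strict_trans)
    moreover have "4 / n \<le> e" using n \<open>e > 0\<close> \<open>n \<ge> 1\<close> by (simp add: field_simps)
    ultimately show "\<bar>expectation (\<lambda>\<omega>. X \<omega> * Y \<omega>) - expectation X * expectation Y\<bar> \<le> \<alpha> + e"
      using step[of n] by linarith
  qed
qed

lemma cov_le_range:
  fixes X Y :: "'a \<Rightarrow> real"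
  assumes X[measurable]: "random_variable borel X" and Y[measurable]: "random_variable borel Y"
    and bX: "\<And>\<omega>. \<omega> \<in> space M \<Longrightarrow> a \<le> X \<omega> \<and> X \<omega> \<le> a + p" and p: "p > 0"
    and bY: "\<And>\<omega>. \<omega> \<in> space M \<Longrightarrow> b \<le> Y \<omega> \<and> Y \<omega> \<le> b + q" and q: "q > 0"
    and mix: "\<And>u v. \<bar>prob ({\<omega>\<in>space M. u \<le> X \<omega>} \<inter> {\<omega>\<in>space M. v \<le> Y \<omega>})
               - prob {\<omega>\<in>space M. u \<le> X \<omega>} * prob {\<omega>\<in>space M. v \<le> Y \<omega>}\<bar> \<le> \<alpha>"
  shows "\<bar>expectation (\<lambda>\<omega>. X \<omega> * Y \<omega>) - expectation X * expectation Y\<bar> \<le> p * q * \<alpha>"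
proof -
  define X' where "X' \<omega> = (X \<omega> - a) / p" for \<omega>
  define Y' where "Y' \<omega> = (Y \<omega> - b) / q" for \<omega>
  have eqX: "X \<omega> = p * X' \<omega> + a" and eqY: "Y \<omega> = q * Y' \<omega> + b" for \<omega>
    using p q by (auto simp: X'_def Y'_def)
  have [measurable]: "random_variable borel X'" "random_variable borel Y'" unfolding X'_def Y'_def by measurable
  have b': "0 \<le> X' \<omega> \<and> X' \<omega> \<le> 1" "0 \<le> Y' \<omega> \<and> Y' \<omega> \<le> 1" if "\<omega> \<in> space M" for \<omega>
    using bX[OF that] bY[OF that] p q by (auto simp: X'_def Y'_def)
  have sX: "{\<omega>\<in>space M. u \<le> X' \<omega>} = {\<omega>\<in>space M. p * u + a \<le> X \<omega>}" 
   and sY: "{\<omega>\<in>space M. u \<le> Y' \<omega>} = {\<omega>\<in>space M. q * u + b \<le> Y \<omega>}" for u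
    using p q by (auto simp: X'_def Y'_def field_simps)
  have c: "\<bar>expectation (\<lambda>\<omega>. X' \<omega> * Y' \<omega>) - expectation X' * expectation Y'\<bar> \<le> \<alpha>"
    by (rule cov_le_unit) (use b' in \<open>auto simp: sX sY intro!: mix\<close>)
  have i: "integrable M X'" "integrable M Y'" "integrable M (\<lambda>\<omega>. X' \<omega> * Y' \<omega>)"
    using b' by (auto intro!: integrable_const_bound[of _ 1] AE_I2 simp: mult_le_one)
  have "expectation (\<lambda>\<omega>. X \<omega> * Y \<omega>) = expectation (\<lambda>\<omega>. p * q * (X' \<omega> * Y' \<omega>) + p * b * X' \<omega> + a * q * Y' \<omega> + a * b)"
    unfolding eqX eqY by (simp add: algebra_simps)
  also have "\<dots> = p * q * expectation (\<lambda>\<omega>. X' \<omega> * Y' \<omega>) + p * b * expectation X' + a * q * expectation Y' + a * b"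
    using i by (simp add: prob_space)
  finally have "expectation (\<lambda>\<omega>. X \<omega> * Y \<omega>) = \<dots>" .
  moreover have "expectation X = p * expectation X' + a" unfolding eqX using i by (simp add: prob_space)
  moreover have "expectation Y = q * expectation Y' + b" unfolding eqY using i by (simp add: prob_space)
  ultimately have "expectation (\<lambda>\<omega>. X \<omega> * Y \<omega>) - expectation X * expectation Y
     = p * q * (expectation (\<lambda>\<omega>. X' \<omega> * Y' \<omega>) - expectation X' * expectation Y')"
    by (simp add: algebra_simps)
  then show ?thesis using c p q by (simp add: abs_mult)
qed

end

section \<open>Sigma-algebras of index sets and the mixing coefficient\<close>

text \<open>Unlike \<open>Fsig\<close> it admits any index set: the past of a block will be a union
  of separated blocks. As a measure it can be used as a subalgebra and as a domain of measurable
  functions.\<close>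

definition sigI :: "'a measure \<Rightarrow> (nat \<Rightarrow> 'a \<Rightarrow> real) \<Rightarrow> nat set \<Rightarrow> 'a measure" where
  "sigI M X I = sigma (space M) (\<Union>r\<in>I. {X r -` B \<inter> space M | B. B \<in> sets borel})"

lemma space_sigI [simp]: "space (sigI M X I) = space M"
  by (simp add: sigI_def space_measure_of_conv)

lemma sets_sigI: "sets (sigI M X I) = sigma_sets (space M) (\<Union>r\<in>I. {X r -` B \<inter> space M | B. B \<in> sets borel})"
  by (auto simp: sigI_def intro!: sets_measure_of)

lemma Fsig_eq_sigI: "Fsig M X i l = sets (sigI M X {i..l})"
  by (simp add: sets_sigI Fsig_def)

lemma measurable_sigI: "r \<in> I \<Longrightarrow> X r \<in> borel_measurable (sigI M X I)"
  by (rule measurableI) (auto simp: sets_sigI intro!: sigma_sets.Basic)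

lemma sets_sigI_mono: "I \<subseteq> J \<Longrightarrow> sets (sigI M X I) \<subseteq> sets (sigI M X J)"
  unfolding sets_sigI by (rule sigma_sets_mono') blast

lemma sets_sigI_empty: "sets (sigI M X {}) = {{}, space M}"
  by (simp add: sets_sigI sigma_sets_empty_eq)

lemma subalgebra_sigI:
  assumes "\<And>r. r \<in> I \<Longrightarrow> X r \<in> borel_measurable M"
  shows "subalgebra M (sigI M X I)"
proof -
  have "sigma_sets (space M) (\<Union>r\<in>I. {X r -` B \<inter> space M | B. B \<in> sets borel}) \<subseteq> sets M"
    by (rule sets.sigma_sets_subset) (use assms in \<open>auto intro: measurable_sets\<close>)
  then show ?thesis by (simp add: subalgebra_def sets_sigI)
qed

context prob_space begin

text \<open>Both sigma-algebras only grow when \<open>I\<close> is filled up to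
  \<open>{1..Max I}\<close> and \<open>J\<close> to \<open>{Max I + k..T}\<close>, and there the
  defining supremum applies. An empty index set leaves only trivial events; that case uses
  \<open>0 \<le> \<alpha>\<close>.\<close>

lemma mixing_coef_bound:
  assumes X: "\<And>i. i \<in> {1..T} \<Longrightarrow> X i \<in> borel_measurable M"
    and \<alpha>: "mixing_coef M X T (int k) \<le> \<alpha>" "0 \<le> \<alpha>" and k: "1 \<le> k"
    and I: "I \<subseteq> {1..T}" and J: "J \<subseteq> {1..T}" and gap: "\<And>i j. i \<in> I \<Longrightarrow> j \<in> J \<Longrightarrow> i + k \<le> j"
    and A: "A \<in> sets (sigI M X I)" and B: "B \<in> sets (sigI M X J)"
  shows "\<bar>prob (A \<inter> B) - prob A * prob B\<bar> \<le> \<alpha>"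
proof -
  have AM: "A \<in> events" using subalgebra_sigI[of I X] X I A unfolding subalgebra_def by blast
  have BM: "B \<in> events" using subalgebra_sigI[of J X] X J B unfolding subalgebra_def by blast
  show ?thesis
  proof (cases "I = {} \<or> J = {}")
    case True
    then have "A \<in> {{}, space M} \<or> B \<in> {{}, space M}"
      using A B sets_sigI_empty[of M X] by auto
    then have "prob (A \<inter> B) = prob A * prob B"
      using sets.Int_space_eq1[OF BM] sets.Int_space_eq2[OF AM] by (auto simp: prob_space)
    then show ?thesis using \<alpha> by simp
  next
    case False
    define l where "l = Max I"
    have finI: "finite I" using I finite_subset by blast
    have l: "l \<in> I" unfolding l_def using False finI by simp
    have Il: "I \<subseteq> {1..l}" using I finI by (auto simp: l_def)
    obtain j where j: "j \<in> J" using False by blast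
    have Jl: "J \<subseteq> {l+k..T}" using J gap[OF l] by auto
    have lk: "l + k \<le> T" "1 \<le> l" using Jl j l I by auto
    have A': "A \<in> Fsig M X 1 l" unfolding Fsig_eq_sigI using sets_sigI_mono[OF Il] A by blast
    have B': "B \<in> Fsig M X (l+k) T" unfolding Fsig_eq_sigI using sets_sigI_mono[OF Jl] B by blast
    \<comment> \<open>The suprema are over reals, so \<open>cSUP_upper\<close> needs the bound
      \<open>g1\<close>. In \<open>mixing_coef\<close> the later event is the first component of the
      pair, hence \<open>g (B, A)\<close> below.\<close>
    define g where "g AB = \<bar>prob (fst AB \<inter> snd AB) - prob (fst AB) * prob (snd AB)\<bar>" for AB :: "'a set \<times> 'a set"
    have g1: "g AB \<le> 1" for AB
    proof -
      have "0 \<le> prob (fst AB \<inter> snd AB)" "prob (fst AB \<inter> snd AB) \<le> 1" by auto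
      moreover have "0 \<le> prob (fst AB) * prob (snd AB)" "prob (fst AB) * prob (snd AB) \<le> 1" by (auto intro: mult_le_one)
      ultimately show ?thesis unfolding g_def by linarith
    qed
    have ne: "Fsig M X (l + k) T \<times> Fsig M X 1 l \<noteq> {}" for l using A' B' unfolding Fsig_eq_sigI 
      by (metis empty_iff mem_Sigma_iff sets.empty_sets)
    have "g (B, A) \<le> (SUP AB \<in> Fsig M X (l + k) T \<times> Fsig M X 1 l. g AB)"
      by (rule cSUP_upper) (use A' B' g1 in \<open>auto intro!: bdd_aboveI2[where M=1]\<close>)
    also have "\<dots> \<le> (SUP l\<in>{1..T - k}. SUP AB \<in> Fsig M X (l + k) T \<times> Fsig M X 1 l. g AB)"
      by (rule cSUP_upper[of l]) (use lk g1 ne in \<open>auto intro!: bdd_aboveI2[where M=1] cSUP_least\<close>)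
    also have "\<dots> = mixing_coef M X T (int k)"
      using k lk by (simp add: mixing_coef_def g_def)
    finally show ?thesis using \<alpha> by (simp add: g_def Int_commute mult.commute)
  qed
qed

lemma cov_le_subalgebra:
  fixes X Y :: "'a \<Rightarrow> real"
  assumes F: "subalgebra M F" and G: "subalgebra M G"
    and X: "X \<in> borel_measurable F" and Y: "Y \<in> borel_measurable G"
    and bX: "\<And>\<omega>. \<omega> \<in> space M \<Longrightarrow> a \<le> X \<omega> \<and> X \<omega> \<le> a + p" and p: "p > 0"
    and bY: "\<And>\<omega>. \<omega> \<in> space M \<Longrightarrow> b \<le> Y \<omega> \<and> Y \<omega> \<le> b + q" and q: "q > 0"
    and mix: "\<And>A B. A \<in> sets F \<Longrightarrow> B \<in> sets G \<Longrightarrow> \<bar>prob (A \<inter> B) - prob A * prob B\<bar> \<le> \<alpha>"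
  shows "\<bar>expectation (\<lambda>\<omega>. X \<omega> * Y \<omega>) - expectation X * expectation Y\<bar> \<le> p * q * \<alpha>"
proof -
  have sp: "space F = space M" "space G = space M" using F G by (auto simp: subalgebra_def)
  have "{\<omega>\<in>space F. u \<le> X \<omega>} \<in> sets F" "{\<omega>\<in>space G. u \<le> Y \<omega>} \<in> sets G" for u
    using X Y by measurable
  then show ?thesis
    using bX bY p q mix measurable_from_subalg[OF F X] measurable_from_subalg[OF G Y]
    by (intro cov_le_range[of X Y a p b q \<alpha>]) (auto simp: sp)
qed

end

section \<open>Truncation and Davydov's inequality\<close>

definition clip :: "real \<Rightarrow> real \<Rightarrow> real" where
  "clip q x = max (- q) (min q x)"

lemma clip_measurable [measurable]: "clip q \<in> borel_measurable borel"
  unfolding clip_def by measurable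

lemma abs_clip: "0 \<le> q \<Longrightarrow> \<bar>clip q x\<bar> = min q \<bar>x\<bar>"
  by (auto simp: clip_def)

text \<open>Clipping keeps signs and shrinks, so the difference is at most
  \<open>\<bar>x * y\<bar>\<close>, and it vanishes unless the larger modulus \<open>m\<close>
  exceeds \<open>q\<close>. In that case \<open>m\<^sup>2 = m powr (2 - s) * m powr s\<close>, and
  the first factor is at most \<open>q powr (2 - s)\<close>.\<close>

lemma clip_mult_error:
  fixes x y q s :: real
  assumes "q \<ge> 1" "s \<ge> 2"
  shows "\<bar>x * y - clip q x * clip q y\<bar> \<le> q powr (2 - s) * (\<bar>x\<bar> powr s + \<bar>y\<bar> powr s)"
proof -
  have key: "\<bar>x * y\<bar> \<le> q powr (2 - s) * (\<bar>x\<bar> powr s + \<bar>y\<bar> powr s)" if "\<bar>x\<bar> > q \<or> \<bar>y\<bar> > q"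
  proof -
    define m where "m = max \<bar>x\<bar> \<bar>y\<bar>"
    have mq: "m > q" using that by (auto simp: m_def)
    have "\<bar>x * y\<bar> \<le> m * m" unfolding abs_mult m_def by (intro mult_mono) auto
    also have "\<dots> = m powr (2 - s) * m powr s" using mq assms by (simp add: powr_add[symmetric] power2_eq_square)
    also have "\<dots> \<le> q powr (2 - s) * m powr s"
      using mq assms by (intro mult_right_mono powr_mono2') auto
    also have "\<dots> \<le> q powr (2 - s) * (\<bar>x\<bar> powr s + \<bar>y\<bar> powr s)"
      by (intro mult_left_mono) (auto simp: m_def max_def)
    finally show ?thesis .
  qed
  show ?thesis
  proof (cases "\<bar>x\<bar> > q \<or> \<bar>y\<bar> > q")
    case True
    have 1: "\<bar>clip q x * clip q y\<bar> \<le> \<bar>x * y\<bar>" unfolding abs_mult using assms by (intro mult_mono) (auto simp: abs_clip)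
    have 2: "0 \<le> clip q x * x" "0 \<le> clip q y * y" for x y using assms by (auto simp: clip_def max_def min_def zero_le_mult_iff)
    have "0 \<le> (clip q x * x) * (clip q y * y)" by (intro mult_nonneg_nonneg 2)
    then have "0 \<le> (clip q x * clip q y) * (x * y)" by (simp add: mult_ac)
    with 1 have "\<bar>x * y - clip q x * clip q y\<bar> \<le> \<bar>x * y\<bar>"
      by (auto simp: zero_le_mult_iff)
    then show ?thesis using key[OF True] by linarith
  next
    case False
    then have "clip q x = x" "clip q y = y" by (auto simp: clip_def)
    then show ?thesis by simp
  qed
qed

text \<open>Beyond the level, \<open>\<bar>x\<bar> powr (1 - s)\<close> is at most
  \<open>q powr (1 - s)\<close>. With \<open>q = \<tau>\<close> this becomes the tail estimate whose
  mean is of order \<open>a h\<close>.\<close>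

lemma clip_error:
  fixes x q s :: real
  assumes "q > 0" "s \<ge> 1"
  shows "\<bar>x - clip q x\<bar> \<le> q powr (1 - s) * \<bar>x\<bar> powr s"
proof (cases "\<bar>x\<bar> > q")
  case True
  have "\<bar>x - clip q x\<bar> \<le> \<bar>x\<bar>" using True assms by (auto simp: clip_def)
  also have "\<bar>x\<bar> = \<bar>x\<bar> powr (1 - s) * \<bar>x\<bar> powr s" using True assms by (simp add: powr_add[symmetric])
  also have "\<dots> \<le> q powr (1 - s) * \<bar>x\<bar> powr s"
    using True assms by (intro mult_right_mono powr_mono2') auto
  finally show ?thesis .
next
  case False
  then have "clip q x = x" by (auto simp: clip_def)
  then show ?thesis by simp
qed

lemma abs_mult_le_sum_squares: "\<bar>x * y\<bar> \<le> x\<^sup>2 + y\<^sup>2" for x y :: real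
proof -
  have "2 * \<bar>x * y\<bar> \<le> x\<^sup>2 + y\<^sup>2"
    using sum_squares_bound[of "\<bar>x\<bar>" "\<bar>y\<bar>"] by (simp add: abs_mult mult.assoc)
  then show ?thesis using abs_ge_zero[of "x * y"] by linarith
qed

lemma abs_le_one_plus_powr:
  fixes x s :: real
  assumes "s \<ge> 1" shows "\<bar>x\<bar> \<le> 1 + \<bar>x\<bar> powr s"
proof (cases "\<bar>x\<bar> \<le> 1")
  case False
  then have "\<bar>x\<bar> powr 1 \<le> \<bar>x\<bar> powr s" using assms by (intro powr_mono) auto
  then show ?thesis using False by simp
qed (simp add: add_increasing2)

lemma square_le_one_plus_powr:
  fixes x s :: real
  assumes "s \<ge> 2" shows "x\<^sup>2 \<le> 1 + \<bar>x\<bar> powr s"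
proof (cases "\<bar>x\<bar> \<le> 1")
  case True
  then have "x\<^sup>2 \<le> 1" by (simp add: abs_square_le_1)
  then show ?thesis by (simp add: add_increasing2)
next
  case False
  then have "\<bar>x\<bar> powr 2 \<le> \<bar>x\<bar> powr s" using assms by (intro powr_mono) auto
  then show ?thesis using False by simp
qed

context prob_space begin

lemma integrable_of_moment:
  fixes X :: "'a \<Rightarrow> real"
  assumes [measurable]: "random_variable borel X" and i: "integrable M (\<lambda>\<omega>. \<bar>X \<omega>\<bar> powr s)" and s: "s \<ge> 1"
  shows "integrable M X"
proof (rule Bochner_Integration.integrable_bound)
  show "integrable M (\<lambda>\<omega>. 1 + \<bar>X \<omega>\<bar> powr s)" using i by simp
  show "AE x in M. norm (X x) \<le> norm (1 + \<bar>X x\<bar> powr s)"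
    using abs_le_one_plus_powr[OF s] by (auto intro!: AE_I2 order_trans[OF _ abs_ge_self])
qed simp

text \<open>Davydov's covariance inequality, by truncation at a level chosen later.\<close>

lemma cov_le_moment:
  fixes X Y :: "'a \<Rightarrow> real"
  assumes F: "subalgebra M F" and G: "subalgebra M G"
    and X: "X \<in> borel_measurable F" and Y: "Y \<in> borel_measurable G"
    and iX: "integrable M (\<lambda>\<omega>. \<bar>X \<omega>\<bar> powr s)" and iY: "integrable M (\<lambda>\<omega>. \<bar>Y \<omega>\<bar> powr s)"
    and BX: "expectation (\<lambda>\<omega>. \<bar>X \<omega>\<bar> powr s) \<le> B" and BY: "expectation (\<lambda>\<omega>. \<bar>Y \<omega>\<bar> powr s) \<le> B"
    and B: "B \<ge> 1" and q: "q \<ge> 1" and s: "s > 2"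
    and mix: "\<And>A B. A \<in> sets F \<Longrightarrow> B \<in> sets G \<Longrightarrow> \<bar>prob (A \<inter> B) - prob A * prob B\<bar> \<le> \<alpha>"
  shows "\<bar>expectation (\<lambda>\<omega>. X \<omega> * Y \<omega>) - expectation X * expectation Y\<bar>
     \<le> 4 * q\<^sup>2 * \<alpha> + 6 * B\<^sup>2 * q powr (2 - s)"
proof -
  have [measurable]: "random_variable borel X" "random_variable borel Y"
    using measurable_from_subalg[OF F X] measurable_from_subalg[OF G Y] by auto
  define X' where "X' \<omega> = clip q (X \<omega>)" for \<omega>
  define Y' where "Y' \<omega> = clip q (Y \<omega>)" for \<omega>
  have X': "X' \<in> borel_measurable F" unfolding X'_def using X by measurable
  have Y': "Y' \<in> borel_measurable G" unfolding Y'_def using Y by measurable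
  have [measurable]: "random_variable borel X'" "random_variable borel Y'"
    using measurable_from_subalg[OF F X'] measurable_from_subalg[OF G Y'] by auto
  have b': "\<bar>X' \<omega>\<bar> \<le> q" "\<bar>Y' \<omega>\<bar> \<le> q" for \<omega> using q by (auto simp: X'_def Y'_def abs_clip)
  \<comment> \<open>The clipped variables lie in an interval of length \<open>2 * q\<close>, which
    gives the factor 4.\<close>
  have c: "\<bar>expectation (\<lambda>\<omega>. X' \<omega> * Y' \<omega>) - expectation X' * expectation Y'\<bar> \<le> (2*q) * (2*q) * \<alpha>"
    by (rule cov_le_subalgebra[OF F G X' Y', of "-q" _ "-q"]) (use b' q mix in \<open>auto simp: abs_le_iff minus_le_iff\<close>)
  have i: "integrable M X" "integrable M Y" "integrable M X'" "integrable M Y'"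
    using integrable_of_moment[OF _ iX] integrable_of_moment[OF _ iY] s b'
    by (auto intro!: integrable_const_bound[of _ q])
  have iXY': "integrable M (\<lambda>\<omega>. X' \<omega> * Y' \<omega>)"
    using b' q by (intro integrable_const_bound[of _ "q * q"]) (auto simp: abs_mult intro!: mult_mono)
  have sq: "integrable M (\<lambda>\<omega>. (X \<omega>)\<^sup>2)" "integrable M (\<lambda>\<omega>. (Y \<omega>)\<^sup>2)"
    by (rule Bochner_Integration.integrable_bound[of _ "\<lambda>\<omega>. 1 + \<bar>X \<omega>\<bar> powr s"],
        use iX s square_le_one_plus_powr[of s] in \<open>auto intro!: AE_I2 order_trans[OF _ abs_ge_self]\<close>,
        rule Bochner_Integration.integrable_bound[of _ "\<lambda>\<omega>. 1 + \<bar>Y \<omega>\<bar> powr s"],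
        use iY s square_le_one_plus_powr[of s] in \<open>auto intro!: AE_I2 order_trans[OF _ abs_ge_self]\<close>)
  have iXY: "integrable M (\<lambda>\<omega>. X \<omega> * Y \<omega>)"
  proof (rule Bochner_Integration.integrable_bound)
    show "integrable M (\<lambda>\<omega>. (X \<omega>)\<^sup>2 + (Y \<omega>)\<^sup>2)" using sq by simp
    show "AE x in M. norm (X x * Y x) \<le> norm ((X x)\<^sup>2 + (Y x)\<^sup>2)" using abs_mult_le_sum_squares by simp
  qed simp
  have "\<bar>expectation (\<lambda>\<omega>. X \<omega> * Y \<omega>) - expectation (\<lambda>\<omega>. X' \<omega> * Y' \<omega>)\<bar>
     \<le> expectation (\<lambda>\<omega>. q powr (2 - s) * (\<bar>X \<omega>\<bar> powr s + \<bar>Y \<omega>\<bar> powr s))"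
    using iX iY s q iXY iXY' by (intro expectation_diff_le_AE AE_I2) (auto simp: X'_def Y'_def intro!: clip_mult_error)
  also have "\<dots> = q powr (2 - s) * (expectation (\<lambda>\<omega>. \<bar>X \<omega>\<bar> powr s) + expectation (\<lambda>\<omega>. \<bar>Y \<omega>\<bar> powr s))"
    using iX iY by simp
  also have "\<dots> \<le> q powr (2 - s) * (2 * B)"
    using BX BY by (intro mult_left_mono) auto
  finally have 1: "\<bar>expectation (\<lambda>\<omega>. X \<omega> * Y \<omega>) - expectation (\<lambda>\<omega>. X' \<omega> * Y' \<omega>)\<bar> \<le> \<dots>" .
  have dX: "\<bar>expectation Z - expectation (\<lambda>\<omega>. clip q (Z \<omega>))\<bar> \<le> q powr (1 - s) * B"
    if Z: "integrable M Z" "integrable M (\<lambda>\<omega>. clip q (Z \<omega>))" "integrable M (\<lambda>\<omega>. \<bar>Z \<omega>\<bar> powr s)"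
      "expectation (\<lambda>\<omega>. \<bar>Z \<omega>\<bar> powr s) \<le> B" for Z
  proof -
    have "\<bar>expectation Z - expectation (\<lambda>\<omega>. clip q (Z \<omega>))\<bar> \<le> expectation (\<lambda>\<omega>. q powr (1 - s) * \<bar>Z \<omega>\<bar> powr s)"
      using Z q s by (intro expectation_diff_le_AE AE_I2) (auto intro!: clip_error)
    also have "\<dots> \<le> q powr (1 - s) * B" using Z by (auto intro: mult_left_mono)
    finally show ?thesis .
  qed
  have dX': "\<bar>expectation X - expectation X'\<bar> \<le> q powr (1 - s) * B"
    and dY': "\<bar>expectation Y - expectation Y'\<bar> \<le> q powr (1 - s) * B"
    using dX[of X] dX[of Y] i iX iY BX BY by (auto simp: X'_def[abs_def] Y'_def[abs_def])
  have eY: "\<bar>expectation Y\<bar> \<le> 1 + B"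
  proof -
    have "\<bar>expectation Y\<bar> \<le> expectation (\<lambda>\<omega>. \<bar>Y \<omega>\<bar>)" using integral_norm_bound[of M Y] by simp
    also have "\<dots> \<le> expectation (\<lambda>\<omega>. 1 + \<bar>Y \<omega>\<bar> powr s)" using i iY s by (intro integral_mono abs_le_one_plus_powr) auto
    also have "\<dots> \<le> 1 + B" using iY BY by (simp add: prob_space)
    finally show ?thesis .
  qed
  \<comment> \<open>The crude bound \<open>q\<close> is enough: multiplied by the clipping error
    \<open>q powr (1 - s)\<close> of the other mean it gives \<open>q powr (2 - s)\<close>, the
    order of the remaining terms.\<close>
  have eX': "\<bar>expectation X'\<bar> \<le> q"
  proof -
    have "\<bar>expectation X'\<bar> \<le> expectation (\<lambda>\<omega>. \<bar>X' \<omega>\<bar>)" using integral_norm_bound[of M X'] by simp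
    also have "\<dots> \<le> q" using i b' by (intro integral_le_const) auto
    finally show ?thesis .
  qed
  have "expectation X * expectation Y - expectation X' * expectation Y'
     = (expectation X - expectation X') * expectation Y + expectation X' * (expectation Y - expectation Y')"
    by (simp add: algebra_simps)
  then have "\<bar>expectation X * expectation Y - expectation X' * expectation Y'\<bar>
     \<le> \<bar>expectation X - expectation X'\<bar> * \<bar>expectation Y\<bar> + \<bar>expectation X'\<bar> * \<bar>expectation Y - expectation Y'\<bar>"
    by (metis abs_mult abs_triangle_ineq)
  also have "\<dots> \<le> (q powr (1 - s) * B) * (1 + B) + q * (q powr (1 - s) * B)"
    using dX' dY' eY eX' by (intro add_mono mult_mono) auto
  also have "\<dots> \<le> q powr (2 - s) * B * (1 + B) + q powr (2 - s) * B"
  proof (intro add_mono)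
    show "q powr (1 - s) * B * (1 + B) \<le> q powr (2 - s) * B * (1 + B)"
      using q B by (intro mult_right_mono powr_mono) auto
    have "q * q powr (1 - s) = q powr (2 - s)" using q by (simp add: powr_mult_base)
    then show "q * (q powr (1 - s) * B) \<le> q powr (2 - s) * B" by (simp add: mult.assoc[symmetric])
  qed
  finally have 2: "\<bar>expectation X * expectation Y - expectation X' * expectation Y'\<bar> \<le> \<dots>" .
  \<comment> \<open>\<open>B\<close> bounds s-th moments, not norms; since \<open>B \<ge> 1\<close>,
    all its powers are absorbed into \<open>B\<^sup>2\<close>.\<close>
  have "q powr (2 - s) * (2 * B) + (q powr (2 - s) * B * (1 + B) + q powr (2 - s) * B) = q powr (2 - s) * (4 * B + B\<^sup>2)"
    by (simp add: algebra_simps power2_eq_square)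
  also have "\<dots> \<le> q powr (2 - s) * (6 * B\<^sup>2)"
    using B by (intro mult_left_mono) (auto simp: power2_eq_square)
  finally show ?thesis using 1 2 c by (simp add: power2_eq_square mult_ac)
qed

end

section \<open>Exponential inequality for window sums\<close>

text \<open>For \<open>z = - u\<close> with \<open>u > 0\<close> it suffices that
  \<open>(1 - u + u\<^sup>2) * exp u\<close> is at least 1. Replacing \<open>exp u\<close> by its
  quadratic Taylor polynomial gives a product with constant term 1, no linear term and positive
  higher coefficients.\<close>

lemma exp_le_quadratic:
  fixes z :: real
  assumes "\<bar>z\<bar> \<le> 1" shows "exp z \<le> 1 + z + z\<^sup>2"
proof (cases "z \<ge> 0")
  case True
  then show ?thesis using assms by (intro exp_bound) auto
next
  case False
  define u where "u = - z"
  have u: "0 \<le> u" using False by (simp add: u_def)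
  have "1 \<le> (1 - u + u\<^sup>2) * (1 + u + u\<^sup>2 / 2)"
  proof -
    have "(1 - u + u\<^sup>2) * (1 + u + u\<^sup>2 / 2) = 1 + (u^2/2 + u^3/2 + u^4/2)"
      by (simp add: field_simps power2_eq_square power3_eq_cube power4_eq_xxxx)
    then show ?thesis using u by simp
  qed
  also have "\<dots> \<le> (1 - u + u\<^sup>2) * exp u"
  proof (rule mult_left_mono)
    show "1 + u + u\<^sup>2 / 2 \<le> exp u" using exp_lower_Taylor_quadratic[OF u] .
    have "1 - u + u\<^sup>2 = (1 - u/2)\<^sup>2 + 3/4 * u\<^sup>2" by (simp add: power2_eq_square field_simps)
    then show "0 \<le> 1 - u + u\<^sup>2" by simp
  qed
  finally have "exp (- u) \<le> 1 - u + u\<^sup>2" by (simp add: exp_minus field_simps)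
  then show ?thesis by (simp add: u_def)
qed

context prob_space begin

text \<open>An exponential inequality under strong mixing without coupling. The process
  \<open>exp (S k)\<close> is killed when \<open>S k\<close> (the sum minus its compensator) first exceeds
  \<open>y\<close>. It stays below \<open>exp y\<close> before, so each step costs at most
  \<open>\<alpha> exp (y + 1)\<close>, and the factor \<open>exp y\<close> cancels against the level that is exceeded.\<close>

lemma sum_tail_mixing:
  fixes U :: "nat \<Rightarrow> 'a \<Rightarrow> real" and F G :: "nat \<Rightarrow> 'a measure"
  assumes F: "\<And>k. k < p \<Longrightarrow> subalgebra M (F k)" and G: "\<And>k. k < p \<Longrightarrow> subalgebra M (G k)"
    and UF: "\<And>i k. i < k \<Longrightarrow> k < p \<Longrightarrow> U i \<in> borel_measurable (F k)"
    and UG: "\<And>k. k < p \<Longrightarrow> U k \<in> borel_measurable (G k)"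
    and mix: "\<And>k A B. k < p \<Longrightarrow> A \<in> sets (F k) \<Longrightarrow> B \<in> sets (G k) \<Longrightarrow>
                \<bar>prob (A \<inter> B) - prob A * prob B\<bar> \<le> \<alpha>"
    and \<alpha>: "0 \<le> \<alpha>"
    and U1: "\<And>k \<omega>. k < p \<Longrightarrow> \<omega> \<in> space M \<Longrightarrow> \<bar>U k \<omega>\<bar> \<le> 1"
    and EU: "\<And>k. k < p \<Longrightarrow> expectation (U k) = 0"
    and VU: "\<And>k. k < p \<Longrightarrow> expectation (\<lambda>\<omega>. (U k \<omega>)\<^sup>2) \<le> v"
    and v: "0 \<le> v" and y: "0 \<le> y"
  shows "prob {\<omega> \<in> space M. (\<Sum>k<p. U k \<omega>) > y + real p * v} \<le> exp (- y) + 3 * real p * \<alpha>"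
proof -
  define S where "S k \<omega> = (\<Sum>i<k. U i \<omega>) - real k * v" for k \<omega>
  \<comment> \<open>\<open>J k\<close> is 1 as long as none of \<open>S 0\<close>, ...,
    \<open>S k\<close> has exceeded \<open>y\<close>, and 0 from then on.\<close>
  define J where "J k \<omega> = (\<Prod>i\<le>k. indicator {..y} (S i \<omega>) :: real)" for k \<omega>
  define W where "W k \<omega> = exp (S k \<omega>) * J k \<omega>" for k \<omega>
  define R where "R k \<omega> = exp (U k \<omega> - v)" for k \<omega>
  have UM: "U k \<in> borel_measurable M" if "k < p" for k
    using measurable_from_subalg[OF G[OF that] UG[OF that]] .
  have SM: "S k \<in> borel_measurable N" if "\<And>i. i < k \<Longrightarrow> U i \<in> borel_measurable N" for k and N :: "'a measure"
    unfolding S_def using that by (intro borel_measurable_diff borel_measurable_sum) auto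
  have JM: "J k \<in> borel_measurable N" if "\<And>i. i < k \<Longrightarrow> U i \<in> borel_measurable N" for k and N :: "'a measure"
    unfolding J_def using that by (intro borel_measurable_prod measurable_compose[OF SM]) auto
  have WM: "W k \<in> borel_measurable N" if "\<And>i. i < k \<Longrightarrow> U i \<in> borel_measurable N" for k and N :: "'a measure"
    unfolding W_def using that by (intro borel_measurable_times measurable_compose[OF SM] JM) auto
  have J01: "J k \<omega> \<in> {0, 1}" for k \<omega>
    unfolding J_def by (induction k) (auto simp: indicator_def)
  have J01': "0 \<le> J k \<omega>" "J k \<omega> \<le> 1" for k \<omega> using J01[of k \<omega>] by (auto simp only: insert_iff empty_iff)
  have JS: "J (Suc k) \<omega> = J k \<omega> * indicator {..y} (S (Suc k) \<omega>)" for k \<omega>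
    unfolding J_def by simp
  have J1: "S k \<omega> \<le> y" if "J k \<omega> \<noteq> 0" for k \<omega>
    using that unfolding J_def by (auto simp: indicator_def)
  have W0: "0 \<le> W k \<omega>" for k \<omega> unfolding W_def using J01' by simp
  have Wy: "W k \<omega> \<le> exp y" for k \<omega>
    using J1[of k \<omega>] J01[of k \<omega>] by (auto simp: W_def)
  have iJ: "integrable M (J k)" if "k \<le> p" for k
    using J01' JM[of k M] UM that by (auto intro!: integrable_const_bound[of _ 1])
  have iW: "integrable M (W k)" if "k \<le> p" for k
    using W0 Wy WM[of k M] UM that by (auto intro!: integrable_const_bound[of _ "exp y"])
  \<comment> \<open>The invariant adds to the mass still alive a charge \<open>exp y\<close> for
    every path killed so far. It starts at 1 and grows by at most
    \<open>3 * \<alpha> * exp y\<close> per step; division by \<open>exp y\<close> at the end bounds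
    the probability of having been killed.\<close>
  have claim: "expectation (W k) + exp y * (1 - expectation (J k)) \<le> 1 + 3 * \<alpha> * real k * exp y" if "k \<le> p" for k
    using that
  proof (induction k)
    case 0
    have "W 0 = (\<lambda>_. 1)" "J 0 = (\<lambda>_. 1)" using y by (auto simp: W_def J_def S_def)
    then show ?case by (simp add: prob_space)
  next
    case (Suc k)
    then have k: "k < p" by simp
    have RG: "R k \<in> borel_measurable (G k)" unfolding R_def using UG[OF k] by measurable
    have RM[measurable]: "R k \<in> borel_measurable M" unfolding R_def using UM[OF k] by measurable
    have R0: "0 \<le> R k \<omega>" for \<omega> by (simp add: R_def)
    have R1: "R k \<omega> \<le> exp 1" if "\<omega> \<in> space M" for \<omega> using U1[OF k that] v by (simp add: R_def)
    have [measurable]: "W k \<in> borel_measurable M" "U k \<in> borel_measurable M" using iW k UM by auto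
    have iR: "integrable M (R k)" using R0 R1 by (auto intro!: integrable_const_bound[of _ "exp 1"] AE_I2)
    have iWR: "integrable M (\<lambda>\<omega>. W k \<omega> * R k \<omega>)"
      using R0 R1 W0 Wy by (auto intro!: integrable_const_bound[of _ "exp y * exp 1"] AE_I2 mult_mono simp: abs_mult)
    have iU: "integrable M (U k)" "integrable M (\<lambda>\<omega>. (U k \<omega>)\<^sup>2)"
      using U1[OF k] by (auto intro!: integrable_const_bound[of _ 1] AE_I2 simp: abs_square_le_1)
    \<comment> \<open>A surviving path carries \<open>W k * R k\<close> on. A path killed at this
      step has \<open>exp (S (Suc k)) > exp y\<close>, so its mass pays the charge.\<close>
    have pw: "W (Suc k) \<omega> + exp y * (J k \<omega> - J (Suc k) \<omega>) \<le> W k \<omega> * R k \<omega>" for \<omega>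
    proof (cases "J k \<omega> = 0")
      case True
      then show ?thesis by (simp add: W_def JS)
    next
      case False
      then have 1: "J k \<omega> = 1" using J01[of k \<omega>] by simp
      have S: "exp (S (Suc k) \<omega>) = exp (S k \<omega>) * R k \<omega>"
        by (simp add: S_def R_def exp_add[symmetric] algebra_simps)
      have "exp y \<le> exp (S k \<omega>) * R k \<omega>" if "\<not> S (Suc k) \<omega> \<le> y"
        using that by (simp flip: S)
      then show ?thesis using 1 S by (auto simp: W_def JS indicator_def)
    qed
    \<comment> \<open>This is what the compensator \<open>v\<close> is for: by the quadratic bound
      the mean of \<open>exp (U k)\<close> is at most \<open>1 + v\<close>, hence at most
      \<open>exp v\<close>.\<close>
    have ER: "expectation (R k) \<le> 1"
    proof -
      have "expectation (R k) \<le> expectation (\<lambda>\<omega>. exp (- v) * (1 + U k \<omega> + (U k \<omega>)\<^sup>2))"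
        using iR iU exp_le_quadratic[OF U1[OF k]]
        by (intro integral_mono) (auto simp: R_def exp_diff exp_minus field_simps)
      also have "\<dots> = exp (- v) * (1 + expectation (\<lambda>\<omega>. (U k \<omega>)\<^sup>2))"
        using iU EU[OF k] by (simp add: prob_space)
      also have "\<dots> \<le> exp (- v) * exp v"
      proof (rule mult_left_mono)
        show "1 + expectation (\<lambda>\<omega>. (U k \<omega>)\<^sup>2) \<le> exp v"
          using VU[OF k] exp_ge_add_one_self[of v] by linarith
      qed simp
      finally show ?thesis by (simp add: exp_minus)
    qed
    have WF: "W k \<in> borel_measurable (F k)" by (rule WM) (use UF k in auto)
    \<comment> \<open>The ranges are \<open>exp y\<close> for \<open>W k\<close> and
      \<open>exp 1\<close> for \<open>R k\<close>; the 3 in the final bound is a bound for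
      \<open>exp 1\<close>.\<close>
    have "\<bar>expectation (\<lambda>\<omega>. W k \<omega> * R k \<omega>) - expectation (W k) * expectation (R k)\<bar> \<le> exp y * exp 1 * \<alpha>"
      by (rule cov_le_subalgebra[OF F[OF k] G[OF k] WF RG, of 0 _ 0]) (use W0 Wy R0 R1 mix[OF k] in auto)
    moreover have "expectation (W k) * expectation (R k) \<le> expectation (W k) * 1"
      using ER W0 by (intro mult_left_mono) auto
    moreover have "exp y * exp 1 * \<alpha> \<le> exp y * 3 * \<alpha>"
      using exp_le \<alpha> by (intro mult_right_mono mult_left_mono) auto
    ultimately have c: "expectation (\<lambda>\<omega>. W k \<omega> * R k \<omega>) \<le> expectation (W k) + 3 * \<alpha> * exp y" by (simp add: mult_ac)
    have "expectation (\<lambda>\<omega>. W (Suc k) \<omega> + exp y * (J k \<omega> - J (Suc k) \<omega>)) \<le> expectation (\<lambda>\<omega>. W k \<omega> * R k \<omega>)"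
      using iW[of "Suc k"] iJ[of k] iJ[of "Suc k"] Suc.prems iWR pw by (intro integral_mono) auto
    also have "expectation (\<lambda>\<omega>. W (Suc k) \<omega> + exp y * (J k \<omega> - J (Suc k) \<omega>)) =
      expectation (W (Suc k)) + exp y * (expectation (J k) - expectation (J (Suc k)))"
      using iW[of "Suc k"] iJ[of k] iJ[of "Suc k"] Suc.prems by simp
    finally show ?case using Suc.IH k c by (simp add: algebra_simps)
  qed
  have [measurable]: "S p \<in> borel_measurable M" by (rule SM) (use UM in auto)
  define Q where "Q = {\<omega> \<in> space M. S p \<omega> > y}"
  have Q[measurable]: "Q \<in> events" unfolding Q_def by measurable
  have "prob Q = expectation (indicator Q)" by simp
  also have "\<dots> \<le> expectation (\<lambda>\<omega>. 1 - J p \<omega>)"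
  proof (rule integral_mono)
    show "integrable M (indicator Q :: 'a \<Rightarrow> real)"
      by (rule integrable_const_bound[where B=1]) auto
    show "integrable M (\<lambda>\<omega>. 1 - J p \<omega>)" using iJ[of p] by simp
    show "indicator Q \<omega> \<le> 1 - J p \<omega>" for \<omega>
      using J1[of p \<omega>] J01[of p \<omega>] by (auto simp: Q_def indicator_def)
  qed
  also have "\<dots> = 1 - expectation (J p)" using iJ[of p] by (simp add: prob_space)
  finally have "exp y * prob Q \<le> exp y * (1 - expectation (J p))" by (intro mult_left_mono) auto
  also have "\<dots> \<le> 1 + 3 * \<alpha> * real p * exp y" using claim[of p] W0 by (simp add: order_trans[OF _ claim[of p]])
  finally have "prob Q \<le> (1 + 3 * \<alpha> * real p * exp y) / exp y" by (simp add: field_simps)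
  also have "\<dots> = exp (- y) + 3 * real p * \<alpha>" by (simp add: field_simps exp_minus)
  finally show ?thesis unfolding Q_def S_def by (simp add: algebra_simps less_diff_eq)
qed

end

section \<open>Variances of block sums\<close>

text \<open>A bound for covariances at lag \<open>k\<close> in units of \<open>B\<^sup>2\<close>.
  The factor \<open>4 * A + 6\<close> collects the two terms of Davydov's inequality; the value 2 at
  lag 0 comes from \<open>1 + B \<le> 2 * B\<^sup>2\<close>.\<close>

definition lag_bound :: "real \<Rightarrow> real \<Rightarrow> nat \<Rightarrow> real" where
  "lag_bound A \<eta> k = (if k = 0 then 2 else (4 * A + 6) * real k powr (- \<eta>))"

text \<open>Lags occur on both sides of an index, hence the factor 2.\<close>

definition block_var :: "real \<Rightarrow> real \<Rightarrow> real" where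
  "block_var A \<eta> = 2 * (\<Sum>k. lag_bound A \<eta> k)"

lemma summable_lag_bound: "\<eta> > 1 \<Longrightarrow> summable (lag_bound A \<eta>)"
proof -
  assume "\<eta> > 1"
  then have "summable (\<lambda>k. (4 * A + 6) * real k powr (- \<eta>))"
    by (intro summable_mult) (simp add: summable_real_powr_iff)
  then have "summable (\<lambda>k. lag_bound A \<eta> (Suc k))"
    by (subst (asm) summable_Suc_iff[symmetric]) (simp add: lag_bound_def)
  then show ?thesis by (simp only: summable_Suc_iff)
qed

lemma lag_bound_nonneg: "A > 0 \<Longrightarrow> 0 \<le> lag_bound A \<eta> k"
  by (simp add: lag_bound_def)

text \<open>On either side of \<open>i\<close>, distinct indices have distinct lags, so each half is
  a part of the convergent series.\<close>

lemma sum_lag_bound_le: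
  assumes "A > 0" "\<eta> > 1" "finite I"
  shows "(\<Sum>j\<in>I. lag_bound A \<eta> (if i \<le> j then j - i else i - j)) \<le> block_var A \<eta>"
proof -
  have half: "(\<Sum>j\<in>I'. lag_bound A \<eta> (g j)) \<le> suminf (lag_bound A \<eta>)" if "inj_on g I'" "finite I'" for g :: "nat \<Rightarrow> nat" and I'
  proof -
    have "(\<Sum>j\<in>I'. lag_bound A \<eta> (g j)) = (\<Sum>k\<in>g`I'. lag_bound A \<eta> k)" using that by (simp add: sum.reindex)
    also have "\<dots> \<le> suminf (lag_bound A \<eta>)"
      using that assms summable_lag_bound lag_bound_nonneg by (intro sum_le_suminf) auto
    finally show ?thesis .
  qed
  have "(\<Sum>j\<in>I. lag_bound A \<eta> (if i \<le> j then j - i else i - j)) =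
     (\<Sum>j\<in>I \<inter> {j. i \<le> j}. lag_bound A \<eta> (j - i)) + (\<Sum>j\<in>I \<inter> - {j. i \<le> j}. lag_bound A \<eta> (i - j))"
    using assms(3) by (simp add: sum.If_cases if_distrib)
  also have "\<dots> \<le> suminf (lag_bound A \<eta>) + suminf (lag_bound A \<eta>)"
    using assms(3) by (intro add_mono half) (auto simp: inj_on_def)
  finally show ?thesis by (simp add: block_var_def)
qed

text \<open>One row of the array at a fixed parameter. \<open>B\<close> bounds an s-th moment, and
  \<open>eta_gt\<close> makes the Davydov covariances summable over the lag.\<close>

locale mixing_array = prob_space M for M :: "'a measure" +
  fixes X :: "nat \<Rightarrow> 'a \<Rightarrow> real" and T :: nat and A \<beta> s B :: real
  assumes X_meas: "\<And>i. i \<in> {1..T} \<Longrightarrow> X i \<in> borel_measurable M"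
    and mixing: "\<And>k. 1 \<le> k \<Longrightarrow> mixing_coef M X T (int k) \<le> A * real k powr (- \<beta>)"
    and A_pos: "A > 0" and s_gt: "s > 2" and eta_gt: "\<beta> * (1 - 2 / s) > 1" and B_ge: "B \<ge> 1"
    and moment_integrable: "\<And>i. i \<in> {1..T} \<Longrightarrow> integrable M (\<lambda>\<omega>. \<bar>X i \<omega>\<bar> powr s)"
    and moment: "\<And>i. i \<in> {1..T} \<Longrightarrow> expectation (\<lambda>\<omega>. \<bar>X i \<omega>\<bar> powr s) \<le> B"
begin

abbreviation "\<eta> \<equiv> \<beta> * (1 - 2 / s)"

lemma mixing_events:
  assumes "1 \<le> k" "I \<subseteq> {1..T}" "J \<subseteq> {1..T}" "\<And>i j. i \<in> I \<Longrightarrow> j \<in> J \<Longrightarrow> i + k \<le> j"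
    and "C \<in> sets (sigI M X I)" "D \<in> sets (sigI M X J)"
  shows "\<bar>prob (C \<inter> D) - prob C * prob D\<bar> \<le> A * real k powr (- \<beta>)"
  by (rule mixing_coef_bound[OF X_meas mixing]) (use assms A_pos in auto)

lemma transform_moment:
  assumes [measurable]: "f \<in> borel_measurable borel" and f: "\<And>u. \<bar>f u\<bar> \<le> \<bar>u\<bar>" and i: "i \<in> {1..T}"
  shows "integrable M (\<lambda>\<omega>. \<bar>f (X i \<omega>)\<bar> powr s)" "expectation (\<lambda>\<omega>. \<bar>f (X i \<omega>)\<bar> powr s) \<le> B"
    "integrable M (\<lambda>\<omega>. f (X i \<omega>))" "integrable M (\<lambda>\<omega>. (f (X i \<omega>))\<^sup>2)"
    "expectation (\<lambda>\<omega>. (f (X i \<omega>))\<^sup>2) \<le> 1 + B"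
proof -
  have [measurable]: "X i \<in> borel_measurable M" using X_meas[OF i] .
  have le: "\<bar>f u\<bar> powr s \<le> \<bar>u\<bar> powr s" for u using f s_gt by (intro powr_mono2) auto
  show 1: "integrable M (\<lambda>\<omega>. \<bar>f (X i \<omega>)\<bar> powr s)"
    by (rule Bochner_Integration.integrable_bound[OF moment_integrable[OF i]]) (use le in auto)
  show 2: "expectation (\<lambda>\<omega>. \<bar>f (X i \<omega>)\<bar> powr s) \<le> B"
    using integral_mono[OF 1 moment_integrable[OF i] le] moment[OF i] by linarith
  show "integrable M (\<lambda>\<omega>. f (X i \<omega>))"
    by (rule integrable_of_moment[OF _ 1]) (use s_gt in auto)
  have i1: "integrable M (\<lambda>\<omega>. 1 + \<bar>f (X i \<omega>)\<bar> powr s)" using 1 by simp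
  show 3: "integrable M (\<lambda>\<omega>. (f (X i \<omega>))\<^sup>2)"
    by (rule Bochner_Integration.integrable_bound[OF i1])
      (use s_gt square_le_one_plus_powr[of s] in \<open>auto intro!: AE_I2 order_trans[OF _ abs_ge_self]\<close>)
  have "expectation (\<lambda>\<omega>. (f (X i \<omega>))\<^sup>2) \<le> expectation (\<lambda>\<omega>. 1 + \<bar>f (X i \<omega>)\<bar> powr s)"
    using s_gt by (intro integral_mono[OF 3 i1] square_le_one_plus_powr) auto
  also have "\<dots> \<le> 1 + B" using 1 2 by (simp add: prob_space)
  finally show "expectation (\<lambda>\<omega>. (f (X i \<omega>))\<^sup>2) \<le> 1 + B" .
qed

lemma cov_transform_le:
  assumes f: "f \<in> borel_measurable borel" "\<And>u. \<bar>f u\<bar> \<le> \<bar>u\<bar>" and g: "g \<in> borel_measurable borel" "\<And>u. \<bar>g u\<bar> \<le> \<bar>u\<bar>"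
    and ij: "i \<in> {1..T}" "j \<in> {1..T}" "i < j"
  shows "\<bar>expectation (\<lambda>\<omega>. f (X i \<omega>) * g (X j \<omega>)) - expectation (\<lambda>\<omega>. f (X i \<omega>)) * expectation (\<lambda>\<omega>. g (X j \<omega>))\<bar>
    \<le> B\<^sup>2 * lag_bound A \<eta> (j - i)"
proof -
  define k where "k = j - i"
  \<comment> \<open>This level balances the two terms of \<open>cov_le_moment\<close>: both
    \<open>q\<^sup>2 * k powr (- \<beta>)\<close> and \<open>q powr (2 - s)\<close> become
    \<open>k powr (- \<eta>)\<close>.\<close>
  define q where "q = real k powr (\<beta> / s)"
  have k: "1 \<le> k" "i + k = j" using ij by (auto simp: k_def)
  have \<beta>: "\<beta> > 0"
  proof (rule ccontr)
    assume "\<not> \<beta> > 0"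
    then have "\<beta> * (1 - 2 / s) \<le> 0" using s_gt by (intro mult_nonpos_nonneg) auto
    then show False using eta_gt by simp
  qed
  have q: "q \<ge> 1" unfolding q_def using k \<beta> s_gt by (intro ge_one_powr_ge_zero) auto
  have [measurable]: "X i \<in> borel_measurable M" "X j \<in> borel_measurable M" using X_meas ij by auto
  note [measurable] = f(1) g(1)
  have mf: "(\<lambda>\<omega>. f (X i \<omega>)) \<in> borel_measurable (sigI M X {i})" 
    using measurable_sigI[of i "{i}" X M] f(1) by (auto intro: measurable_compose)
  have mg: "(\<lambda>\<omega>. g (X j \<omega>)) \<in> borel_measurable (sigI M X {j})"
    using measurable_sigI[of j "{j}" X M] g(1) by (auto intro: measurable_compose)
  have "\<bar>expectation (\<lambda>\<omega>. f (X i \<omega>) * g (X j \<omega>)) - expectation (\<lambda>\<omega>. f (X i \<omega>)) * expectation (\<lambda>\<omega>. g (X j \<omega>))\<bar>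
    \<le> 4 * q\<^sup>2 * (A * real k powr (- \<beta>)) + 6 * B\<^sup>2 * q powr (2 - s)"
  proof (rule cov_le_moment[OF _ _ mf mg _ _ _ _ B_ge q s_gt])
    show "subalgebra M (sigI M X {i})" "subalgebra M (sigI M X {j})"
      using ij X_meas by (auto intro!: subalgebra_sigI)
    show "\<bar>prob (C \<inter> D) - prob C * prob D\<bar> \<le> A * real k powr - \<beta>"
      if "C \<in> sets (sigI M X {i})" "D \<in> sets (sigI M X {j})" for C D
      using that ij k by (intro mixing_events[of k "{i}" "{j}"]) auto
  qed (use transform_moment[OF f ij(1)] transform_moment[OF g ij(2)] in auto)
  also have "q\<^sup>2 = real k powr (2 * \<beta> / s)"
  proof -
    have "q\<^sup>2 = q powr 2" using q by simp
    then show ?thesis by (simp add: q_def powr_powr mult.commute)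
  qed
  also have "q powr (2 - s) = real k powr (- \<eta>)"
  proof -
    have "\<beta> / s * (2 - s) = - \<eta>" using s_gt by (simp add: field_simps)
    then show ?thesis by (simp add: q_def powr_powr)
  qed
  also have "4 * real k powr (2 * \<beta> / s) * (A * real k powr (- \<beta>)) = 4 * A * real k powr (- \<eta>)"
  proof -
    have "2 * \<beta> / s + - \<beta> = - \<eta>" using s_gt by (simp add: field_simps)
    then have "real k powr (2 * \<beta> / s) * real k powr (- \<beta>) = real k powr (- \<eta>)"
      using powr_add[of "real k" "2 * \<beta> / s" "- \<beta>"] by simp
    then show ?thesis by simp
  qed
  also have "4 * A * real k powr (- \<eta>) + 6 * B\<^sup>2 * real k powr (- \<eta>) \<le> B\<^sup>2 * ((4 * A + 6) * real k powr (- \<eta>))"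
  proof -
    have "4 * A * 1 \<le> 4 * A * B\<^sup>2" using A_pos B_ge by (intro mult_left_mono) auto
    then have "(4 * A + 6 * B\<^sup>2) * real k powr (- \<eta>) \<le> (B\<^sup>2 * (4 * A + 6)) * real k powr (- \<eta>)"
      by (intro mult_right_mono) (auto simp: algebra_simps)
    then show ?thesis by (simp add: algebra_simps)
  qed
  also have "(4 * A + 6) * real k powr (- \<eta>) = lag_bound A \<eta> (j - i)"
    unfolding k_def[symmetric] lag_bound_def using k(1) by auto
  finally show ?thesis .
qed

end

lemma sum_pairs_lessThan:
  fixes g :: "nat \<Rightarrow> real"
  shows "(\<Sum>l<2 * p. g l) = (\<Sum>k<p. g (2 * k)) + (\<Sum>k<p. g (2 * k + 1))"
  by (induction p) (auto simp: algebra_simps)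

context mixing_array begin

definition centered :: "(nat \<Rightarrow> real \<Rightarrow> real) \<Rightarrow> nat \<Rightarrow> 'a \<Rightarrow> real" where
  "centered f i \<omega> = f i (X i \<omega>) - expectation (\<lambda>\<omega>. f i (X i \<omega>))"

text \<open>For each fixed index the covariances with all others are summable, so only the number of
  indices enters. The transformations may depend on the index because they will carry the kernel
  weights.\<close>

lemma variance_centered_sum_le:
  assumes f: "\<And>i. f i \<in> borel_measurable borel" "\<And>i u. \<bar>f i u\<bar> \<le> \<bar>u\<bar>" and I: "I \<subseteq> {1..T}"
  shows "expectation (\<lambda>\<omega>. (\<Sum>i\<in>I. centered f i \<omega>)\<^sup>2) \<le> real (card I) * (block_var A \<eta> * B\<^sup>2)"
proof -
  have fin: "finite I" using I finite_subset by blast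
  have mX: "X i \<in> borel_measurable M" if "i \<in> I" for i using X_meas I that by auto
  define e where "e i = expectation (\<lambda>\<omega>. f i (X i \<omega>))" for i
  have i1: "integrable M (\<lambda>\<omega>. f i (X i \<omega>))" "integrable M (\<lambda>\<omega>. (f i (X i \<omega>))\<^sup>2)" if "i \<in> I" for i
    using transform_moment[OF f(1) f(2), of i i] I that by auto
  have i2: "integrable M (\<lambda>\<omega>. f i (X i \<omega>) * f j (X j \<omega>))" if "i \<in> I" "j \<in> I" for i j
  proof (rule Bochner_Integration.integrable_bound)
    show "integrable M (\<lambda>\<omega>. (f i (X i \<omega>))\<^sup>2 + (f j (X j \<omega>))\<^sup>2)" using i1 that by simp
    show "AE x in M. norm (f i (X i x) * f j (X j x)) \<le> norm ((f i (X i x))\<^sup>2 + (f j (X j x))\<^sup>2)" using abs_mult_le_sum_squares by simp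
    show "(\<lambda>\<omega>. f i (X i \<omega>) * f j (X j \<omega>)) \<in> borel_measurable M"
      using mX f(1) that by (auto intro!: borel_measurable_times intro: measurable_compose)
  qed
  define c where "c i j = expectation (\<lambda>\<omega>. f i (X i \<omega>) * f j (X j \<omega>)) - e i * e j" for i j
  have ec: "integrable M (\<lambda>\<omega>. centered f i \<omega> * centered f j \<omega>) \<and> expectation (\<lambda>\<omega>. centered f i \<omega> * centered f j \<omega>) = c i j" 
    if "i \<in> I" "j \<in> I" for i j
  proof -
    have eq: "(\<lambda>\<omega>. centered f i \<omega> * centered f j \<omega>) = (\<lambda>\<omega>. f i (X i \<omega>) * f j (X j \<omega>) - e j * f i (X i \<omega>) - e i * f j (X j \<omega>) + e i * e j)"
      by (simp add: centered_def e_def algebra_simps)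
    show ?thesis unfolding eq using i1 i2 that by (simp add: prob_space c_def e_def)
  qed
  have cb: "\<bar>c i j\<bar> \<le> B\<^sup>2 * lag_bound A \<eta> (if i \<le> j then j - i else i - j)" if ij: "i \<in> I" "j \<in> I" for i j
  proof -
    consider "i < j" | "j < i" | "i = j" by linarith
    then show ?thesis
    proof cases
      case 1
      then show ?thesis using cov_transform_le[OF f(1,2) f(1,2), of i j i j] subsetD[OF I ij(1)] subsetD[OF I ij(2)] by (auto simp: c_def e_def)
    next
      case 2
      then show ?thesis using cov_transform_le[OF f(1,2) f(1,2), of j i j i] subsetD[OF I ij(1)] subsetD[OF I ij(2)] by (auto simp: c_def e_def mult.commute)
    next
      case 3
      have "c i i = expectation (\<lambda>\<omega>. (f i (X i \<omega>))\<^sup>2) - (e i)\<^sup>2" by (simp add: c_def power2_eq_square)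
      moreover have "expectation (\<lambda>\<omega>. (f i (X i \<omega>))\<^sup>2) \<le> 1 + B" using transform_moment[OF f(1,2), of i i] I ij by auto
      moreover have "c i i \<ge> 0"
      proof -
        have "0 \<le> expectation (\<lambda>\<omega>. centered f i \<omega> * centered f i \<omega>)" by (intro integral_nonneg_AE) auto
        then show ?thesis using ec ij by simp
      qed
      moreover have "1 + B \<le> 2 * B\<^sup>2"
      proof -
        have "B * 1 \<le> B * B" using B_ge by (intro mult_left_mono) auto
        then show ?thesis using B_ge unfolding power2_eq_square by linarith
      qed
      ultimately have "\<bar>c i i\<bar> \<le> 2 * B\<^sup>2" by (smt (verit) zero_le_power2)
      then show ?thesis using 3 by (simp add: lag_bound_def mult.commute)
    qed
  qed
  have "expectation (\<lambda>\<omega>. (\<Sum>i\<in>I. centered f i \<omega>)\<^sup>2) = expectation (\<lambda>\<omega>. \<Sum>i\<in>I. \<Sum>j\<in>I. centered f i \<omega> * centered f j \<omega>)"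
    by (simp add: power2_eq_square sum_product)
  also have "\<dots> = (\<Sum>i\<in>I. \<Sum>j\<in>I. c i j)"
    using ec by (simp add: Bochner_Integration.integral_sum Bochner_Integration.integrable_sum cong: sum.cong)
  also have "\<dots> \<le> (\<Sum>i\<in>I. \<Sum>j\<in>I. B\<^sup>2 * lag_bound A \<eta> (if i \<le> j then j - i else i - j))"
    using cb by (intro sum_mono) (auto simp: abs_le_iff)
  also have "\<dots> = (\<Sum>i\<in>I. B\<^sup>2 * (\<Sum>j\<in>I. lag_bound A \<eta> (if i \<le> j then j - i else i - j)))"
    by (simp add: sum_distrib_left)
  also have "\<dots> \<le> (\<Sum>i\<in>I. B\<^sup>2 * block_var A \<eta>)"
    using sum_lag_bound_le[OF A_pos eta_gt fin] by (intro sum_mono mult_left_mono) auto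
  finally show ?thesis by (simp add: mult_ac)
qed

lemma block_var_nonneg: "0 \<le> block_var A \<eta>"
  unfolding block_var_def using summable_lag_bound[OF eta_gt] lag_bound_nonneg[OF A_pos]
  by (simp add: suminf_nonneg)

text \<open>The scaled block sums are the \<open>U\<close> of \<open>sum_tail_mixing\<close>: the
  condition on \<open>t\<close> bounds them by 1, their second moments are of order
  \<open>t\<^sup>2 * b\<close>, and the gaps make the mixing bound at lag \<open>b\<close> the price
  per block.\<close>

lemma alternate_blocks_tail:
  fixes blk :: "nat \<Rightarrow> nat set" and b p :: nat
  assumes f: "\<And>i. f i \<in> borel_measurable borel" "\<And>i u. \<bar>f i u\<bar> \<le> \<bar>u\<bar>" "\<And>i u. \<bar>f i u\<bar> \<le> \<tau>"
    and blk: "\<And>k. blk k \<subseteq> {1..T}" "\<And>k. card (blk k) \<le> b"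
    and gap: "\<And>i j k l. k < l \<Longrightarrow> i \<in> blk k \<Longrightarrow> j \<in> blk l \<Longrightarrow> i + b \<le> j" and b: "1 \<le> b"
    and t: "t > 0" "t * real b * (2 * \<tau>) \<le> 1" and y: "0 \<le> y"
  shows "prob {\<omega> \<in> space M. (\<Sum>k<p. \<Sum>i\<in>blk k. centered f i \<omega>) > (y + real p * (t\<^sup>2 * real b * (block_var A \<eta> * B\<^sup>2))) / t}
    \<le> exp (- y) + 3 * real p * (A * real b powr (- \<beta>))"
proof -
  define U where "U k \<omega> = t * (\<Sum>i\<in>blk k. centered f i \<omega>)" for k \<omega>
  define v where "v = t\<^sup>2 * real b * (block_var A \<eta> * B\<^sup>2)"
  have fin: "finite (blk k)" for k using blk finite_subset by blast
  have Xi: "X i \<in> borel_measurable M" if "i \<in> blk k" for i k using blk(1)[of k] that X_meas by auto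
  have \<tau>: "0 \<le> \<tau>" using f(3)[of 0 0] by linarith
  have i1: "integrable M (\<lambda>\<omega>. f i (X i \<omega>))" if "i \<in> blk k" for i k
    using transform_moment[OF f(1) f(2), of i i] blk(1)[of k] that by auto
  have Um: "U k \<in> borel_measurable (sigI M X I)" if "blk k \<subseteq> I" for k I
    unfolding U_def centered_def using that f(1)
    by (intro borel_measurable_times borel_measurable_sum borel_measurable_diff measurable_compose[OF measurable_sigI f(1)]) auto
  have e1: "\<bar>expectation (\<lambda>\<omega>. f i (X i \<omega>))\<bar> \<le> \<tau>" if "i \<in> blk k" for i k
  proof -
    have "\<bar>expectation (\<lambda>\<omega>. f i (X i \<omega>))\<bar> \<le> expectation (\<lambda>\<omega>. \<bar>f i (X i \<omega>)\<bar>)"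
      using integral_norm_bound[of M "\<lambda>\<omega>. f i (X i \<omega>)"] by simp
    also have "\<dots> \<le> \<tau>" using i1[OF that] f(3) by (intro integral_le_const) auto
    finally show ?thesis .
  qed
  have "prob {\<omega> \<in> space M. (\<Sum>k<p. U k \<omega>) > y + real p * v} \<le> exp (- y) + 3 * real p * (A * real b powr (- \<beta>))"
  \<comment> \<open>The past of block \<open>k\<close> is generated by the earlier blocks of the
    same family alone; the indices in between are left out.\<close>
  proof (rule sum_tail_mixing[where F="\<lambda>k. sigI M X (\<Union>i<k. blk i)" and G="\<lambda>k. sigI M X (blk k)"])
    show "subalgebra M (sigI M X (\<Union>i<k. blk i))" "subalgebra M (sigI M X (blk k))" for k
      using Xi by (auto intro!: subalgebra_sigI)
    show "U i \<in> borel_measurable (sigI M X (\<Union>i<k. blk i))" if "i < k" for i k using that by (intro Um) auto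
    show "U k \<in> borel_measurable (sigI M X (blk k))" for k by (intro Um) auto
    show "\<bar>prob (C \<inter> D) - prob C * prob D\<bar> \<le> A * real b powr - \<beta>"
      if "C \<in> sets (sigI M X (\<Union>i<k. blk i))" "D \<in> sets (sigI M X (blk k))" for k C D
      using that b by (intro mixing_events[OF b _ _ _ that]) (use blk(1) gap in blast)+
    show "0 \<le> A * real b powr - \<beta>" using A_pos by simp
    show "\<bar>U k \<omega>\<bar> \<le> 1" for k \<omega>
    proof -
      have "\<bar>\<Sum>i\<in>blk k. centered f i \<omega>\<bar> \<le> (\<Sum>i\<in>blk k. \<bar>centered f i \<omega>\<bar>)" by (rule sum_abs)
      also have "\<dots> \<le> (\<Sum>i\<in>blk k. 2 * \<tau>)"
      proof (rule sum_mono)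
        fix i assume "i \<in> blk k"
        then show "\<bar>centered f i \<omega>\<bar> \<le> 2 * \<tau>" unfolding centered_def using e1[of i k] f(3)[of i "X i \<omega>"] by linarith
      qed
      also have "\<dots> = real (card (blk k)) * (2 * \<tau>)" by simp
      also have "\<dots> \<le> real b * (2 * \<tau>)" using blk \<tau> by (intro mult_right_mono) auto
      finally have "t * \<bar>\<Sum>i\<in>blk k. centered f i \<omega>\<bar> \<le> t * (real b * (2 * \<tau>))" using t by (intro mult_left_mono) auto
      also have "\<dots> \<le> 1" using t by (simp add: mult.assoc)
      finally show ?thesis using t by (simp add: U_def abs_mult)
    qed
    show "expectation (U k) = 0" for k
    proof -
      have "expectation (U k) = t * (\<Sum>i\<in>blk k. expectation (\<lambda>\<omega>. centered f i \<omega>))"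
        unfolding U_def using i1 by (simp add: Bochner_Integration.integral_sum centered_def)
      also have "\<dots> = 0" using i1 by (simp add: centered_def prob_space cong: sum.cong)
      finally show ?thesis .
    qed
    show "expectation (\<lambda>\<omega>. (U k \<omega>)\<^sup>2) \<le> v" for k
    proof -
      have "expectation (\<lambda>\<omega>. (U k \<omega>)\<^sup>2) = t\<^sup>2 * expectation (\<lambda>\<omega>. (\<Sum>i\<in>blk k. centered f i \<omega>)\<^sup>2)"
        by (simp add: U_def power_mult_distrib)
      also have "\<dots> \<le> t\<^sup>2 * (real (card (blk k)) * (block_var A \<eta> * B\<^sup>2))"
        using variance_centered_sum_le[OF f(1,2) blk(1)] by (intro mult_left_mono) auto
      also have "\<dots> \<le> t\<^sup>2 * (real b * (block_var A \<eta> * B\<^sup>2))"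
        using blk(2) block_var_nonneg by (intro mult_left_mono mult_right_mono) auto
      finally show ?thesis by (simp add: v_def mult_ac)
    qed
    show "0 \<le> v" using block_var_nonneg by (simp add: v_def)
  qed (use y in auto)
  also have "{\<omega> \<in> space M. (\<Sum>k<p. U k \<omega>) > y + real p * v} = {\<omega> \<in> space M. (\<Sum>k<p. \<Sum>i\<in>blk k. centered f i \<omega>) > (y + real p * v) / t}"
    using t by (simp add: U_def sum_distrib_left[symmetric] divide_less_eq mult.commute)
  finally show ?thesis unfolding v_def .
qed

text \<open>The window is cut into \<open>2 * p\<close> blocks of length \<open>b\<close>, and
  blocks of equal parity are separated by a full block. If the absolute sum exceeds twice a level,
  the sum over one parity exceeds the level in absolute value; with both signs this makes four
  events.\<close>

lemma window_tail:
  fixes b p :: nat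
  assumes f: "\<And>i. f i \<in> borel_measurable borel" "\<And>i u. \<bar>f i u\<bar> \<le> \<bar>u\<bar>" "\<And>i u. \<bar>f i u\<bar> \<le> \<tau>"
    and W: "{lo..<lo+n} \<subseteq> {1..T}" and b: "1 \<le> b" and p: "n \<le> 2 * p * b"
    and t: "t > 0" "t * real b * (2 * \<tau>) \<le> 1" and y: "0 \<le> y"
  shows "prob {\<omega> \<in> space M. \<bar>\<Sum>i\<in>{lo..<lo+n}. centered f i \<omega>\<bar> > 2 * ((y + real p * (t\<^sup>2 * real b * (block_var A \<eta> * B\<^sup>2))) / t)}
    \<le> 4 * (exp (- y) + 3 * real p * (A * real b powr (- \<beta>)))"
proof -
  define x where "x = (y + real p * (t\<^sup>2 * real b * (block_var A \<eta> * B\<^sup>2))) / t"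
  define E where "E = exp (- y) + 3 * real p * (A * real b powr (- \<beta>))"
  \<comment> \<open>Intersecting with the window lets the last blocks be short or empty, so
    \<open>2 * p * b\<close> only has to cover \<open>n\<close>.\<close>
  define blk where "blk l = {lo + l * b..<lo + (l + 1) * b} \<inter> {lo..<lo+n}" for l
  define S where "S f e \<omega> = (\<Sum>k<p. \<Sum>i\<in>blk (2 * k + e). centered f i \<omega>)" for f and e :: nat and \<omega>
  have blkW: "blk l \<subseteq> {1..T}" for l using W by (auto simp: blk_def)
  have card: "card (blk l) \<le> b" for l
  proof -
    have "card (blk l) \<le> card {lo + l * b..<lo + (l + 1) * b}" unfolding blk_def by (intro card_mono) auto
    then show ?thesis by simp
  qed
  have gap: "i + b \<le> j" if kl: "k < l" and ij: "i \<in> blk (2 * k + e)" "j \<in> blk (2 * l + e)" for i j k l e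
  proof -
    have "(2 * k + e + 2) * b \<le> (2 * l + e) * b" using kl by (intro mult_right_mono) auto
    then show ?thesis using ij by (auto simp: blk_def algebra_simps)
  qed
  have half: "prob {\<omega> \<in> space M. S g e \<omega> > x} \<le> E" 
    if g: "\<And>i. g i \<in> borel_measurable borel" "\<And>i u. \<bar>g i u\<bar> \<le> \<bar>u\<bar>" "\<And>i u. \<bar>g i u\<bar> \<le> \<tau>" for g e
    unfolding S_def x_def E_def
    by (rule alternate_blocks_tail[where b=b and blk="\<lambda>k. blk (2 * k + e)", OF g blkW card _ b t y]) (rule gap)
  \<comment> \<open>Lower tails are upper tails of the negated transformations, which satisfy the
    same bounds.\<close>
  define g where "g i u = - f i u" for i u
  have g: "\<And>i. g i \<in> borel_measurable borel" "\<And>i u. \<bar>g i u\<bar> \<le> \<bar>u\<bar>" "\<And>i u. \<bar>g i u\<bar> \<le> \<tau>"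
    using f by (auto simp: g_def[abs_def])
  have Sg: "S g e \<omega> = - S f e \<omega>" for e \<omega>
    by (simp add: S_def g_def centered_def sum_negf[symmetric])
  have Sm[measurable]: "S f e \<in> borel_measurable M" for e
  proof -
    have "centered f i \<in> borel_measurable M" if "i \<in> blk l" for i l
      unfolding centered_def using X_meas blkW[of l] f(1) that
      by (intro borel_measurable_diff measurable_compose[OF _ f(1)]) auto
    then show ?thesis unfolding S_def by (intro borel_measurable_sum) auto
  qed
  have sum: "(\<Sum>i\<in>{lo..<lo+n}. centered f i \<omega>) = S f 0 \<omega> + S f 1 \<omega>" for \<omega>
  proof -
    have "{lo..<lo+n} = (\<Union>l<2*p. blk l)"
    proof (rule set_eqI, rule iffI)
      fix i assume i: "i \<in> {lo..<lo+n}"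
      define l where "l = (i - lo) div b"
      have "l * b \<le> i - lo" "i - lo < (l + 1) * b" using b unfolding l_def
        by (simp, metis add.commute dividend_less_div_times less_le_trans mult.commute mult_Suc_right plus_1_eq_Suc zero_less_one)
      moreover have "l < 2 * p" unfolding l_def using i p b by (intro less_mult_imp_div_less) auto
      ultimately show "i \<in> (\<Union>l<2*p. blk l)" using i by (auto simp: blk_def intro!: bexI[of _ l])
    qed (auto simp: blk_def)
    moreover have "(\<Sum>i\<in>(\<Union>l<2*p. blk l). centered f i \<omega>) = (\<Sum>l<2*p. \<Sum>i\<in>blk l. centered f i \<omega>)"
    proof (rule sum.UNION_disjoint)
      have "blk k \<inter> blk l = {}" if "k < l" for k l
      proof -
        have "(k + 1) * b \<le> l * b" using that by (intro mult_right_mono) auto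
        then show ?thesis by (auto simp: blk_def)
      qed
      then show "\<forall>i\<in>{..<2 * p}. \<forall>j\<in>{..<2 * p}. i \<noteq> j \<longrightarrow> blk i \<inter> blk j = {}"
        by (metis inf_commute linorder_neqE_nat)
    qed (auto simp: blk_def)
    ultimately show ?thesis by (simp add: sum_pairs_lessThan S_def)
  qed
  have "prob {\<omega> \<in> space M. \<bar>\<Sum>i\<in>{lo..<lo+n}. centered f i \<omega>\<bar> > 2 * x}
    \<le> prob (({\<omega> \<in> space M. S f 0 \<omega> > x} \<union> {\<omega> \<in> space M. S f 1 \<omega> > x}) \<union> 
        ({\<omega> \<in> space M. S g 0 \<omega> > x} \<union> {\<omega> \<in> space M. S g 1 \<omega> > x}))"
    by (intro finite_measure_mono) (auto simp: sum Sg)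
  also have "\<dots> \<le> (prob {\<omega> \<in> space M. S f 0 \<omega> > x} + prob {\<omega> \<in> space M. S f 1 \<omega> > x}) +
      (prob {\<omega> \<in> space M. S g 0 \<omega> > x} + prob {\<omega> \<in> space M. S g 1 \<omega> > x})"
    unfolding Sg by (intro order_trans[OF measure_Un_le] add_mono) auto
  also have "\<dots> \<le> (E + E) + (E + E)" by (intro add_mono half f g)
  finally have "prob {\<omega> \<in> space M. \<bar>\<Sum>i\<in>{lo..<lo+n}. centered f i \<omega>\<bar> > 2 * x} \<le> 4 * E" by simp
  then show ?thesis unfolding x_def E_def .
qed

end

lemma window_interval:
  fixes x h \<rho> :: real
  assumes "T \<ge> 1" "h > 0" "\<rho> \<ge> 0"
  obtains lo n where "{i\<in>{1..T}. \<bar>real i / real T - x\<bar> \<le> \<rho> * h} = {lo..<lo+n}"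
    "real n \<le> 2 * \<rho> * (real T * h) + 1"
proof -
  define W where "W = {i\<in>{1..T}. \<bar>real i / real T - x\<bar> \<le> \<rho> * h}"
  have finW: "finite W" by (simp add: W_def)
  show thesis
  proof (cases "W = {}")
    case True
    then show thesis using that[of 1 0] assms by (simp add: W_def)
  next
    case False
    define lo hi where "lo = Min W" and "hi = Max W"
    have mem: "lo \<in> W" "hi \<in> W" using finW False by (auto simp: lo_def hi_def)
    have le: "lo \<le> hi" using finW mem by (auto simp: hi_def)
    have "W = {lo..<lo + (hi - lo + 1)}"
    proof (intro set_eqI iffI)
      fix i assume "i \<in> W"
      then have "lo \<le> i" "i \<le> hi" using finW by (auto simp: lo_def hi_def)
      then show "i \<in> {lo..<lo + (hi - lo + 1)}" by auto
    next
      fix i assume "i \<in> {lo..<lo + (hi - lo + 1)}"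
      then have i: "lo \<le> i" "i \<le> hi" using le by auto
      then have "real lo / real T \<le> real i / real T" "real i / real T \<le> real hi / real T"
        using assms by (auto intro!: divide_right_mono)
      then show "i \<in> W" using mem i by (auto simp: W_def abs_le_iff)
    qed
    moreover have "real (hi - lo + 1) \<le> 2 * \<rho> * (real T * h) + 1"
    proof -
      have "real hi / real T - real lo / real T \<le> 2 * (\<rho> * h)" using mem by (auto simp: W_def abs_le_iff)
      then have "real hi - real lo \<le> 2 * (\<rho> * h) * real T" using assms by (simp add: field_simps)
      then show ?thesis using le by (simp add: of_nat_diff algebra_simps)
    qed
    ultimately show thesis using that[of lo "hi - lo + 1"] by (simp add: W_def)
  qed
qed

context mixing_array begin

text \<open>\<open>window_tail\<close> with its free parameters fixed: block length about
  \<open>1 / (a * \<tau>)\<close>, \<open>t = a / (2 * D)\<close>, and exponent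
  \<open>y * (N * a\<^sup>2)\<close>, where \<open>N * a\<^sup>2\<close> will be
  \<open>ln T\<close>. With \<open>B = c * D\<close> the exponent and the compensator, divided by
  \<open>t\<close>, are both of order \<open>D * N * a\<close>.\<close>

lemma window_deviation:
  fixes \<rho> h x D a \<tau> y c :: real
  defines "N \<equiv> real T * h"
  defines "W \<equiv> {i\<in>{1..T}. \<bar>real i / real T - x\<bar> \<le> \<rho> * h}"
  assumes f: "\<And>i. f i \<in> borel_measurable borel" "\<And>i u. \<bar>f i u\<bar> \<le> \<bar>u\<bar>" "\<And>i u. \<bar>f i u\<bar> \<le> \<tau>"
    and T: "T \<ge> 1" and h: "h > 0" and \<rho>: "\<rho> \<ge> 1" and D: "D \<ge> 1" and B: "B = c * D"
    and a: "0 < a" "a \<le> 1" "N * a\<^sup>2 \<ge> 1" and \<tau>: "\<tau> \<ge> 1" "a * \<tau> \<le> 1" and y: "y \<ge> 0" and \<beta>: "\<beta> > 0"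
  shows "prob {\<omega> \<in> space M. \<bar>\<Sum>i\<in>W. centered f i \<omega>\<bar> > 4 * (y + (\<rho> + 2) * block_var A \<eta> * c\<^sup>2) * (D * N * a)}
     \<le> 4 * (exp (- (y * (N * a\<^sup>2))) + 3 * A * (\<rho> + 2) * N * (2 * a * \<tau>) powr (1 + \<beta>))"
proof -
  obtain lo n where W: "W = {lo..<lo+n}" and n: "real n \<le> 2 * \<rho> * N + 1"
    unfolding W_def N_def using window_interval[of T h \<rho> x] T h \<rho> by auto
  have WT: "{lo..<lo+n} \<subseteq> {1..T}" unfolding W[symmetric] W_def by auto
  have a2: "a\<^sup>2 \<le> a" using a by (simp add: power2_eq_square mult_left_le)
  have N0: "N > 0" unfolding N_def using T h by simp
  have Na: "1 \<le> N * a" using mult_left_mono[OF a2, of N] N0 a by linarith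
  have N1: "1 \<le> N" using mult_left_mono[OF a(2), of N] N0 Na by linarith
  have aN: "1 / a \<le> N" using Na a by (simp add: field_simps)
  have at: "0 < a * \<tau>" using a \<tau> by simp
  \<comment> \<open>Since \<open>1 / (a * \<tau>)\<close> is at least 1, rounding down loses at most
    a factor 2; this is the 2 inside \<open>(2 * a * \<tau>) powr (1 + \<beta>)\<close>.\<close>
  define b where "b = nat \<lfloor>1 / (a * \<tau>)\<rfloor>"
  have q1: "1 \<le> 1 / (a * \<tau>)" using at \<tau> by (simp add: field_simps)
  have b: "1 \<le> b" "real b \<le> 1 / (a * \<tau>)" "1 / (a * \<tau>) \<le> 2 * real b"
  proof -
    have "1 \<le> \<lfloor>1 / (a * \<tau>)\<rfloor>" using q1 by (simp only: le_floor_iff of_int_1)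
    then obtain k where k: "\<lfloor>1 / (a * \<tau>)\<rfloor> = k" "1 \<le> k" by blast
    then have "real b = of_int \<lfloor>1 / (a * \<tau>)\<rfloor>" "1 \<le> b" unfolding b_def k by auto
    then show "1 \<le> b" "real b \<le> 1 / (a * \<tau>)" "1 / (a * \<tau>) \<le> 2 * real b" by linarith+
  qed
  have "1 / (a * \<tau>) \<le> 1 / a" using a \<tau> by (simp add: field_simps)
  then have bN: "real b \<le> N" using b aN by linarith
  define p where "p = nat \<lceil>real n / (2 * real b)\<rceil>"
  have p: "real n / (2 * real b) \<le> real p" "real p \<le> real n / (2 * real b) + 1"
  proof -
    have "0 \<le> real n / (2 * real b)" by simp
    then show "real n / (2 * real b) \<le> real p" "real p \<le> real n / (2 * real b) + 1"
      unfolding p_def by linarith+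
  qed
  have np: "n \<le> 2 * p * b"
  proof -
    have "real n \<le> real (2 * p * b)" using p(1) b(1) by (simp add: field_simps)
    then show ?thesis by linarith
  qed
  have pb: "real p * real b \<le> (\<rho> + 2) * N"
  proof -
    have "real p * real b \<le> (real n / (2 * real b) + 1) * real b" using p by (intro mult_right_mono) auto
    also have "\<dots> = real n / 2 + real b" using b(1) by (simp add: field_simps)
    also have "\<dots> \<le> (2 * \<rho> * N + 1) / 2 + N" using n bN by (intro add_mono divide_right_mono) auto
    also have "\<dots> \<le> (\<rho> + 2) * N" using N1 by (simp add: algebra_simps)
    finally show ?thesis .
  qed
  \<comment> \<open>As \<open>b * \<tau> \<le> 1 / a\<close>, the factor \<open>a / 2\<close>
    already brings the block sums below 1; the further division by \<open>D\<close> offsets the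
    \<open>D\<^sup>2\<close> in the variances.\<close>
  define t where "t = a / (2 * D)"
  have t0: "t > 0" using a D by (simp add: t_def)
  have t1: "t * real b * (2 * \<tau>) \<le> 1"
  proof -
    have "t * real b * (2 * \<tau>) = real b * (a * \<tau>) / D" by (simp add: t_def)
    also have "\<dots> \<le> 1 / D" using b(2) at D by (intro divide_right_mono) (auto simp: field_simps)
    also have "\<dots> \<le> 1" using D by simp
    finally show ?thesis .
  qed
  have yL: "0 \<le> y * (N * a\<^sup>2)" using y a by simp
  define z where "z = 2 * ((y * (N * a\<^sup>2) + real p * (t\<^sup>2 * real b * (block_var A \<eta> * B\<^sup>2))) / t)"
  have zle: "z \<le> 4 * (y + (\<rho> + 2) * block_var A \<eta> * c\<^sup>2) * (D * N * a)"
  proof -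
    have "real p * (t\<^sup>2 * real b * (block_var A \<eta> * B\<^sup>2)) = (real p * real b) * (t\<^sup>2 * (block_var A \<eta> * B\<^sup>2))"
      by (simp add: mult_ac)
    also have "\<dots> \<le> ((\<rho> + 2) * N) * (t\<^sup>2 * (block_var A \<eta> * B\<^sup>2))"
      using pb block_var_nonneg by (intro mult_right_mono) auto
    also have "\<dots> = (\<rho> + 2) * block_var A \<eta> * c\<^sup>2 * (N * a\<^sup>2) / 4"
      using D by (simp add: t_def B power_mult_distrib power_divide field_simps)
    also have "\<dots> \<le> (\<rho> + 2) * block_var A \<eta> * c\<^sup>2 * (N * a\<^sup>2)"
    proof -
      have "0 \<le> (\<rho> + 2) * block_var A \<eta> * c\<^sup>2 * (N * a\<^sup>2)"
        using \<rho> block_var_nonneg N0 by (intro mult_nonneg_nonneg) auto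
      then show ?thesis by linarith
    qed
    finally have "z \<le> 2 * ((y * (N * a\<^sup>2) + (\<rho> + 2) * block_var A \<eta> * c\<^sup>2 * (N * a\<^sup>2)) / t)"
      unfolding z_def using t0 by (intro mult_left_mono divide_right_mono add_left_mono) auto
    also have "\<dots> = 4 * (y + (\<rho> + 2) * block_var A \<eta> * c\<^sup>2) * (D * N * a)"
      using a D by (simp add: t_def field_simps power2_eq_square)
    finally show ?thesis .
  qed
  have m: "random_variable borel (\<lambda>\<omega>. \<Sum>i\<in>W. centered f i \<omega>)"
    unfolding centered_def using X_meas WT W
    by (intro borel_measurable_sum borel_measurable_diff measurable_compose[OF _ f(1)]) auto
  have "prob {\<omega> \<in> space M. \<bar>\<Sum>i\<in>W. centered f i \<omega>\<bar> > 4 * (y + (\<rho> + 2) * block_var A \<eta> * c\<^sup>2) * (D * N * a)}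
     \<le> prob {\<omega> \<in> space M. \<bar>\<Sum>i\<in>W. centered f i \<omega>\<bar> > z}"
    using zle m by (intro finite_measure_mono) auto
  also have "\<dots> \<le> 4 * (exp (- (y * (N * a\<^sup>2))) + 3 * real p * (A * real b powr (- \<beta>)))"
    unfolding z_def W by (rule window_tail[OF f WT b(1) np t0 t1 yL])
  also have "\<dots> \<le> 4 * (exp (- (y * (N * a\<^sup>2))) + 3 * A * (\<rho> + 2) * N * (2 * a * \<tau>) powr (1 + \<beta>))"
  proof -
    \<comment> \<open>There are \<open>p\<close> blocks with price \<open>b powr (- \<beta>)\<close>
      each. Splitting off one factor \<open>b\<close> leaves \<open>p * b\<close>, which is of the
      order of the window size \<open>N\<close>.\<close>
    have "real b powr (- \<beta>) = real b * real b powr (- (1 + \<beta>))" using b(1) by (simp add: powr_mult_base)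
    moreover have "real b powr (- (1 + \<beta>)) \<le> (2 * a * \<tau>) powr (1 + \<beta>)"
    proof -
      have "real b powr (- (1 + \<beta>)) \<le> (1 / (2 * a * \<tau>)) powr (- (1 + \<beta>))"
        using b(1,3) at \<beta> by (intro powr_mono2') (auto simp: field_simps)
      also have "\<dots> = (2 * a * \<tau>) powr (1 + \<beta>)"
      proof -
        have inv: "(1 / v) powr (- r) = v powr r" if "v > 0" for v r :: real
          using that by (simp add: powr_minus powr_divide)
        have "2 * a * \<tau> > 0" using a \<tau> by simp
        then show ?thesis by (rule inv)
      qed
      finally show ?thesis .
    qed
    ultimately have "real p * real b powr (- \<beta>) \<le> (real p * real b) * (2 * a * \<tau>) powr (1 + \<beta>)"
      by (simp add: mult.assoc mult_left_mono)
    also have "\<dots> \<le> ((\<rho> + 2) * N) * (2 * a * \<tau>) powr (1 + \<beta>)" using pb by (intro mult_right_mono) auto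
    finally have "3 * A * (real p * real b powr (- \<beta>)) \<le> 3 * A * (((\<rho> + 2) * N) * (2 * a * \<tau>) powr (1 + \<beta>))"
      using A_pos by (intro mult_left_mono) auto
    then show ?thesis by (simp add: algebra_simps)
  qed
  finally show ?thesis .
qed

end

section \<open>Finite maxima and the kernel with its polynomial factor\<close>

context prob_space begin

text \<open>The supremum over \<open>S\<close> need not be measurable, and then the integral in the assumption is
  only a lower integral; it still dominates the integral of a maximum over a finite subset.\<close>

lemma finite_sup_dominated:
  fixes u :: "'b \<Rightarrow> 'a \<Rightarrow> real"
  assumes G: "finite G" "G \<subseteq> S" and m: "\<And>g. g \<in> G \<Longrightarrow> u g \<in> borel_measurable M"
    and u0: "\<And>g \<omega>. 0 \<le> u g \<omega>"
    and le: "(\<integral>\<^sup>+ \<omega>. (SUP g\<in>S. ennreal (u g \<omega>)) \<partial>M) \<le> ennreal c" and c: "0 \<le> c"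
  obtains H where "integrable M H" "expectation H \<le> c" "\<And>\<omega>. 0 \<le> H \<omega>" "\<And>g \<omega>. g \<in> G \<Longrightarrow> u g \<omega> \<le> H \<omega>"
proof (cases "G = {}")
  case True
  then show thesis using that[of "\<lambda>_. 0"] c by simp
next
  case False
  define H where "H \<omega> = Max ((\<lambda>g. u g \<omega>) ` G)" for \<omega>
  have H: "u g \<omega> \<le> H \<omega>" if "g \<in> G" for g \<omega> unfolding H_def using that G by simp
  have Hm[measurable]: "H \<in> borel_measurable M" unfolding H_def using m G by (intro borel_measurable_Max) auto
  have ex: "\<exists>g\<in>G. H \<omega> = u g \<omega>" for \<omega>
  proof -
    have "Max ((\<lambda>g. u g \<omega>) ` G) \<in> (\<lambda>g. u g \<omega>) ` G" using G False by (intro Max_in) auto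
    then show ?thesis unfolding H_def by blast
  qed
  have H0: "0 \<le> H \<omega>" for \<omega> using ex[of \<omega>] u0 by auto
  have "(\<integral>\<^sup>+ \<omega>. ennreal (H \<omega>) \<partial>M) \<le> (\<integral>\<^sup>+ \<omega>. (SUP g\<in>S. ennreal (u g \<omega>)) \<partial>M)"
  proof (rule nn_integral_mono)
    fix \<omega>
    obtain g where "g \<in> G" "H \<omega> = u g \<omega>" using ex by blast
    then show "ennreal (H \<omega>) \<le> (SUP g\<in>S. ennreal (u g \<omega>))" using G by (auto intro: SUP_upper)
  qed
  also note le
  finally have n: "(\<integral>\<^sup>+ \<omega>. ennreal (H \<omega>) \<partial>M) \<le> ennreal c" .
  have i: "integrable M H"
    by (rule integrableI_nonneg) (use H0 n in \<open>auto intro: order_le_less_trans\<close>)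
  have "ennreal (expectation H) \<le> ennreal c" using nn_integral_eq_integral[OF i] H0 n by simp
  then have "expectation H \<le> c" using c by simp
  then show thesis using that[of H] i H0 H by blast
qed

lemma moment_of_nn_integral:
  fixes u :: "'a \<Rightarrow> real"
  assumes "u \<in> borel_measurable M" "\<And>\<omega>. 0 \<le> u \<omega>" "(\<integral>\<^sup>+ \<omega>. ennreal (u \<omega>) \<partial>M) \<le> ennreal c" "0 \<le> c"
  shows "integrable M u" "expectation u \<le> c"
proof -
  show i: "integrable M u"
    by (rule integrableI_nonneg) (use assms in \<open>auto intro: order_le_less_trans\<close>)
  have "ennreal (expectation u) \<le> ennreal c" using nn_integral_eq_integral[OF i] assms by simp
  then show "expectation u \<le> c" using assms by simp
qed

end

text \<open>The power is not globally Lipschitz, but \<open>K\<close> vanishes outside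
  \<open>[-R, R]\<close>, so only pairs with at least one point in the support matter.
  \<open>k0\<close> is made at least 1 so that weights can be normalised by it.\<close>

lemma kernel_times_power:
  fixes K :: "real \<Rightarrow> real"
  assumes Kb: "\<And>u. \<bar>K u\<bar> \<le> Kb" and supp: "\<And>u. \<bar>u\<bar> > R \<Longrightarrow> K u = 0" and R: "R \<ge> 1"
    and lip: "\<And>u u'. \<bar>K u - K u'\<bar> \<le> \<Lambda> * \<bar>u - u'\<bar>" and \<Lambda>: "\<Lambda> \<ge> 0"
  obtains k0 l0 where "k0 \<ge> 1" "l0 \<ge> 0" "\<And>u. \<bar>K u * u ^ j\<bar> \<le> k0"
    "\<And>u. \<bar>u\<bar> > R \<Longrightarrow> K u * u ^ j = 0" "\<And>u u'. \<bar>K u * u ^ j - K u' * u' ^ j\<bar> \<le> l0 * \<bar>u - u'\<bar>"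
proof -
  have Kb0: "0 \<le> Kb" using Kb[of 0] by linarith
  have pw: "\<bar>u ^ n\<bar> \<le> R ^ n" if "\<bar>u\<bar> \<le> R" for u n using that by (simp add: power_abs power_mono)
  have plip: "\<bar>u ^ n - u' ^ n\<bar> \<le> real n * R ^ n * \<bar>u - u'\<bar>" if "\<bar>u\<bar> \<le> R" "\<bar>u'\<bar> \<le> R" for u u' n
  proof (induction n)
    case (Suc n)
    have "u ^ Suc n - u' ^ Suc n = u * (u ^ n - u' ^ n) + (u - u') * u' ^ n" by (simp add: algebra_simps)
    then have "\<bar>u ^ Suc n - u' ^ Suc n\<bar> \<le> \<bar>u\<bar> * \<bar>u ^ n - u' ^ n\<bar> + \<bar>u - u'\<bar> * \<bar>u' ^ n\<bar>"
      by (metis abs_mult abs_triangle_ineq)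
    also have "\<dots> \<le> R * (real n * R ^ n * \<bar>u - u'\<bar>) + \<bar>u - u'\<bar> * R ^ Suc n"
    proof (intro add_mono mult_mono Suc.IH that)
      have "\<bar>u' ^ n\<bar> \<le> R ^ n" using pw that by blast
      also have "\<dots> \<le> R ^ Suc n" using R by (intro power_increasing) auto
      finally show "\<bar>u' ^ n\<bar> \<le> R ^ Suc n" .
    qed (use R in auto)
    finally show ?case by (simp add: algebra_simps)
  qed simp
  define l0 where "l0 = \<Lambda> * R ^ j + Kb * (real j * R ^ j)"
  \<comment> \<open>The Lipschitz bound of \<open>K\<close> is paired with the power at
    \<open>u\<close>, the point known to lie in the support. If \<open>u'\<close> lies outside, its
    term is 0 and no bound on its power is needed.\<close>
  have oneside: "\<bar>K u * u ^ j - K u' * u' ^ j\<bar> \<le> l0 * \<bar>u - u'\<bar>" if u: "\<bar>u\<bar> \<le> R" for u u'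
  proof -
    have 1: "\<bar>K u - K u'\<bar> * \<bar>u ^ j\<bar> \<le> (\<Lambda> * \<bar>u - u'\<bar>) * R ^ j"
      using lip pw u \<Lambda> by (intro mult_mono) auto
    show ?thesis
    proof (cases "\<bar>u'\<bar> \<le> R")
      case True
      have "K u * u ^ j - K u' * u' ^ j = (K u - K u') * u ^ j + K u' * (u ^ j - u' ^ j)" by (simp add: algebra_simps)
      then have "\<bar>K u * u ^ j - K u' * u' ^ j\<bar> \<le> \<bar>K u - K u'\<bar> * \<bar>u ^ j\<bar> + \<bar>K u'\<bar> * \<bar>u ^ j - u' ^ j\<bar>"
        by (metis abs_mult abs_triangle_ineq)
      also have "\<dots> \<le> (\<Lambda> * \<bar>u - u'\<bar>) * R ^ j + Kb * (real j * R ^ j * \<bar>u - u'\<bar>)"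
        using Kb plip u True Kb0 by (intro add_mono 1 mult_mono) auto
      finally show ?thesis by (simp add: l0_def algebra_simps)
    next
      case False
      then have "K u' = 0" using supp by simp
      then have "\<bar>K u * u ^ j - K u' * u' ^ j\<bar> = \<bar>K u - K u'\<bar> * \<bar>u ^ j\<bar>" by (simp add: abs_mult)
      also have "\<dots> \<le> \<Lambda> * R ^ j * \<bar>u - u'\<bar>" using 1 by (simp add: mult_ac)
      also have "\<dots> \<le> l0 * \<bar>u - u'\<bar>" unfolding l0_def using Kb0 R by (intro mult_right_mono) auto
      finally show ?thesis .
    qed
  qed
  have l0: "0 \<le> l0" unfolding l0_def using \<Lambda> R Kb0 by simp
  show thesis
  proof (rule that[of "max 1 (Kb * R ^ j)" l0])
    show "\<bar>K u * u ^ j\<bar> \<le> max 1 (Kb * R ^ j)" for u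
    proof (cases "\<bar>u\<bar> \<le> R")
      case True
      have "\<bar>K u * u ^ j\<bar> \<le> Kb * R ^ j" unfolding abs_mult using Kb pw[OF True] Kb0 by (intro mult_mono) auto
      then show ?thesis by simp
    qed (use supp in simp)
    show "\<bar>K u * u ^ j - K u' * u' ^ j\<bar> \<le> l0 * \<bar>u - u'\<bar>" for u u'
    proof (cases "\<bar>u\<bar> \<le> R")
      case False
      show ?thesis
      proof (cases "\<bar>u'\<bar> \<le> R")
        case True
        then show ?thesis using oneside[of u' u] by (simp add: abs_minus_commute)
      qed (use False supp l0 in simp)
    qed (rule oneside)
  qed (use supp l0 in auto)
qed

section \<open>Uniform deviation over a net\<close>

lemma enorm_eq_L2_set: "enorm m g = L2_set g {..<m}"
  by (simp add: enorm_def L2_set_def)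

text \<open>\<open>S\<close> is an arbitrary subset of a ball, so grid points themselves may lie
  outside it. One representative inside \<open>S\<close> is chosen for each grid cell that meets
  \<open>S\<close>, and cells are counted.\<close>

lemma ball_net:
  assumes S: "\<And>g. g \<in> S \<Longrightarrow> enorm m g \<le> d" and e: "\<epsilon> > 0" and d: "d \<ge> 0"
  obtains G where "finite G" "G \<subseteq> S" "real (card G) \<le> (2 * real (m + 1) * d / \<epsilon> + 2) ^ m"
    "\<And>\<gamma>. \<gamma> \<in> S \<Longrightarrow> \<exists>g\<in>G. enorm m (\<lambda>k. \<gamma> k - g k) \<le> \<epsilon>"
proof -
  \<comment> \<open>Cells of this side have diagonal at most \<open>m * z \<le> \<epsilon>\<close>;
    \<open>m + 1\<close> in place of \<open>m\<close> covers dimension 0.\<close>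
  define z where "z = \<epsilon> / real (m + 1)"
  have z: "z > 0" using e by (simp add: z_def)
  define \<phi> where "\<phi> g = restrict (\<lambda>i. \<lfloor>g i / z\<rfloor>) {..<m}" for g :: "nat \<Rightarrow> real"
  define I where "I = {\<lfloor>- d / z\<rfloor>..\<lfloor>d / z\<rfloor>}"
  have cardI: "real (card I) \<le> 2 * d / z + 2"
  proof -
    have "0 \<le> d / z" using d z by simp
    then have fl: "\<lfloor>- d / z\<rfloor> \<le> 0" "0 \<le> \<lfloor>d / z\<rfloor>" by (simp_all add: floor_le_iff)
    obtain u v where uv: "\<lfloor>- d / z\<rfloor> = u" "\<lfloor>d / z\<rfloor> = v" by blast
    have "real (card I) = of_int \<lfloor>d / z\<rfloor> - of_int \<lfloor>- d / z\<rfloor> + 1"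
      using fl unfolding I_def uv by simp
    also have "\<dots> \<le> 2 * d / z + 2"
    proof -
      have "of_int \<lfloor>d / z\<rfloor> \<le> d / z" "- d / z - 1 < of_int \<lfloor>- d / z\<rfloor>" by linarith+
      moreover have "- d / z = - (d / z)" "2 * d / z = 2 * (d / z)" by simp_all
      ultimately show ?thesis by linarith
    qed
    finally show ?thesis .
  qed
  have sub: "\<phi> ` S \<subseteq> (\<Pi>\<^sub>E i\<in>{..<m}. I)"
  proof (rule image_subsetI)
    fix g assume g: "g \<in> S"
    have "\<lfloor>g i / z\<rfloor> \<in> I" if "i < m" for i
    proof -
      have "\<bar>g i\<bar> \<le> L2_set (\<lambda>i. \<bar>g i\<bar>) {..<m}" using that by (intro member_le_L2_set) auto
      also have "\<dots> = enorm m g" by (simp add: enorm_eq_L2_set L2_set_def)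
      also have "\<dots> \<le> d" using S[OF g] .
      finally have "- d \<le> g i" "g i \<le> d" by auto
      then have "- d / z \<le> g i / z" "g i / z \<le> d / z" using z by (intro divide_right_mono; simp)+
      then show ?thesis unfolding I_def by (auto intro: floor_mono)
    qed
    then show "\<phi> g \<in> (\<Pi>\<^sub>E i\<in>{..<m}. I)" by (auto simp: \<phi>_def)
  qed
  have finP: "finite (\<Pi>\<^sub>E i\<in>{..<m}. I)" by (auto simp: I_def intro!: finite_PiE)
  define G where "G = inv_into S \<phi> ` (\<phi> ` S)"
  have "finite G" unfolding G_def using finite_subset[OF sub finP] by blast
  moreover have "G \<subseteq> S" unfolding G_def by (auto intro: inv_into_into)
  moreover have "real (card G) \<le> (2 * real (m + 1) * d / \<epsilon> + 2) ^ m"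
  proof -
    have "card G \<le> card (\<phi> ` S)" unfolding G_def using finite_subset[OF sub finP] by (rule card_image_le)
    also have "\<dots> \<le> card (\<Pi>\<^sub>E i\<in>{..<m}. I)" by (rule card_mono[OF finP sub])
    also have "\<dots> = card I ^ m" by (simp add: card_PiE)
    finally have "real (card G) \<le> real (card I) ^ m" by (metis of_nat_le_iff of_nat_power)
    also have "\<dots> \<le> (2 * d / z + 2) ^ m" using cardI by (intro power_mono) auto
    also have "2 * d / z = 2 * real (m + 1) * d / \<epsilon>" by (simp add: z_def)
    finally show ?thesis .
  qed
  moreover have "\<exists>g\<in>G. enorm m (\<lambda>k. \<gamma> k - g k) \<le> \<epsilon>" if \<gamma>: "\<gamma> \<in> S" for \<gamma>
  proof
    define g where "g = inv_into S \<phi> (\<phi> \<gamma>)"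
    show "g \<in> G" using \<gamma> by (auto simp: g_def G_def)
    have eq: "\<phi> g = \<phi> \<gamma>" unfolding g_def by (rule f_inv_into_f[OF imageI[OF \<gamma>]])
    have "\<bar>\<gamma> i - g i\<bar> \<le> z" if "i < m" for i
    proof -
      have "\<lfloor>g i / z\<rfloor> = \<lfloor>\<gamma> i / z\<rfloor>" using fun_cong[OF eq, of i] that by (simp add: \<phi>_def)
      then have "\<bar>\<gamma> i / z - g i / z\<bar> \<le> 1" by linarith
      then show ?thesis using z by (simp add: diff_divide_distrib[symmetric] divide_le_eq)
    qed
    then have "enorm m (\<lambda>k. \<gamma> k - g k) \<le> (\<Sum>i<m. z)"
      unfolding enorm_eq_L2_set by (intro order_trans[OF L2_set_le_sum_abs] sum_mono) auto
    also have "\<dots> = real m * z" by simp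
    also have "\<dots> \<le> \<epsilon>" using e by (simp add: z_def field_simps)
    finally show "enorm m (\<lambda>k. \<gamma> k - g k) \<le> \<epsilon>" .
  qed
  ultimately show thesis by (rule that)
qed

lemma unit_interval_net:
  fixes \<epsilon> :: real
  assumes e: "\<epsilon> > 0"
  obtains Q where "finite Q" "real (card Q) \<le> 1 / \<epsilon> + 2" "\<And>x. x \<in> {0..1} \<Longrightarrow> \<exists>q\<in>Q. \<bar>x - q\<bar> \<le> \<epsilon>"
proof -
  define n where "n = nat \<lfloor>1 / \<epsilon>\<rfloor>"
  define Q where "Q = (\<lambda>k. real k * \<epsilon>) ` {..n}"
  have n: "real n \<le> 1 / \<epsilon>" unfolding n_def using e by simp
  have "card Q \<le> card {..n}" unfolding Q_def by (rule card_image_le) simp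
  then have "real (card Q) \<le> 1 / \<epsilon> + 2" using n by simp
  moreover have "\<exists>q\<in>Q. \<bar>x - q\<bar> \<le> \<epsilon>" if x: "x \<in> {0..1}" for x
  proof -
    define k where "k = nat \<lfloor>x / \<epsilon>\<rfloor>"
    have "x / \<epsilon> \<le> 1 / \<epsilon>" using x e by (intro divide_right_mono) auto
    then have kn: "k \<le> n" unfolding k_def n_def by (intro nat_mono floor_mono)
    have "0 \<le> x / \<epsilon>" using x e by simp
    then have "real k = of_int \<lfloor>x / \<epsilon>\<rfloor>" unfolding k_def by simp
    then have "\<bar>x / \<epsilon> - real k\<bar> \<le> 1" by linarith
    moreover have "x / \<epsilon> - real k = (x - real k * \<epsilon>) / \<epsilon>" using e by (simp add: field_simps)
    ultimately have "\<bar>x - real k * \<epsilon>\<bar> \<le> \<epsilon>" using e by (simp add: divide_le_eq)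
    then show ?thesis using kn by (auto simp: Q_def)
  qed
  moreover have "finite Q" by (simp add: Q_def)
  ultimately show thesis using that by blast
qed

context prob_space begin

text \<open>The exceptional set is the union of a null set where the Lipschitz bound fails, a Markov
  set for the remainder with share \<open>\<delta>\<close>, and a finite union over pairs of net
  points. In the constant, \<open>1 / \<delta> + 1\<close> stands for the remainder and its mean,
  \<open>k0 * E1\<close> for the deviation at net points, and the \<open>l0\<close> term for the
  passage from \<open>x\<close> to a net point.\<close>

lemma uniform_deviation_bound:
  fixes e xi :: "nat \<Rightarrow> 'b \<Rightarrow> 'a \<Rightarrow> real" and \<kappa> :: "real \<Rightarrow> real" and \<pi> :: "'b \<Rightarrow> 'b" and T :: nat
    and h a A \<beta> s c D k0 l0 R y \<delta> :: real
  defines "N \<equiv> real T * h" and "\<tau> \<equiv> (a * h) powr (- 1 / (s - 1))"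
  defines "E1 \<equiv> 4 * (y + (R + 3) * block_var A (\<beta> * (1 - 2 / s)) * c\<^sup>2)"
  defines "\<Psi> \<equiv> \<lambda>x g \<omega>. (\<Sum>i=1..T. \<kappa> ((real i / real T - x) / h) * e i g \<omega>) / N"
  assumes T: "T \<ge> 1" and h: "h > 0" and a: "0 < a" "a \<le> 1" "N * a\<^sup>2 \<ge> 1" and ah: "a * h \<le> 1" and a\<tau>: "a * \<tau> \<le> 1"
    and s: "s > 2" and A: "A > 0" and \<eta>: "\<beta> * (1 - 2 / s) > 1" and \<beta>: "\<beta> > 0" and D: "D \<ge> 1" and c: "c \<ge> 1"
    and G: "finite G" "G \<subseteq> S" and \<pi>: "\<And>\<gamma>. \<gamma> \<in> S \<Longrightarrow> \<pi> \<gamma> \<in> G"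
    and em: "\<And>i g. i \<in> {1..T} \<Longrightarrow> g \<in> S \<Longrightarrow> e i g \<in> borel_measurable M"
    and xm: "\<And>i g. i \<in> {1..T} \<Longrightarrow> g \<in> S \<Longrightarrow> xi i g \<in> borel_measurable M"
    and lip: "AE \<omega> in M. \<forall>i\<in>{1..T}. \<forall>\<gamma>\<in>S. \<bar>e i \<gamma> \<omega> - e i (\<pi> \<gamma>) \<omega>\<bar> \<le> xi i (\<pi> \<gamma>) \<omega> * (a * h)"
    and mixing: "\<And>g k. g \<in> G \<Longrightarrow> 1 \<le> k \<Longrightarrow> mixing_coef M (\<lambda>r. e r g) T (int k) \<le> A * real k powr (- \<beta>)"
    and mome: "\<And>i. i \<in> {1..T} \<Longrightarrow> (\<integral>\<^sup>+ \<omega>. (SUP g\<in>S. ennreal (\<bar>e i g \<omega>\<bar> powr s)) \<partial>M) \<le> ennreal (c * D)"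
    and momx: "\<And>i. i \<in> {1..T} \<Longrightarrow> (\<integral>\<^sup>+ \<omega>. (SUP g\<in>S. ennreal (\<bar>xi i g \<omega>\<bar> powr s)) \<partial>M) \<le> ennreal (c * D)"
    and k0: "k0 \<ge> 1" "\<And>u. \<bar>\<kappa> u\<bar> \<le> k0" and R: "R \<ge> 1" "\<And>u. \<bar>u\<bar> > R \<Longrightarrow> \<kappa> u = 0"
    and l0: "l0 \<ge> 0" "\<And>u u'. \<bar>\<kappa> u - \<kappa> u'\<bar> \<le> l0 * \<bar>u - u'\<bar>"
    and y: "y \<ge> 0" and \<delta>: "\<delta> > 0"
  obtains Bad where "Bad \<in> events"
    "prob Bad \<le> \<delta> + real (card G) * (1 / (a * h) + 2) *
        (8 * (exp (- (y * (N * a\<^sup>2))) + 3 * A * (R + 3) * N * (2 * a * \<tau>) powr (1 + \<beta>)))"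
    "\<And>\<omega> \<gamma> x. \<omega> \<in> space M - Bad \<Longrightarrow> \<gamma> \<in> S \<Longrightarrow> x \<in> {0..1} \<Longrightarrow> \<bar>\<Psi> x \<gamma> \<omega> - expectation (\<Psi> x \<gamma>)\<bar>
        \<le> (k0 * (1 + 2 * c) * (1 / \<delta> + 1) + k0 * E1 + l0 * (E1 + 2 * (2 * R + 3) * (1 + c))) * (D * a)"
proof -
  have N0: "N > 0" using T h by (simp add: N_def)
  have ah0: "a * h > 0" using a h by simp
  have a2: "a\<^sup>2 \<le> a" using a by (simp add: power2_eq_square mult_left_le)
  have Na: "1 \<le> N * a" using mult_left_mono[OF a2, of N] N0 a by linarith
  have N1: "1 \<le> N" using mult_left_mono[OF a(2), of N] N0 Na by linarith
  have \<tau>1: "\<tau> \<ge> 1"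
  proof -
    have "(1::real) powr (- 1 / (s - 1)) \<le> (a * h) powr (- 1 / (s - 1))" using ah ah0 s by (intro powr_mono2') auto
    then show ?thesis by (simp add: \<tau>_def)
  qed
  \<comment> \<open>The level is chosen for this identity: the clipping error of each term gets the
    same factor \<open>a * h\<close> as the mesh error.\<close>
  have \<tau>s: "\<tau> powr (1 - s) = a * h"
  proof -
    have "- 1 / (s - 1) * (1 - s) = 1" using s by (simp add: field_simps)
    then show ?thesis using ah0 by (simp add: \<tau>_def powr_powr)
  qed
  have cD: "c * D \<ge> 1" using c D mult_mono[of 1 c 1 D] by simp
  define w where "w x i = \<kappa> ((real i / real T - x) / h)" for x and i :: nat
  have wk: "\<bar>w x i\<bar> \<le> k0" for x i unfolding w_def by (rule k0)
  have moment_e: "integrable M (\<lambda>\<omega>. \<bar>e i g \<omega>\<bar> powr s)" "expectation (\<lambda>\<omega>. \<bar>e i g \<omega>\<bar> powr s) \<le> c * D"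
    if "i \<in> {1..T}" "g \<in> S" for i g
  proof -
    have [measurable]: "e i g \<in> borel_measurable M" using em that by auto
    have "(\<integral>\<^sup>+ \<omega>. ennreal (\<bar>e i g \<omega>\<bar> powr s) \<partial>M) \<le> (\<integral>\<^sup>+ \<omega>. (SUP g\<in>S. ennreal (\<bar>e i g \<omega>\<bar> powr s)) \<partial>M)"
      using that by (intro nn_integral_mono SUP_upper) auto
    also note mome[OF that(1)]
    finally have "(\<integral>\<^sup>+ \<omega>. ennreal (\<bar>e i g \<omega>\<bar> powr s) \<partial>M) \<le> ennreal (c * D)" .
    then show "integrable M (\<lambda>\<omega>. \<bar>e i g \<omega>\<bar> powr s)" "expectation (\<lambda>\<omega>. \<bar>e i g \<omega>\<bar> powr s) \<le> c * D"
      using cD by (auto intro!: moment_of_nn_integral)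
  qed
  have ie: "integrable M (e i g)" if "i \<in> {1..T}" "g \<in> S" for i g
    by (rule integrable_of_moment[OF em moment_e(1)]) (use that s in auto)
  have "\<exists>H. integrable M H \<and> expectation H \<le> c * D \<and> (\<forall>\<omega>. 0 \<le> H \<omega>) \<and> (\<forall>g\<in>G. \<forall>\<omega>. \<bar>e i g \<omega>\<bar> powr s \<le> H \<omega>)"
    if i: "i \<in> {1..T}" for i
  proof -
    have "(\<lambda>\<omega>. \<bar>e i g \<omega>\<bar> powr s) \<in> borel_measurable M" if "g \<in> G" for g
    proof -
      have [measurable]: "e i g \<in> borel_measurable M" using em[OF i, of g] that G by auto
      show ?thesis by measurable
    qed
    from finite_sup_dominated[OF G this _ mome[OF i]] cD show ?thesis by (smt (verit) powr_ge_zero)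
  qed
  then obtain He where He: "\<And>i. i \<in> {1..T} \<Longrightarrow> integrable M (He i)" "\<And>i. i \<in> {1..T} \<Longrightarrow> expectation (He i) \<le> c * D"
     "\<And>i \<omega>. i \<in> {1..T} \<Longrightarrow> 0 \<le> He i \<omega>" "\<And>i g \<omega>. i \<in> {1..T} \<Longrightarrow> g \<in> G \<Longrightarrow> \<bar>e i g \<omega>\<bar> powr s \<le> He i \<omega>"
    by metis
  have "\<exists>H. integrable M H \<and> expectation H \<le> c * D \<and> (\<forall>\<omega>. 0 \<le> H \<omega>) \<and> (\<forall>g\<in>G. \<forall>\<omega>. \<bar>xi i g \<omega>\<bar> powr s \<le> H \<omega>)"
    if i: "i \<in> {1..T}" for i
  proof -
    have "(\<lambda>\<omega>. \<bar>xi i g \<omega>\<bar> powr s) \<in> borel_measurable M" if "g \<in> G" for g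
    proof -
      have [measurable]: "xi i g \<in> borel_measurable M" using xm[OF i, of g] that G by auto
      show ?thesis by measurable
    qed
    from finite_sup_dominated[OF G this _ momx[OF i]] cD show ?thesis by (smt (verit) powr_ge_zero)
  qed
  then obtain Hx where Hx: "\<And>i. i \<in> {1..T} \<Longrightarrow> integrable M (Hx i)" "\<And>i. i \<in> {1..T} \<Longrightarrow> expectation (Hx i) \<le> c * D"
     "\<And>i \<omega>. i \<in> {1..T} \<Longrightarrow> 0 \<le> Hx i \<omega>" "\<And>i g \<omega>. i \<in> {1..T} \<Longrightarrow> g \<in> G \<Longrightarrow> \<bar>xi i g \<omega>\<bar> powr s \<le> Hx i \<omega>"
    by metis
  \<comment> \<open>Dominates both the replacement of the parameter by its net point and the
    clipping, for all \<open>x\<close> and all parameters in \<open>S\<close> at once. Its mean is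
    of order \<open>D * a\<close>: \<open>T\<close> terms of order \<open>a * h * D\<close> are
    divided by \<open>N = T * h\<close>.\<close>
  define Rr where "Rr \<omega> = (k0 * (a * h) / N) * (\<Sum>i=1..T. 1 + Hx i \<omega> + He i \<omega>)" for \<omega>
  have iRr: "integrable M Rr" unfolding Rr_def using He(1) Hx(1)
    by (intro integrable_mult_right Bochner_Integration.integrable_sum Bochner_Integration.integrable_add) auto
  have Rr0: "0 \<le> Rr \<omega>" for \<omega>
    unfolding Rr_def using k0 a h N0 Hx(3) He(3) by (intro mult_nonneg_nonneg sum_nonneg divide_nonneg_nonneg add_nonneg_nonneg) auto
  define KR where "KR = k0 * (1 + 2 * c) * (D * a)"
  have KR0: "KR > 0" unfolding KR_def using k0 c D a by simp
  have ERr: "expectation Rr \<le> KR"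
  proof -
    have "expectation Rr = (k0 * (a * h) / N) * (\<Sum>i=1..T. 1 + expectation (Hx i) + expectation (He i))"
    proof -
      have "expectation (\<lambda>\<omega>. 1 + Hx i \<omega> + He i \<omega>) = 1 + expectation (Hx i) + expectation (He i)" if "i \<in> {1..T}" for i
        using He(1)[OF that] Hx(1)[OF that] by (simp add: prob_space)
      moreover have "expectation (\<lambda>\<omega>. \<Sum>i=1..T. 1 + Hx i \<omega> + He i \<omega>) = (\<Sum>i=1..T. expectation (\<lambda>\<omega>. 1 + Hx i \<omega> + He i \<omega>))"
        using He(1) Hx(1) by (intro Bochner_Integration.integral_sum Bochner_Integration.integrable_add) auto
      ultimately show ?thesis unfolding Rr_def by (simp add: integral_mult_right_zero)
    qed
    also have "\<dots> \<le> (k0 * (a * h) / N) * (\<Sum>i=1..T. D + c * D + c * D)"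
      using k0 ah0 N0 He(2) Hx(2) D by (intro mult_left_mono sum_mono add_mono) auto
    also have "\<dots> = KR" using T h by (simp add: KR_def N_def field_simps)
    finally show ?thesis .
  qed
  define \<Psi>c where "\<Psi>c x g \<omega> = (\<Sum>i=1..T. w x i * clip \<tau> (e i g \<omega>)) / N" for x g \<omega>
  have iclip: "integrable M (\<lambda>\<omega>. clip \<tau> (e i g \<omega>))" if "i \<in> {1..T}" "g \<in> S" for i g
    using em[OF that] \<tau>1 by (intro integrable_const_bound[of _ \<tau>]) (auto simp: abs_clip)
  have i\<Psi>: "integrable M (\<Psi> x g)" if "g \<in> S" for x g
    unfolding \<Psi>_def using ie that
    by (intro integrable_divide Bochner_Integration.integrable_sum integrable_mult_right) auto
  have i\<Psi>c: "integrable M (\<Psi>c x g)" if "g \<in> S" for x g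
    unfolding \<Psi>c_def using iclip that
    by (intro integrable_divide Bochner_Integration.integrable_sum integrable_mult_right) auto
  \<comment> \<open>One null set serves all parameters, because the quantifier over \<open>S\<close>
    stands inside \<open>AE\<close>. The failure set itself need not be measurable and is only
    covered.\<close>
  from lip obtain Null where Null: "Null \<in> null_sets M"
    "{\<omega> \<in> space M. \<not> (\<forall>i\<in>{1..T}. \<forall>\<gamma>\<in>S. \<bar>e i \<gamma> \<omega> - e i (\<pi> \<gamma>) \<omega>\<bar> \<le> xi i (\<pi> \<gamma>) \<omega> * (a * h))} \<subseteq> Null"
    by (auto elim!: AE_E simp: null_sets_def)
  have approx: "\<bar>\<Psi> x \<gamma> \<omega> - \<Psi>c x (\<pi> \<gamma>) \<omega>\<bar> \<le> Rr \<omega>" if \<omega>: "\<omega> \<in> space M - Null" and \<gamma>: "\<gamma> \<in> S" for x \<gamma> \<omega>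
  proof -
    have "\<Psi> x \<gamma> \<omega> - \<Psi>c x (\<pi> \<gamma>) \<omega> = (\<Sum>i=1..T. w x i * (e i \<gamma> \<omega> - clip \<tau> (e i (\<pi> \<gamma>) \<omega>))) / N"
      unfolding \<Psi>_def \<Psi>c_def w_def by (simp add: diff_divide_distrib sum_subtractf right_diff_distrib)
    also have "\<bar>\<dots>\<bar> \<le> (\<Sum>i=1..T. \<bar>w x i * (e i \<gamma> \<omega> - clip \<tau> (e i (\<pi> \<gamma>) \<omega>))\<bar>) / N"
      using N0 by (simp add: divide_right_mono)
    also have "\<dots> \<le> (\<Sum>i=1..T. k0 * ((a * h) * (1 + Hx i \<omega> + He i \<omega>))) / N"
    proof (intro divide_right_mono sum_mono)
      fix i assume i: "i \<in> {1..T}"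
      have g: "\<pi> \<gamma> \<in> G" using \<pi>[OF \<gamma>] .
      have "\<bar>e i \<gamma> \<omega> - e i (\<pi> \<gamma>) \<omega>\<bar> \<le> xi i (\<pi> \<gamma>) \<omega> * (a * h)"
        using \<omega> \<gamma> i Null(2) by blast
      also have "\<dots> \<le> (1 + Hx i \<omega>) * (a * h)"
        using abs_le_one_plus_powr[of s "xi i (\<pi> \<gamma>) \<omega>"] Hx(4)[OF i g, of \<omega>] s ah0
        by (intro mult_right_mono) auto
      finally have 1: "\<bar>e i \<gamma> \<omega> - e i (\<pi> \<gamma>) \<omega>\<bar> \<le> (1 + Hx i \<omega>) * (a * h)" .
      have "\<bar>e i (\<pi> \<gamma>) \<omega> - clip \<tau> (e i (\<pi> \<gamma>) \<omega>)\<bar> \<le> \<tau> powr (1 - s) * \<bar>e i (\<pi> \<gamma>) \<omega>\<bar> powr s"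
        using \<tau>1 s by (intro clip_error) auto
      also have "\<dots> \<le> (a * h) * He i \<omega>" unfolding \<tau>s using He(4)[OF i g] ah0 by (intro mult_left_mono) auto
      finally have "\<bar>e i \<gamma> \<omega> - clip \<tau> (e i (\<pi> \<gamma>) \<omega>)\<bar> \<le> (a * h) * (1 + Hx i \<omega> + He i \<omega>)"
        using 1 by (simp add: algebra_simps)
      then show "\<bar>w x i * (e i \<gamma> \<omega> - clip \<tau> (e i (\<pi> \<gamma>) \<omega>))\<bar> \<le> k0 * ((a * h) * (1 + Hx i \<omega> + He i \<omega>))"
        unfolding abs_mult using wk k0 by (intro mult_mono) auto
    qed (use N0 in simp)
    also have "\<dots> = Rr \<omega>" by (simp add: Rr_def sum_distrib_left[symmetric] mult_ac)
    finally show ?thesis .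
  qed
  have approxE: "\<bar>expectation (\<Psi> x \<gamma>) - expectation (\<Psi>c x (\<pi> \<gamma>))\<bar> \<le> KR" if \<gamma>: "\<gamma> \<in> S" for x \<gamma>
  proof -
    have "\<bar>expectation (\<Psi> x \<gamma>) - expectation (\<Psi>c x (\<pi> \<gamma>))\<bar> \<le> expectation Rr"
    proof (rule expectation_diff_le_AE)
      show "AE \<omega> in M. \<bar>\<Psi> x \<gamma> \<omega> - \<Psi>c x (\<pi> \<gamma>) \<omega>\<bar> \<le> Rr \<omega>"
        by (rule AE_I'[OF Null(1)]) (use approx[OF _ \<gamma>] in blast)
    qed (use i\<Psi>[OF \<gamma>] i\<Psi>c[OF subsetD[OF G(2) \<pi>[OF \<gamma>]]] iRr in auto)
    then show ?thesis using ERr by linarith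
  qed
  obtain Q where Q: "finite Q" "real (card Q) \<le> 1 / (a * h) + 2" "\<And>x. x \<in> {0..1} \<Longrightarrow> \<exists>q\<in>Q. \<bar>x - q\<bar> \<le> a * h"
    using unit_interval_net[OF ah0] by blast
  \<comment> \<open>The radius \<open>R + 1\<close> makes the window contain the kernel support for
    every \<open>x\<close> within \<open>a * h \<le> h\<close> of \<open>q\<close>. It is also the
    source of \<open>R + 3\<close> and \<open>2 * R + 3\<close> in the constants.\<close>
  define W where "W q = {i\<in>{1..T}. \<bar>real i / real T - q\<bar> \<le> (R + 1) * h}" for q
  define cen where "cen f g i \<omega> = f i (e i g \<omega>) - expectation (\<lambda>\<omega>. f i (e i g \<omega>))" for f :: "nat \<Rightarrow> real \<Rightarrow> real" and g i \<omega>
  \<comment> \<open>Two families are needed: \<open>f1\<close> carries the weights at the net point,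
    divided by \<open>k0\<close> so that it is dominated by the identity; \<open>f2\<close> serves
    to move \<open>x\<close>.\<close>
  define f1 where "f1 q i u = w q i / k0 * clip \<tau> u" for q and i :: nat and u
  define f2 where "f2 i u = \<bar>clip \<tau> u\<bar>" for i :: nat and u
  have f1: "f1 q i \<in> borel_measurable borel" "\<bar>f1 q i u\<bar> \<le> \<bar>u\<bar>" "\<bar>f1 q i u\<bar> \<le> \<tau>" for q i u
  proof -
    show "f1 q i \<in> borel_measurable borel" unfolding f1_def by measurable
    have "\<bar>f1 q i u\<bar> = \<bar>w q i\<bar> / k0 * \<bar>clip \<tau> u\<bar>" using k0 by (simp add: f1_def abs_mult)
    also have "\<dots> \<le> 1 * \<bar>clip \<tau> u\<bar>" using wk[of q i] k0 by (intro mult_right_mono) auto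
    finally have "\<bar>f1 q i u\<bar> \<le> min \<tau> \<bar>u\<bar>" using \<tau>1 by (simp add: abs_clip)
    then show "\<bar>f1 q i u\<bar> \<le> \<bar>u\<bar>" "\<bar>f1 q i u\<bar> \<le> \<tau>" by auto
  qed
  have f2: "f2 i \<in> borel_measurable borel" "\<bar>f2 i u\<bar> \<le> \<bar>u\<bar>" "\<bar>f2 i u\<bar> \<le> \<tau>" for i u
  proof -
    show "f2 i \<in> borel_measurable borel" unfolding f2_def by measurable
    show "\<bar>f2 i u\<bar> \<le> \<bar>u\<bar>" "\<bar>f2 i u\<bar> \<le> \<tau>" using \<tau>1 by (auto simp: f2_def abs_clip)
  qed
  define Ev where "Ev f g q = {\<omega> \<in> space M. \<bar>\<Sum>i\<in>W q. cen f g i \<omega>\<bar> > E1 * (D * N * a)}" for f g q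
  define pb where "pb = 4 * (exp (- (y * (N * a\<^sup>2))) + 3 * A * (R + 3) * N * (2 * a * \<tau>) powr (1 + \<beta>))"
  have MA: "mixing_array M (\<lambda>i. e i g) T A \<beta> s (c * D)" if "g \<in> G" for g
    by unfold_locales (use em mixing[OF that] A s \<eta> cD moment_e that G in auto)
  have Ev: "Ev f g q \<in> events" "prob (Ev f g q) \<le> pb" 
    if g: "g \<in> G" and f: "\<And>i. f i \<in> borel_measurable borel" "\<And>i u. \<bar>f i u\<bar> \<le> \<bar>u\<bar>" "\<And>i u. \<bar>f i u\<bar> \<le> \<tau>" for f g q
  proof -
    interpret MA: mixing_array M "\<lambda>i. e i g" T A \<beta> s "c * D" by (rule MA[OF g])
    have cen: "cen f g = MA.centered f" by (simp add: fun_eq_iff cen_def MA.centered_def)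
    have "(\<lambda>\<omega>. cen f g i \<omega>) \<in> borel_measurable M" if "i \<in> W q" for i
      unfolding cen_def using em[of i g] g G that
      by (intro borel_measurable_diff measurable_compose[OF _ f(1)]) (auto simp: W_def)
    then have [measurable]: "(\<lambda>\<omega>. \<Sum>i\<in>W q. cen f g i \<omega>) \<in> borel_measurable M" by (intro borel_measurable_sum) auto
    show "Ev f g q \<in> events" unfolding Ev_def by measurable
    show "prob (Ev f g q) \<le> pb"
      using MA.window_deviation[OF f T h, where \<rho>="R + 1" and D=D and c=c and a=a and y=y and x=q] R D a \<tau>1 a\<tau> y \<beta>
      unfolding Ev_def pb_def cen E1_def W_def N_def by (simp add: add.assoc)
  qed
  have EvBound: "\<bar>\<Psi>c x g \<omega> - expectation (\<Psi>c x g)\<bar> \<le> (k0 * E1 + l0 * (E1 + 2 * (2 * R + 3) * (1 + c))) * (D * a)"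
    if g: "g \<in> G" and q: "\<bar>x - q\<bar> \<le> a * h" and \<omega>: "\<omega> \<in> space M" "\<omega> \<notin> Ev (f1 q) g q" "\<omega> \<notin> Ev f2 g q" for x q g \<omega>
  proof -
    have gS: "g \<in> S" using g G by auto
    interpret MA: mixing_array M "\<lambda>i. e i g" T A \<beta> s "c * D" by (rule MA[OF g])
    define Z where "Z i = clip \<tau> (e i g \<omega>) - expectation (\<lambda>\<omega>. clip \<tau> (e i g \<omega>))" for i
    define EY where "EY i = expectation (\<lambda>\<omega>. \<bar>clip \<tau> (e i g \<omega>)\<bar>)" for i
    have finW: "finite (W q)" and WT: "W q \<subseteq> {1..T}" by (auto simp: W_def)
    have E10: "0 \<le> E1" unfolding E1_def using y R MA.block_var_nonneg by simp
    have "\<Psi>c x g \<omega> - expectation (\<Psi>c x g) = (\<Sum>i=1..T. w x i * Z i) / N"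
      unfolding \<Psi>c_def Z_def using iclip gS
      by (simp add: Bochner_Integration.integral_sum diff_divide_distrib sum_subtractf right_diff_distrib cong: sum.cong)
    also have "(\<Sum>i=1..T. w x i * Z i) = (\<Sum>i\<in>W q. w x i * Z i)"
    proof (rule sum.mono_neutral_right)
      show "\<forall>i\<in>{1..T} - W q. w x i * Z i = 0"
      proof
        fix i assume "i \<in> {1..T} - W q"
        then have "(R + 1) * h < \<bar>real i / real T - q\<bar>" by (auto simp: W_def)
        moreover have "a * h \<le> h" using a h by simp
        ultimately have "R * h < \<bar>real i / real T - x\<bar>" using q by (simp add: algebra_simps)
        then have "R < \<bar>(real i / real T - x) / h\<bar>" using h by (simp add: abs_divide less_divide_eq)
        then show "w x i * Z i = 0" using R by (simp add: w_def)
      qed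
    qed (use WT in auto)
    \<comment> \<open>The first sum is governed by the event for \<open>f1 q\<close>. In the second
      the weights differ by at most \<open>l0 * a\<close>, because \<open>x\<close> moves by
      \<open>a * h\<close> and the kernel argument is scaled by \<open>1 / h\<close>.\<close>
    also have "(\<Sum>i\<in>W q. w x i * Z i) = (\<Sum>i\<in>W q. w q i * Z i) + (\<Sum>i\<in>W q. (w x i - w q i) * Z i)"
      by (simp add: sum.distrib[symmetric] algebra_simps)
    finally have eq: "\<Psi>c x g \<omega> - expectation (\<Psi>c x g) = ((\<Sum>i\<in>W q. w q i * Z i) + (\<Sum>i\<in>W q. (w x i - w q i) * Z i)) / N" .
    have 1: "\<bar>\<Sum>i\<in>W q. w q i * Z i\<bar> \<le> k0 * (E1 * (D * N * a))"
    proof -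
      have "cen (f1 q) g i \<omega> = w q i * Z i / k0" for i
        by (simp add: cen_def f1_def Z_def diff_divide_distrib right_diff_distrib)
      then have "(\<Sum>i\<in>W q. cen (f1 q) g i \<omega>) = (\<Sum>i\<in>W q. w q i * Z i) / k0" by (simp add: sum_divide_distrib)
      then have "\<bar>\<Sum>i\<in>W q. w q i * Z i\<bar> / k0 \<le> E1 * (D * N * a)" using \<omega> k0 by (auto simp: Ev_def)
      then show ?thesis using k0 by (simp add: divide_le_eq mult.commute)
    qed
    have 2: "\<bar>\<Sum>i\<in>W q. (w x i - w q i) * Z i\<bar> \<le> l0 * a * (E1 * (D * N * a) + 2 * ((2 * R + 3) * N * ((1 + c) * D)))"
    proof -
      have "\<bar>\<Sum>i\<in>W q. (w x i - w q i) * Z i\<bar> \<le> (\<Sum>i\<in>W q. \<bar>(w x i - w q i) * Z i\<bar>)" by (rule sum_abs)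
      also have "\<dots> \<le> (\<Sum>i\<in>W q. l0 * a * (cen f2 g i \<omega> + 2 * EY i))"
      proof (rule sum_mono)
        fix i assume i: "i \<in> W q"
        have "\<bar>w x i - w q i\<bar> \<le> l0 * \<bar>(real i / real T - x) / h - (real i / real T - q) / h\<bar>" unfolding w_def by (rule l0)
        also have "(real i / real T - x) / h - (real i / real T - q) / h = (q - x) / h" by (simp add: diff_divide_distrib)
        also have "l0 * \<bar>(q - x) / h\<bar> \<le> l0 * a"
          using q h l0 by (intro mult_left_mono) (auto simp: abs_divide divide_le_eq abs_minus_commute)
        finally have ww: "\<bar>w x i - w q i\<bar> \<le> l0 * a" .
        have "\<bar>expectation (\<lambda>\<omega>. clip \<tau> (e i g \<omega>))\<bar> \<le> EY i"
          unfolding EY_def using integral_norm_bound[of M "\<lambda>\<omega>. clip \<tau> (e i g \<omega>)"] by simp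
        \<comment> \<open>Recentring: \<open>\<bar>clip\<bar> + EY\<close> equals
          \<open>(\<bar>clip\<bar> - EY) + 2 * EY\<close>. The centred part is controlled by the
          event for \<open>f2\<close>, and \<open>EY\<close> is of order \<open>D\<close> by the
          moment bound, so no factor \<open>\<tau>\<close> appears.\<close>
        then have "\<bar>Z i\<bar> \<le> cen f2 g i \<omega> + 2 * EY i"
          unfolding Z_def cen_def f2_def EY_def[symmetric] by linarith
        then show "\<bar>(w x i - w q i) * Z i\<bar> \<le> l0 * a * (cen f2 g i \<omega> + 2 * EY i)"
          unfolding abs_mult using ww l0 a by (intro mult_mono) auto
      qed
      also have "\<dots> = l0 * a * ((\<Sum>i\<in>W q. cen f2 g i \<omega>) + 2 * (\<Sum>i\<in>W q. EY i))"
        by (simp add: sum.distrib sum_distrib_left algebra_simps)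
      also have "\<dots> \<le> l0 * a * (E1 * (D * N * a) + 2 * ((2 * R + 3) * N * ((1 + c) * D)))"
      proof -
        have "(\<Sum>i\<in>W q. cen f2 g i \<omega>) \<le> E1 * (D * N * a)" using \<omega> by (auto simp: Ev_def)
        moreover have "(\<Sum>i\<in>W q. EY i) \<le> (2 * R + 3) * N * ((1 + c) * D)"
        proof -
          have "EY i \<le> (1 + c) * D" if "i \<in> W q" for i
          proof -
            have i: "i \<in> {1..T}" using that WT by auto
            have "EY i \<le> expectation (\<lambda>\<omega>. 1 + \<bar>e i g \<omega>\<bar> powr s)"
              unfolding EY_def
            proof (rule integral_mono)
              show "\<bar>clip \<tau> (e i g \<omega>)\<bar> \<le> 1 + \<bar>e i g \<omega>\<bar> powr s" for \<omega>
                using abs_le_one_plus_powr[of s "e i g \<omega>"] s \<tau>1 by (simp add: abs_clip)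
            qed (use iclip[OF i gS] moment_e[OF i gS] in auto)
            also have "\<dots> \<le> 1 + c * D" using moment_e[OF i gS] by (simp add: prob_space)
            also have "\<dots> \<le> (1 + c) * D" using D by (simp add: algebra_simps)
            finally show ?thesis .
          qed
          then have "(\<Sum>i\<in>W q. EY i) \<le> (\<Sum>i\<in>W q. (1 + c) * D)" by (rule sum_mono)
          also have "\<dots> = real (card (W q)) * ((1 + c) * D)" by simp
          also have "\<dots> \<le> (2 * R + 3) * N * ((1 + c) * D)"
          proof (rule mult_right_mono)
            obtain lo n where "W q = {lo..<lo+n}" "real n \<le> 2 * (R + 1) * N + 1"
              unfolding W_def N_def using window_interval[of T h "R + 1" q] T h R by auto
            then show "real (card (W q)) \<le> (2 * R + 3) * N" using N1 by (simp add: algebra_simps)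
          qed (use c D in simp)
          finally show ?thesis .
        qed
        ultimately show ?thesis using l0 a by (intro mult_left_mono) auto
      qed
      finally show ?thesis .
    qed
    have "\<bar>\<Psi>c x g \<omega> - expectation (\<Psi>c x g)\<bar> \<le> (k0 * (E1 * (D * N * a)) + l0 * a * (E1 * (D * N * a) + 2 * ((2 * R + 3) * N * ((1 + c) * D)))) / N"
      unfolding eq using N0 1 2 by (simp add: divide_right_mono)
    also have "\<dots> = (k0 * E1 + l0 * (E1 * a + 2 * (2 * R + 3) * (1 + c))) * (D * a)"
      using N0 by (simp add: field_simps)
    also have "\<dots> \<le> (k0 * E1 + l0 * (E1 * 1 + 2 * (2 * R + 3) * (1 + c))) * (D * a)"
      using l0 a D E10 by (intro mult_right_mono add_left_mono mult_left_mono add_right_mono) auto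
    finally show ?thesis by simp
  qed
  define BR where "BR = {\<omega> \<in> space M. Rr \<omega> \<ge> KR / \<delta>}"
  have BR: "BR \<in> events" "prob BR \<le> \<delta>"
  proof -
    have [measurable]: "Rr \<in> borel_measurable M" using iRr by auto
    show "BR \<in> events" unfolding BR_def by measurable
    have "prob BR \<le> expectation Rr / (KR / \<delta>)"
      unfolding BR_def by (rule integral_Markov_inequality_measure[of _ _ "{}"]) (use iRr Rr0 KR0 \<delta> in auto)
    also have "\<dots> \<le> KR / (KR / \<delta>)" using ERr KR0 \<delta> by (intro divide_right_mono) auto
    also have "\<dots> = \<delta>" using KR0 by simp
    finally show "prob BR \<le> \<delta>" .
  qed
  \<comment> \<open>Two events for each pair of net points give \<open>2 * pb\<close>, hence the
    factor 8.\<close>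
  define BG where "BG = (\<Union>gq\<in>G\<times>Q. Ev (f1 (snd gq)) (fst gq) (snd gq) \<union> Ev f2 (fst gq) (snd gq))"
  have BG: "BG \<in> events" "prob BG \<le> real (card G) * (1 / (a * h) + 2) * (2 * pb)"
  proof -
    have ev: "Ev (f1 (snd gq)) (fst gq) (snd gq) \<union> Ev f2 (fst gq) (snd gq) \<in> events" if "gq \<in> G \<times> Q" for gq
      using that Ev(1)[OF _ f1] Ev(1)[OF _ f2] by auto
    show "BG \<in> events" unfolding BG_def using ev G Q by (intro sets.finite_UN) auto
    have pb0: "0 \<le> pb" unfolding pb_def using A R N0 by simp
    have "prob BG \<le> (\<Sum>gq\<in>G\<times>Q. prob (Ev (f1 (snd gq)) (fst gq) (snd gq) \<union> Ev f2 (fst gq) (snd gq)))"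
      unfolding BG_def using ev G Q by (intro finite_measure_subadditive_finite) auto
    also have "\<dots> \<le> (\<Sum>gq\<in>G\<times>Q. pb + pb)"
      using Ev[OF _ f1] Ev[OF _ f2] by (intro sum_mono order_trans[OF measure_Un_le] add_mono) auto
    also have "\<dots> = real (card G) * real (card Q) * (2 * pb)" by (simp add: card_cartesian_product)
    also have "\<dots> \<le> real (card G) * (1 / (a * h) + 2) * (2 * pb)"
      using Q pb0 by (intro mult_right_mono mult_left_mono) auto
    finally show "prob BG \<le> real (card G) * (1 / (a * h) + 2) * (2 * pb)" .
  qed
  show thesis
  proof (rule that[of "Null \<union> (BR \<union> BG)"])
    show "Null \<union> (BR \<union> BG) \<in> events" using Null BR BG by auto
    have "prob (Null \<union> (BR \<union> BG)) \<le> prob Null + (prob BR + prob BG)"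
      using Null BR BG by (intro order_trans[OF measure_Un_le] add_left_mono) auto
    also have "prob Null = 0" using Null by (simp add: measure_eq_0_null_sets)
    finally show "prob (Null \<union> (BR \<union> BG)) \<le> \<delta> + real (card G) * (1 / (a * h) + 2) *
        (8 * (exp (- (y * (N * a\<^sup>2))) + 3 * A * (R + 3) * N * (2 * a * \<tau>) powr (1 + \<beta>)))"
      using BR BG unfolding pb_def by (simp add: mult_ac)
    fix \<omega> \<gamma> x assume \<omega>: "\<omega> \<in> space M - (Null \<union> (BR \<union> BG))" and \<gamma>: "\<gamma> \<in> S" and x: "x \<in> {0..1::real}"
    have g: "\<pi> \<gamma> \<in> G" using \<pi>[OF \<gamma>] .
    obtain q where q: "q \<in> Q" "\<bar>x - q\<bar> \<le> a * h" using Q(3)[OF x] by blast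
    have "\<bar>\<Psi>c x (\<pi> \<gamma>) \<omega> - expectation (\<Psi>c x (\<pi> \<gamma>))\<bar> \<le> (k0 * E1 + l0 * (E1 + 2 * (2 * R + 3) * (1 + c))) * (D * a)"
      using \<omega> g q by (intro EvBound[OF g q(2)]) (auto simp: BG_def)
    moreover have "\<bar>\<Psi> x \<gamma> \<omega> - \<Psi>c x (\<pi> \<gamma>) \<omega>\<bar> \<le> KR / \<delta>"
      using approx[of \<omega> \<gamma> x] \<omega> \<gamma> by (auto simp: BR_def)
    ultimately have "\<bar>\<Psi> x \<gamma> \<omega> - expectation (\<Psi> x \<gamma>)\<bar> \<le> KR / \<delta> + KR + (k0 * E1 + l0 * (E1 + 2 * (2 * R + 3) * (1 + c))) * (D * a)"
      using approxE[OF \<gamma>, of x] by linarith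
    also have "\<dots> = (k0 * (1 + 2 * c) * (1 / \<delta> + 1) + k0 * E1 + l0 * (E1 + 2 * (2 * R + 3) * (1 + c))) * (D * a)"
      by (simp add: KR_def algebra_simps add_divide_distrib)
    finally show "\<bar>\<Psi> x \<gamma> \<omega> - expectation (\<Psi> x \<gamma>)\<bar>
        \<le> (k0 * (1 + 2 * c) * (1 / \<delta> + 1) + k0 * E1 + l0 * (E1 + 2 * (2 * R + 3) * (1 + c))) * (D * a)" .
  qed
qed

end

section \<open>Rates\<close>

text \<open>\<open>Z\<close> is the order of the number of pairs of net points: \<open>m\<close> of
  the powers of \<open>1 / (a * h)\<close> come from the parameter and one from \<open>x\<close>.
  The two limits concern the two terms of the tail bound, multiplied by this number.\<close>

lemma rate_asymptotics:
  fixes h :: "nat \<Rightarrow> real" and m :: nat and s \<beta> c r \<theta> :: real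
  defines "a \<equiv> \<lambda>T. sqrt (ln (real T) / (real T * h T))"
  defines "\<tau> \<equiv> \<lambda>T. (a T * h T) powr (- 1 / (s - 1))"
  defines "Z \<equiv> \<lambda>T. (real T powr r) ^ m * (1 / (a T * h T)) ^ (m + 1)"
  assumes h_pos: "\<forall>T\<ge>1. h T > 0" and h_lim: "h \<longlonglongrightarrow> 0"
    and Th_lim: "filterlim (\<lambda>T. real T * h T) at_top sequentially"
    and s: "s > 2" and \<beta>: "\<beta> > 0" and c: "c > 0" and r: "0 \<le> r" "r \<le> c"
    and \<theta>: "\<theta> = (\<beta> * (s - 2) - real m * (s - 1) * (1 + 2 * c) - 2 * s + 1) / (\<beta> * s + real m * (s - 1) + 1)"
    and rate: "(\<lambda>T. ln (real T) / (real T powr \<theta> * h T)) \<longlonglongrightarrow> 0"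
  shows "\<forall>\<^sub>F T in sequentially. 1 \<le> T \<and> 0 < h T \<and> 0 < a T \<and> a T \<le> 1 \<and> real T * h T * (a T)\<^sup>2 = ln (real T)
            \<and> 1 \<le> ln (real T) \<and> a T * h T \<le> 1 \<and> a T * \<tau> T \<le> 1"
    and "(\<lambda>T. Z T * exp (- ((real m + 2 + c * real m) * ln (real T)))) \<longlonglongrightarrow> 0"
    and "(\<lambda>T. Z T * (real T * h T * (a T * \<tau> T) powr (1 + \<beta>))) \<longlonglongrightarrow> 0"
proof -
  define den where "den = \<beta> * s + real m * (s - 1) + 1"
  define num where "num = \<beta> * (s - 2) - real m * (s - 1) * (1 + 2 * c) - 2 * s + 1"
  \<comment> \<open>In \<open>X\<close> below, \<open>h\<close> has exactly the exponent
    \<open>- den / (2 * (s - 1))\<close> and, at \<open>r = c\<close>, \<open>T\<close> has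
    \<open>- num / (2 * (s - 1))\<close>. Apart from surplus powers of \<open>ln T\<close>,
    \<open>X\<close> is thus the power \<open>q\<close> of the quotient in the rate condition, which
    explains \<open>\<theta> = num / den\<close>.\<close>
  define q where "q = den / (2 * (s - 1))"
  have den: "den > 0" unfolding den_def using \<beta> s by (intro add_nonneg_pos add_nonneg_nonneg) auto
  have q: "q > 0" unfolding q_def using den s by simp
  have \<theta>den: "den * \<theta> = num" using den by (simp add: \<theta> den_def num_def)
  have "num \<le> den"
  proof -
    have "0 \<le> 2 * \<beta> + real m * (s - 1) * (2 + 2 * c) + 2 * s" using \<beta> s c by simp
    then show ?thesis by (simp add: num_def den_def algebra_simps)
  qed
  then have \<theta>1: "\<theta> \<le> 1" using \<theta>den den by (metis mult.right_neutral mult_le_cancel_left_pos)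
  have ev: "\<forall>\<^sub>F T in sequentially. 3 \<le> T \<and> h T < 1 \<and> 1 \<le> real T * h T \<and> ln (real T) / (real T powr \<theta> * h T) < 1"
    using eventually_ge_at_top[of "3::nat"] order_tendstoD(2)[OF h_lim zero_less_one]
      filterlim_at_top[THEN iffD1, OF Th_lim, rule_format, of 1] order_tendstoD(2)[OF rate zero_less_one]
    by eventually_elim auto
  have basic: "1 \<le> T \<and> 0 < h T \<and> 0 < a T \<and> a T \<le> 1 \<and> real T * h T * (a T)\<^sup>2 = ln (real T)
            \<and> 1 \<le> ln (real T) \<and> a T * h T \<le> 1"
    if T: "3 \<le> T \<and> h T < 1 \<and> 1 \<le> real T * h T \<and> ln (real T) / (real T powr \<theta> * h T) < 1" for T
  proof -
    have h0: "0 < h T" using h_pos T by simp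
    have "exp 1 \<le> real T" using exp_le T by (intro order_trans[OF exp_le]) simp
    then have L: "1 \<le> ln (real T)" using T by (subst ln_ge_iff) auto
    have "ln (real T) / (real T * h T) \<le> ln (real T) / (real T powr \<theta> * h T)"
    proof (intro divide_left_mono mult_right_mono)
      have "real T powr \<theta> \<le> real T powr 1" using T \<theta>1 by (intro powr_mono) auto
      then show "real T powr \<theta> \<le> real T" using T by simp
    qed (use L h0 T in auto)
    then have le1: "ln (real T) / (real T * h T) \<le> 1" using T by linarith
    have pos: "0 < ln (real T) / (real T * h T)" using L h0 T by simp
    have a: "0 < a T" "a T \<le> 1" unfolding a_def using pos le1 by (auto simp: real_sqrt_le_1_iff)
    have "(a T)\<^sup>2 = ln (real T) / (real T * h T)" unfolding a_def using pos by simp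
    then have "real T * h T * (a T)\<^sup>2 = ln (real T)" using h0 T by simp
    moreover have "a T * h T \<le> 1" using a h0 T by (intro mult_le_one) auto
    ultimately show ?thesis using T h0 a L by auto
  qed
  \<comment> \<open>Here \<open>(T * a * h)\<^sup>2\<close> is the product of \<open>T * h\<close>
    and \<open>ln T\<close>, both at least 1, so \<open>1 / (a * h) \<le> T\<close> and
    \<open>Z\<close> is at most \<open>T powr (c * m + m + 1)\<close>. The coefficient
    \<open>m + 2 + c * m\<close> exceeds this exponent by one.\<close>
  have Zle: "Z T * exp (- ((real m + 2 + c * real m) * ln (real T))) \<le> 1 / real T"
    if T: "3 \<le> T \<and> h T < 1 \<and> 1 \<le> real T * h T \<and> ln (real T) / (real T powr \<theta> * h T) < 1" for T
  proof -
    note b = basic[OF T]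
    have T0: "real T > 0" using T by simp
    have "1 \<le> (real T * h T) * (real T * h T * (a T)\<^sup>2)" using b T mult_mono[of 1 "real T * h T" 1 "ln (real T)"] by simp
    also have "\<dots> = (real T * (a T * h T))\<^sup>2" by (simp add: power2_eq_square)
    finally have "1\<^sup>2 \<le> (real T * (a T * h T))\<^sup>2" by simp
    then have "1 \<le> real T * (a T * h T)" using b T0 by (rule_tac power2_le_imp_le) auto
    then have 1: "1 / (a T * h T) \<le> real T" using b by (simp add: field_simps)
    have "Z T \<le> (real T powr c) ^ m * real T ^ (m + 1)"
      unfolding Z_def using r b 1 T by (intro mult_mono power_mono powr_mono) auto
    also have "\<dots> = real T powr (c * real m + (real m + 1))"
      using T0 by (simp add: powr_add powr_realpow powr_powr flip: powr_realpow)
    finally have "Z T * exp (- ((real m + 2 + c * real m) * ln (real T)))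
      \<le> real T powr (c * real m + (real m + 1)) * exp (- ((real m + 2 + c * real m) * ln (real T)))"
      by (intro mult_right_mono) auto
    also have "\<dots> = real T powr (- 1)"
      using T0 by (simp add: powr_def exp_add[symmetric] algebra_simps)
    finally show ?thesis using T0 by (simp add: powr_minus_divide)
  qed
  have Z0: "0 \<le> Z T" if "1 \<le> T" "0 < h T" "0 < a T" for T
    unfolding Z_def using that by simp
  show "(\<lambda>T. Z T * exp (- ((real m + 2 + c * real m) * ln (real T)))) \<longlonglongrightarrow> 0"
  proof (rule tendsto_sandwich[of "\<lambda>_. 0" _ _ "\<lambda>T. 1 / real T"])
    show "\<forall>\<^sub>F T in sequentially. 0 \<le> Z T * exp (- ((real m + 2 + c * real m) * ln (real T)))"
      using ev by eventually_elim (use basic Z0 in auto)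
    show "\<forall>\<^sub>F T in sequentially. Z T * exp (- ((real m + 2 + c * real m) * ln (real T))) \<le> 1 / real T"
      using ev by eventually_elim (rule Zle)
    show "(\<lambda>T. 1 / real T) \<longlonglongrightarrow> 0" using lim_1_over_n by simp
  qed simp
  define X where "X T = Z T * (real T * h T * (a T * \<tau> T) powr (1 + \<beta>))" for T
  have Xle: "X T \<le> (ln (real T) / (real T powr \<theta> * h T)) powr q"
    if T: "3 \<le> T \<and> h T < 1 \<and> 1 \<le> real T * h T \<and> ln (real T) / (real T powr \<theta> * h T) < 1" for T
  proof -
    note b = basic[OF T]
    have T0: "real T > 0" using T by simp
    \<comment> \<open>Both sides are products of powers, so taking logarithms leaves an inequality
      that is linear in \<open>l\<close>, \<open>lh\<close> and \<open>ll\<close>.\<close>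
    define l where "l = ln (real T)"
    define lh where "lh = ln (h T)"
    define ll where "ll = ln (ln (real T))"
    have ll: "0 \<le> ll" "1 \<le> l" using b by (auto simp: ll_def l_def)
    have \<tau>0: "\<tau> T > 0" unfolding \<tau>_def using b by simp
    have la: "ln (a T) = (ll - l - lh) / 2"
    proof -
      have "ln (real T) > 0" using b by linarith
      moreover have "real T * h T > 0" using b T0 by simp
      ultimately have "ln (a T) = (ln (ln (real T)) - ln (real T * h T)) / 2"
        unfolding a_def by (subst ln_sqrt) (simp_all only: ln_divide_pos divide_nonneg_pos less_imp_le)
      also have "ln (real T * h T) = l + lh" using b T0 by (simp only: ln_mult_pos l_def lh_def)
      finally show ?thesis by (simp add: ll_def)
    qed
    have lah: "ln (a T * h T) = (ll - l + lh) / 2"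
    proof -
      have "ln (a T * h T) = ln (a T) + lh" using b by (simp add: ln_mult_pos lh_def)
      then show ?thesis unfolding la by (simp add: field_simps)
    qed
    have l\<tau>: "ln (\<tau> T) = - ((ll - l + lh) / 2) / (s - 1)"
      unfolding \<tau>_def using b by (simp add: ln_powr lah)
    have Zpos: "Z T > 0" unfolding Z_def using b T0 by simp
    have lZ: "ln (Z T) = real m * (r * l) - (real m + 1) * ((ll - l + lh) / 2)"
    proof -
      have "ln (Z T) = ln ((real T powr r) ^ m) + ln ((1 / (a T * h T)) ^ (m + 1))"
        unfolding Z_def using b T0 by (intro ln_mult_pos) auto
      also have "ln ((real T powr r) ^ m) = real m * (r * l)" using T0 by (simp add: ln_realpow l_def)
      also have "ln ((1 / (a T * h T)) ^ (m + 1)) = (real m + 1) * ln (1 / (a T * h T))" by (subst ln_realpow) simp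
      also have "ln (1 / (a T * h T)) = - ((ll - l + lh) / 2)"
        unfolding lah[symmetric] using b by (subst ln_divide_pos) auto
      finally show ?thesis by simp
    qed
    have X0: "X T > 0" unfolding X_def using Zpos b T0 \<tau>0 by simp
    have lX: "ln (X T) = real m * (r * l) - (real m + 1) * ((ll - l + lh) / 2) + l + lh
        + (1 + \<beta>) * ((ll - l - lh) / 2 - (ll - l + lh) / 2 / (s - 1))"
      unfolding X_def using b T0 Zpos \<tau>0 by (simp add: ln_mult_pos ln_powr lZ la l\<tau> l_def lh_def)
    have lY: "ln ((ln (real T) / (real T powr \<theta> * h T)) powr q) = q * (ll - \<theta> * l - lh)"
    proof -
      have "ln (real T) > 0" using b by linarith
      moreover have "real T powr \<theta> * h T > 0" using b T0 by simp
      ultimately have "ln ((ln (real T) / (real T powr \<theta> * h T)) powr q) = q * (ln (ln (real T)) - ln (real T powr \<theta> * h T))"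
        by (simp only: ln_powr ln_divide_pos)
      also have "ln (real T powr \<theta> * h T) = \<theta> * l + lh"
        using b T0 by (simp add: ln_mult_pos ln_powr l_def lh_def)
      finally show ?thesis by (simp add: ll_def algebra_simps)
    qed
    have "2 * (s - 1) * ln (X T) \<le> den * ll - num * l - den * lh"
    proof -
      define V where "V = (1 + \<beta>) * ((ll - l - lh) / 2 - (ll - l + lh) / 2 / (s - 1))"
      have V: "2 * (s - 1) * V = (1 + \<beta>) * ((s - 1) * (ll - l - lh) - (ll - l + lh))"
      proof -
        have cancel: "2 * p * (b * (x / 2 - w / 2 / p)) = b * (p * x - w)" if "p \<noteq> 0" for p b x w :: real
          using that by (simp add: field_simps)
        have "s - 1 \<noteq> 0" using s by simp
        then show ?thesis unfolding V_def by (rule cancel)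
      qed
      have "2 * (s - 1) * ln (X T) = 2 * (s - 1) * (real m * (r * l)) - (s - 1) * ((real m + 1) * (ll - l + lh))
          + 2 * (s - 1) * (l + lh) + 2 * (s - 1) * V"
        unfolding lX V_def[symmetric] by (simp add: field_simps)
      \<comment> \<open>The two subtracted terms are nonnegative: surplus powers of
        \<open>ln T\<close>, and the slack between \<open>r\<close> and \<open>c\<close>.\<close>
      also have "\<dots> = den * ll - num * l - den * lh
          - (2 * \<beta> + 2 + 2 * (real m * (s - 1))) * ll - 2 * (s - 1) * (real m * ((c - r) * l))"
        unfolding V den_def num_def by (simp add: algebra_simps)
      also have "\<dots> \<le> den * ll - num * l - den * lh"
      proof -
        have "0 \<le> (2 * \<beta> + 2 + 2 * (real m * (s - 1))) * ll" using \<beta> s ll by simp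
        moreover have "0 \<le> 2 * (s - 1) * (real m * ((c - r) * l))" using s r ll by simp
        ultimately show ?thesis by linarith
      qed
      finally show ?thesis .
    qed
    also have "\<dots> = 2 * (s - 1) * (q * (ll - \<theta> * l - lh))"
      using s unfolding q_def \<theta>den[symmetric] by (simp add: field_simps)
    finally have "ln (X T) \<le> q * (ll - \<theta> * l - lh)"
      using s by (simp add: mult_le_cancel_left_pos)
    then show ?thesis unfolding lY[symmetric] using X0 b T0 by (subst (asm) ln_le_cancel_iff) auto
  qed
  have X0: "0 \<le> X T" if T: "3 \<le> T \<and> h T < 1 \<and> 1 \<le> real T * h T \<and> ln (real T) / (real T powr \<theta> * h T) < 1" for T
    unfolding X_def using basic[OF T] Z0[of T] by simp
  have Xlim: "X \<longlonglongrightarrow> 0"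
  proof (rule tendsto_sandwich[of "\<lambda>_. 0" _ _ "\<lambda>T. (ln (real T) / (real T powr \<theta> * h T)) powr q"])
    show "\<forall>\<^sub>F T in sequentially. 0 \<le> X T" using ev by eventually_elim (rule X0)
    show "\<forall>\<^sub>F T in sequentially. X T \<le> (ln (real T) / (real T powr \<theta> * h T)) powr q"
      using ev by eventually_elim (rule Xle)
    have "\<forall>\<^sub>F T in sequentially. 0 \<le> ln (real T) / (real T powr \<theta> * h T)"
      using ev
    proof eventually_elim
      case (elim T)
      have "0 < h T" "1 \<le> ln (real T)" using basic[OF elim] by auto
      then show ?case by (intro divide_nonneg_nonneg mult_nonneg_nonneg) auto
    qed
    then show "(\<lambda>T. (ln (real T) / (real T powr \<theta> * h T)) powr q) \<longlonglongrightarrow> 0"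
      using tendsto_powr'[OF rate tendsto_const[of q]] q by simp
  qed simp
  then show "(\<lambda>T. Z T * (real T * h T * (a T * \<tau> T) powr (1 + \<beta>))) \<longlonglongrightarrow> 0" unfolding X_def .
  have "\<forall>\<^sub>F T in sequentially. X T < 1" using order_tendstoD(2)[OF Xlim zero_less_one] .
  with ev show "\<forall>\<^sub>F T in sequentially. 1 \<le> T \<and> 0 < h T \<and> 0 < a T \<and> a T \<le> 1 \<and> real T * h T * (a T)\<^sup>2 = ln (real T)
            \<and> 1 \<le> ln (real T) \<and> a T * h T \<le> 1 \<and> a T * \<tau> T \<le> 1"
  proof eventually_elim
    case (elim T)
    note b = basic[OF elim(1)]
    have \<tau>0: "\<tau> T > 0" unfolding \<tau>_def using b by simp
    have Z1: "1 \<le> Z T"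
    proof -
      have "1 \<le> (real T powr r) ^ m" using b r by (intro one_le_power ge_one_powr_ge_zero) auto
      moreover have "1 \<le> (1 / (a T * h T)) ^ (m + 1)" using b by (intro one_le_power) auto
      ultimately show ?thesis unfolding Z_def using mult_mono[of 1 _ 1] by fastforce
    qed
    \<comment> \<open>This follows from the third limit itself: \<open>Z\<close> and
      \<open>T * h\<close> are at least 1, so \<open>a * \<tau> > 1\<close> would force
      \<open>X\<close> to be at least 1.\<close>
    have "a T * \<tau> T \<le> 1"
    proof (rule ccontr)
      assume "\<not> a T * \<tau> T \<le> 1"
      then have "1 \<le> (a T * \<tau> T) powr (1 + \<beta>)" using \<beta> by (intro ge_one_powr_ge_zero) auto
      then have "1 * (1 * 1) \<le> X T"
        unfolding X_def using Z1 elim by (intro mult_mono) auto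
      then show False using elim by simp
    qed
    then show ?case using b by blast
  qed
qed

text \<open>Suprema are taken in \<open>ennreal\<close>, so they exist without any boundedness, and
  the exceedance set is measured by outer probability because it need not be measurable.\<close>

theorem theorem1:
  fixes M :: "'a measure"
    and m j :: nat
    and \<Theta> :: "(nat \<Rightarrow> real) set"
    and eps xi :: "nat \<Rightarrow> nat \<Rightarrow> (nat \<Rightarrow> real) \<Rightarrow> 'a \<Rightarrow> real"
    and h :: "nat \<Rightarrow> real"
    and K :: "real \<Rightarrow> real"
    and \<beta> s lam c :: real
  assumes P: "prob_space M"
    and Theta: "\<Theta> \<subseteq> vecs m"
    and eps_meas: "\<And>T i g. 1 \<le> T \<Longrightarrow> i \<in> {1..T} \<Longrightarrow> g \<in> \<Theta> \<Longrightarrow> eps T i g \<in> borel_measurable M"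
    and h_pos: "\<And>T. 1 \<le> T \<Longrightarrow> h T > 0"
    and h_lim: "h \<longlonglongrightarrow> 0"
    and Th_lim: "filterlim (\<lambda>T. real T * h T) at_top sequentially"
    and s_gt: "s > 2"
    and lam: "lam \<ge> 0"
    and c_pos: "c > 0"
    \<comment> \<open>(A.1)\<close>
    and A1: "\<exists>A>0. \<beta> > 2 \<and> (\<forall>i\<ge>1. \<forall>T\<ge>1. \<forall>g\<in>\<Theta>.
                mixing_coef M (\<lambda>r. eps T r g) T (int i) \<le> A * real i powr (- \<beta>))"
    \<comment> \<open>(A.2)\<close>
    and A2: "\<exists>Kb \<mu>b \<Lambda>1 L1. (\<forall>u. \<bar>K u\<bar> \<le> Kb)
                \<and> (\<integral>\<^sup>+ u. ennreal (\<bar>K u\<bar> powr s) \<partial>lborel) \<le> ennreal \<mu>b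
                \<and> 1 \<le> \<Lambda>1 \<and> 1 \<le> L1
                \<and> (\<forall>u. \<bar>u\<bar> > L1 \<longrightarrow> K u = 0)
                \<and> (\<forall>u u'. \<bar>K u - K u'\<bar> \<le> \<Lambda>1 * \<bar>u - u'\<bar>)"
    \<comment> \<open>(A.3)\<close>
    and xi_meas: "\<And>T i g. 1 \<le> T \<Longrightarrow> i \<in> {1..T} \<Longrightarrow> g \<in> \<Theta> \<Longrightarrow> xi T i g \<in> borel_measurable M"
    and xi_nonneg: "\<And>T i g \<omega>. 1 \<le> T \<Longrightarrow> i \<in> {1..T} \<Longrightarrow> g \<in> \<Theta> \<Longrightarrow> xi T i g \<omega> \<ge> 0"
    and A3_lip: "\<And>T i. 1 \<le> T \<Longrightarrow> i \<in> {1..T} \<Longrightarrow>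
                AE \<omega> in M. \<forall>g\<in>\<Theta>. \<forall>g'\<in>\<Theta>. enorm m (\<lambda>k. g' k - g k) \<le> h T \<longrightarrow>
                   \<bar>eps T i g' \<omega> - eps T i g \<omega>\<bar> \<le> xi T i g \<omega> * enorm m (\<lambda>k. g' k - g k)"
    and A3_mom: "\<exists>C1>0. \<exists>C2>0. \<forall>T\<ge>1. \<forall>i\<in>{1..T}. \<forall>g\<in>\<Theta>.
                (\<integral>\<^sup>+ \<omega>. ennreal (\<bar>eps T i g \<omega>\<bar> powr s) \<partial>M) \<le> ennreal (C1 * (1 + rpow (enorm m g) lam))
              \<and> (\<integral>\<^sup>+ \<omega>. ennreal (\<bar>xi T i g \<omega>\<bar> powr s) \<partial>M) \<le> ennreal (C2 * (1 + rpow (enorm m g) lam))"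
    \<comment> \<open>rate conditions\<close>
    and beta_cond: "\<beta> > (real m * (s - 1) * (1 + 2 * c) + 2 * s - 1) / (s - 2)"
    and rate: "let \<theta> = (\<beta> * (s - 2) - real m * (s - 1) * (1 + 2 * c) - 2 * s + 1)
                      / (\<beta> * s + real m * (s - 1) + 1)
               in (\<lambda>T. ln (real T) / (real T powr \<theta> * h T)) \<longlonglongrightarrow> 0"
    \<comment> \<open>uniform moment bounds over \<Theta>_T\<close>
    and sup_mom: "let \<theta> = (\<beta> * (s - 2) - real m * (s - 1) * (1 + 2 * c) - 2 * s + 1)
                         / (\<beta> * s + real m * (s - 1) + 1);
                     r = (if lam = 0 then c else min c ((1 - \<theta>) / (2 * lam)));
                     d = (\<lambda>T. real T powr r)
                 in \<exists>C>0. \<forall>T\<ge>1. \<forall>i\<in>{1..T}.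
                   (\<integral>\<^sup>+ \<omega>. (SUP g\<in>{g\<in>\<Theta>. enorm m g \<le> d T}. ennreal (\<bar>eps T i g \<omega>\<bar> powr s)) \<partial>M)
                      \<le> ennreal (C * (1 + rpow (d T) lam))
                 \<and> (\<integral>\<^sup>+ \<omega>. (SUP g\<in>{g\<in>\<Theta>. enorm m g \<le> d T}. ennreal (\<bar>xi T i g \<omega>\<bar> powr s)) \<partial>M)
                      \<le> ennreal (C * (1 + rpow (d T) lam))"
  shows "let \<theta> = (\<beta> * (s - 2) - real m * (s - 1) * (1 + 2 * c) - 2 * s + 1)
                 / (\<beta> * s + real m * (s - 1) + 1);
             r = (if lam = 0 then c else min c ((1 - \<theta>) / (2 * lam)));
             d = (\<lambda>T. real T powr r)
         in \<forall>\<delta>>0. \<exists>Mc. \<forall>\<^sub>F T in sequentially.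
              outer_prob M {\<omega> \<in> space M.
                 (SUP gx \<in> {g\<in>\<Theta>. enorm m g \<le> d T} \<times> {0..1}.
                    ennreal \<bar>Psi_hat K h eps j T (snd gx) (fst gx) \<omega>
                       - integral\<^sup>L M (Psi_hat K h eps j T (snd gx) (fst gx))\<bar>)
                 > ennreal (Mc * (rpow (d T) lam * sqrt (ln (real T) / (real T * h T))))} \<le> \<delta>"
proof -
  interpret prob_space M by (rule P)
  define \<theta> where "\<theta> = (\<beta> * (s - 2) - real m * (s - 1) * (1 + 2 * c) - 2 * s + 1) / (\<beta> * s + real m * (s - 1) + 1)"
  define r where "r = (if lam = 0 then c else min c ((1 - \<theta>) / (2 * lam)))"
  define d where "d T = real T powr r" for T
  define a where "a T = sqrt (ln (real T) / (real T * h T))" for T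
  define \<tau> where "\<tau> T = (a T * h T) powr (- 1 / (s - 1))" for T
  from A1 obtain A where A: "A > 0" and \<beta>2: "\<beta> > 2"
    and mixA: "\<And>i T g. i \<ge> 1 \<Longrightarrow> T \<ge> 1 \<Longrightarrow> g \<in> \<Theta> \<Longrightarrow> mixing_coef M (\<lambda>r. eps T r g) T (int i) \<le> A * real i powr (- \<beta>)"
    by blast
  from A2 obtain Kb \<mu>b \<Lambda> R where K: "\<And>u. \<bar>K u\<bar> \<le> Kb" "1 \<le> \<Lambda>" "1 \<le> R" "\<And>u. \<bar>u\<bar> > R \<Longrightarrow> K u = 0"
    "\<And>u u'. \<bar>K u - K u'\<bar> \<le> \<Lambda> * \<bar>u - u'\<bar>" by blast
  obtain k0 l0 where k0: "k0 \<ge> 1" "\<And>u. \<bar>K u * u ^ j\<bar> \<le> k0" and supp: "\<And>u. \<bar>u\<bar> > R \<Longrightarrow> K u * u ^ j = 0"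
    and l0: "l0 \<ge> 0" "\<And>u u'. \<bar>K u * u ^ j - K u' * u' ^ j\<bar> \<le> l0 * \<bar>u - u'\<bar>"
    by (rule kernel_times_power[OF K(1,4,3,5), of j]) (use K(2) in auto)
  from sup_mom obtain C where C: "C > 0"
    and supe: "\<And>T i. T \<ge> 1 \<Longrightarrow> i \<in> {1..T} \<Longrightarrow> (\<integral>\<^sup>+ \<omega>. (SUP g\<in>{g\<in>\<Theta>. enorm m g \<le> d T}. ennreal (\<bar>eps T i g \<omega>\<bar> powr s)) \<partial>M)
                      \<le> ennreal (C * (1 + rpow (d T) lam))"
    and supx: "\<And>T i. T \<ge> 1 \<Longrightarrow> i \<in> {1..T} \<Longrightarrow> (\<integral>\<^sup>+ \<omega>. (SUP g\<in>{g\<in>\<Theta>. enorm m g \<le> d T}. ennreal (\<bar>xi T i g \<omega>\<bar> powr s)) \<partial>M)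
                      \<le> ennreal (C * (1 + rpow (d T) lam))"
    unfolding Let_def \<theta>_def[symmetric] r_def[symmetric] d_def[symmetric] by blast
  have \<beta>s: "\<beta> * (s - 2) > 2 * s - 1"
  proof -
    have "real m * (s - 1) * (1 + 2 * c) + 2 * s - 1 < \<beta> * (s - 2)"
      using beta_cond s_gt by (simp add: divide_less_eq)
    moreover have "0 \<le> real m * (s - 1) * (1 + 2 * c)" using s_gt c_pos by simp
    ultimately show ?thesis by linarith
  qed
  \<comment> \<open>The lower bound on \<open>\<beta>\<close> gives
    \<open>\<beta> * (s - 2) > 2 * s - 1\<close>, which exceeds \<open>s\<close>.\<close>
  have \<eta>: "\<beta> * (1 - 2 / s) > 1"
  proof -
    have "s < \<beta> * (s - 2)" using \<beta>s s_gt by linarith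
    then show ?thesis using s_gt by (simp add: field_simps)
  qed
  have den: "\<beta> * s + real m * (s - 1) + 1 > 0" using \<beta>2 s_gt by (intro add_nonneg_pos add_nonneg_nonneg) auto
  have \<theta>1: "\<theta> \<le> 1"
  proof -
    have "0 \<le> 2 * \<beta> + real m * (s - 1) * (2 + 2 * c) + 2 * s" using \<beta>2 s_gt c_pos by simp
    then have "\<beta> * (s - 2) - real m * (s - 1) * (1 + 2 * c) - 2 * s + 1 \<le> \<beta> * s + real m * (s - 1) + 1"
      by (simp add: algebra_simps)
    then show ?thesis unfolding \<theta>_def using den by (simp add: divide_le_eq)
  qed
  have r: "0 \<le> r" "r \<le> c" using c_pos lam \<theta>1 by (auto simp: r_def)
  \<comment> \<open>One more than the exponent of \<open>T\<close> that bounds the number of net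
    points, so the exponential term summed over the net is \<open>O(1 / T)\<close>.\<close>
  define y where "y = real m + 2 + c * real m"
  have y0: "y \<ge> 0" using c_pos by (simp add: y_def)
  \<comment> \<open>The factor 2 turns \<open>C * (1 + D)\<close> into a multiple of
    \<open>D \<ge> 1\<close>; the maximum secures \<open>c0 \<ge> 1\<close>.\<close>
  define c0 where "c0 = max 1 (2 * C)"
  have c0: "c0 \<ge> 1" by (simp add: c0_def)
  define Z where "Z T = (real T powr r) ^ m * (1 / (a T * h T)) ^ (m + 1)" for T
  have rate': "(\<lambda>T. ln (real T) / (real T powr \<theta> * h T)) \<longlonglongrightarrow> 0"
    using rate unfolding Let_def \<theta>_def .
  have h_pos': "\<forall>T\<ge>1. h T > 0" and \<beta>0: "\<beta> > 0" using h_pos \<beta>2 by auto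
  note asy = rate_asymptotics[OF h_pos' h_lim Th_lim s_gt \<beta>0 c_pos r \<theta>_def rate',
      folded a_def, folded \<tau>_def, folded Z_def, folded y_def]
  define E1 where "E1 = 4 * (y + (R + 3) * block_var A (\<beta> * (1 - 2 / s)) * c0\<^sup>2)"
  \<comment> \<open>With \<open>u = 1 / (a h) \<ge> 1\<close> the net in the parameter has at most
    \<open>((2 * m + 4) * d * u) ^ m\<close> points and the one in \<open>x\<close> at most
    \<open>3 * u\<close>; 24 is this 3 times the 8 of \<open>uniform_deviation_bound\<close>. The
    power of 2 comes from \<open>2 * a * \<tau>\<close>.\<close>
  define B where "B T = real (24 * (2 * m + 4) ^ m) * (Z T * exp (- (y * ln (real T)))
      + 3 * A * (R + 3) * 2 powr (1 + \<beta>) * (Z T * (real T * h T * (a T * \<tau> T) powr (1 + \<beta>))))" for T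
  have Blim: "B \<longlonglongrightarrow> 0"
    unfolding B_def using asy(2,3) by (intro tendsto_mult_right_zero tendsto_add_zero)
  have "\<exists>Mc. \<forall>\<^sub>F T in sequentially.
              outer_prob M {\<omega> \<in> space M.
                 (SUP gx \<in> {g\<in>\<Theta>. enorm m g \<le> d T} \<times> {0..1}.
                    ennreal \<bar>Psi_hat K h eps j T (snd gx) (fst gx) \<omega>
                       - integral\<^sup>L M (Psi_hat K h eps j T (snd gx) (fst gx))\<bar>)
                 > ennreal (Mc * (rpow (d T) lam * sqrt (ln (real T) / (real T * h T))))} \<le> \<delta>"
    if \<delta>: "\<delta> > 0" for \<delta>
  proof -
    \<comment> \<open>One half of \<open>\<delta>\<close> is spent on the remainder, the other on
      \<open>B T\<close>.\<close>
    define Mc where "Mc = k0 * (1 + 2 * c0) * (1 / (\<delta> / 2) + 1) + k0 * E1 + l0 * (E1 + 2 * (2 * R + 3) * (1 + c0))"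
    have "\<forall>\<^sub>F T in sequentially. B T < \<delta> / 2" using order_tendstoD(2)[OF Blim, of "\<delta> / 2"] \<delta> by simp
    with asy(1) have "\<forall>\<^sub>F T in sequentially.
              outer_prob M {\<omega> \<in> space M.
                 (SUP gx \<in> {g\<in>\<Theta>. enorm m g \<le> d T} \<times> {0..1}.
                    ennreal \<bar>Psi_hat K h eps j T (snd gx) (fst gx) \<omega>
                       - integral\<^sup>L M (Psi_hat K h eps j T (snd gx) (fst gx))\<bar>)
                 > ennreal (Mc * (rpow (d T) lam * sqrt (ln (real T) / (real T * h T))))} \<le> \<delta>"
    proof eventually_elim
      case (elim T)
      then have T: "T \<ge> 1" and h: "0 < h T" and aT: "0 < a T" "a T \<le> 1"
        and Na: "real T * h T * (a T)\<^sup>2 = ln (real T)" and L: "1 \<le> ln (real T)" and ah: "a T * h T \<le> 1"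
        and a\<tau>: "a T * \<tau> T \<le> 1" and BT: "B T < \<delta> / 2" by auto
      define S where "S = {g\<in>\<Theta>. enorm m g \<le> d T}"
      define D where "D = rpow (d T) lam"
      have d1: "d T \<ge> 1" unfolding d_def using T r by (intro ge_one_powr_ge_zero) auto
      have D1: "D \<ge> 1" unfolding D_def rpow_def using d1 lam by (auto intro: ge_one_powr_ge_zero)
      have ah0: "a T * h T > 0" using aT h by simp
      have CD: "C * (1 + D) \<le> c0 * D"
      proof -
        have "C * (1 + D) \<le> C * (2 * D)" using C D1 by (intro mult_left_mono) auto
        also have "\<dots> = (2 * C) * D" by simp
        also have "\<dots> \<le> c0 * D" using D1 by (intro mult_right_mono) (auto simp: c0_def)
        finally show ?thesis .
      qed
      obtain G where G: "finite G" "G \<subseteq> S" "real (card G) \<le> (2 * real (m + 1) * d T / (a T * h T) + 2) ^ m"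
        and net: "\<And>\<gamma>. \<gamma> \<in> S \<Longrightarrow> \<exists>g\<in>G. enorm m (\<lambda>k. \<gamma> k - g k) \<le> a T * h T"
        using ball_net[of S m "d T" "a T * h T"] ah0 d1 by (auto simp: S_def)
      define \<pi> where "\<pi> \<gamma> = (SOME g. g \<in> G \<and> enorm m (\<lambda>k. \<gamma> k - g k) \<le> a T * h T)" for \<gamma>
      have \<pi>: "\<pi> \<gamma> \<in> G" "enorm m (\<lambda>k. \<gamma> k - \<pi> \<gamma> k) \<le> a T * h T" if "\<gamma> \<in> S" for \<gamma>
        using someI_ex[of "\<lambda>g. g \<in> G \<and> enorm m (\<lambda>k. \<gamma> k - g k) \<le> a T * h T"] net[OF that] unfolding \<pi>_def by blast+
      have SO: "S \<subseteq> \<Theta>" by (auto simp: S_def)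
      have lipT: "AE \<omega> in M. \<forall>i\<in>{1..T}. \<forall>\<gamma>\<in>S. \<bar>eps T i \<gamma> \<omega> - eps T i (\<pi> \<gamma>) \<omega>\<bar> \<le> xi T i (\<pi> \<gamma>) \<omega> * (a T * h T)"
      proof (rule AE_finite_allI)
        fix i assume i: "i \<in> {1..T}"
        from A3_lip[OF T i] show "AE \<omega> in M. \<forall>\<gamma>\<in>S. \<bar>eps T i \<gamma> \<omega> - eps T i (\<pi> \<gamma>) \<omega>\<bar> \<le> xi T i (\<pi> \<gamma>) \<omega> * (a T * h T)"
        proof eventually_elim
          case (elim \<omega>)
          show ?case
          proof
            fix \<gamma> assume \<gamma>: "\<gamma> \<in> S"
            have m: "\<gamma> \<in> \<Theta>" "\<pi> \<gamma> \<in> \<Theta>" using \<gamma> \<pi>(1)[OF \<gamma>] G SO by auto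
            \<comment> \<open>The Lipschitz condition only holds up to distance \<open>h\<close>;
              \<open>a \<le> 1\<close> keeps the mesh within it. Its modulus is taken at the base
              point, which here is the net point.\<close>
            have "a T * h T \<le> h T" using aT h by simp
            then have "enorm m (\<lambda>k. \<gamma> k - \<pi> \<gamma> k) \<le> h T" using \<pi>(2)[OF \<gamma>] by linarith
            then have "\<bar>eps T i \<gamma> \<omega> - eps T i (\<pi> \<gamma>) \<omega>\<bar> \<le> xi T i (\<pi> \<gamma>) \<omega> * enorm m (\<lambda>k. \<gamma> k - \<pi> \<gamma> k)"
              using elim m by blast
            also have "\<dots> \<le> xi T i (\<pi> \<gamma>) \<omega> * (a T * h T)"
              using xi_nonneg[OF T i m(2)] \<pi>(2)[OF \<gamma>] by (intro mult_left_mono) auto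
            finally show "\<bar>eps T i \<gamma> \<omega> - eps T i (\<pi> \<gamma>) \<omega>\<bar> \<le> xi T i (\<pi> \<gamma>) \<omega> * (a T * h T)" .
          qed
        qed
      qed simp
      have mome: "(\<integral>\<^sup>+ \<omega>. (SUP g\<in>S. ennreal (\<bar>eps T i g \<omega>\<bar> powr s)) \<partial>M) \<le> ennreal (c0 * D)"
        and momx: "(\<integral>\<^sup>+ \<omega>. (SUP g\<in>S. ennreal (\<bar>xi T i g \<omega>\<bar> powr s)) \<partial>M) \<le> ennreal (c0 * D)" if "i \<in> {1..T}" for i
        using order_trans[OF supe[OF T that] ennreal_leI] order_trans[OF supx[OF T that] ennreal_leI] CD
        unfolding S_def D_def by blast+
      define \<Psi> where "\<Psi> x g \<omega> = (\<Sum>i=1..T. K ((real i / real T - x) / h T) * ((real i / real T - x) / h T) ^ j * eps T i g \<omega>) / (real T * h T)" for x g \<omega>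
      have \<Psi>: "Psi_hat K h eps j T x g = \<Psi> x g" for x g
        unfolding \<Psi>_def Psi_hat_def by (simp add: fun_eq_iff sum_divide_distrib sum_distrib_left mult_ac)
      obtain Bad where Bad: "Bad \<in> events"
        "prob Bad \<le> \<delta> / 2 + real (card G) * (1 / (a T * h T) + 2) *
          (8 * (exp (- (y * ln (real T))) + 3 * A * (R + 3) * (real T * h T) * (2 * a T * \<tau> T) powr (1 + \<beta>)))"
        "\<And>\<omega> \<gamma> x. \<omega> \<in> space M - Bad \<Longrightarrow> \<gamma> \<in> S \<Longrightarrow> x \<in> {0..1} \<Longrightarrow> \<bar>\<Psi> x \<gamma> \<omega> - expectation (\<Psi> x \<gamma>)\<bar> \<le> Mc * (D * a T)"
        by (rule uniform_deviation_bound[where T=T and h="h T" and a="a T" and s=s and A=A and \<beta>=\<beta> and c=c0 and D=D and S=S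
              and G=G and \<pi>=\<pi> and e="eps T" and xi="xi T" and \<kappa>="\<lambda>u. K u * u ^ j" and ?k0.0=k0 and ?l0.0=l0 and R=R and y=y and \<delta>="\<delta> / 2",
              folded \<tau>_def \<Psi>_def E1_def, unfolded Na, folded Mc_def])
          (use T h aT Na L ah a\<tau> s_gt A \<eta> \<beta>2 D1 c0 G \<pi>(1) lipT mome momx k0 supp l0 y0 \<delta> K SO in
            \<open>auto simp: \<tau>_def intro!: eps_meas xi_meas mixA\<close>)
      have "prob Bad \<le> \<delta> / 2 + B T"
      proof -
        define Q where "Q = exp (- (y * ln (real T))) + 3 * A * (R + 3) * (real T * h T) * (2 * a T * \<tau> T) powr (1 + \<beta>)"
        have Q0: "0 \<le> Q" unfolding Q_def using A K h by simp
        define u where "u = 1 / (a T * h T)"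
        have u1: "u \<ge> 1" unfolding u_def using ah ah0 by simp
        have "real (card G) * (1 / (a T * h T) + 2) * (8 * Q) \<le> (real (2 * m + 4) * d T * u) ^ m * (3 * u) * (8 * Q)"
        proof (intro mult_mono)
          have "2 * real (m + 1) * d T / (a T * h T) + 2 \<le> real (2 * m + 4) * d T * u"
          proof -
            have "1 * 1 \<le> d T * u" using d1 u1 by (intro mult_mono) auto
            moreover have "2 * real (m + 1) * d T / (a T * h T) = (2 * real m + 2) * (d T * u)" by (simp add: u_def)
            moreover have "real (2 * m + 4) * d T * u = (2 * real m + 2) * (d T * u) + 2 * (d T * u)" by (simp add: algebra_simps)
            ultimately show ?thesis by linarith
          qed
          then have "(2 * real (m + 1) * d T / (a T * h T) + 2) ^ m \<le> (real (2 * m + 4) * d T * u) ^ m"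
            using d1 ah0 by (intro power_mono) auto
          then show "real (card G) \<le> (real (2 * m + 4) * d T * u) ^ m" using G by linarith
          show "1 / (a T * h T) + 2 \<le> 3 * u" using u1 unfolding u_def by linarith
        qed (use Q0 u1 d1 ah0 in auto)
        also have "\<dots> = real (24 * (2 * m + 4) ^ m) * (Z T * Q)"
          unfolding Z_def u_def[symmetric] d_def[symmetric] by (simp add: power_mult_distrib mult_ac)
        also have "Z T * Q = Z T * exp (- (y * ln (real T)))
            + 3 * A * (R + 3) * 2 powr (1 + \<beta>) * (Z T * (real T * h T * (a T * \<tau> T) powr (1 + \<beta>)))"
        proof -
          have "(2 * a T * \<tau> T) powr (1 + \<beta>) = 2 powr (1 + \<beta>) * (a T * \<tau> T) powr (1 + \<beta>)"
            using aT by (simp add: powr_mult mult.assoc \<tau>_def)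
          then show ?thesis unfolding Q_def by (simp add: algebra_simps)
        qed
        finally have "real (card G) * (1 / (a T * h T) + 2) * (8 * Q) \<le> B T" unfolding B_def .
        then show ?thesis using Bad(2) unfolding Q_def by linarith
      qed
      then have PB: "prob Bad \<le> \<delta>" using BT by simp
      define ES where "ES = {\<omega> \<in> space M.
                 (SUP gx \<in> S \<times> {0..1}.
                    ennreal \<bar>Psi_hat K h eps j T (snd gx) (fst gx) \<omega>
                       - integral\<^sup>L M (Psi_hat K h eps j T (snd gx) (fst gx))\<bar>)
                 > ennreal (Mc * (D * a T))}"
      \<comment> \<open>\<open>Bad\<close> is a measurable cover of \<open>ES\<close>, so its
        probability bounds the outer probability.\<close>
      have "ES \<subseteq> Bad"
      proof
        fix \<omega> assume \<omega>: "\<omega> \<in> ES"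
        show "\<omega> \<in> Bad"
        proof (rule ccontr)
          assume "\<omega> \<notin> Bad"
          then have "\<omega> \<in> space M - Bad" using \<omega> by (simp add: ES_def)
          then have "(SUP gx \<in> S \<times> {0..1}.
                    ennreal \<bar>Psi_hat K h eps j T (snd gx) (fst gx) \<omega>
                       - integral\<^sup>L M (Psi_hat K h eps j T (snd gx) (fst gx))\<bar>) \<le> ennreal (Mc * (D * a T))"
            unfolding \<Psi> using Bad(3)[of \<omega>] by (intro SUP_least ennreal_leI) auto
          moreover have "ennreal (Mc * (D * a T)) < (SUP gx \<in> S \<times> {0..1}.
                    ennreal \<bar>Psi_hat K h eps j T (snd gx) (fst gx) \<omega>
                       - integral\<^sup>L M (Psi_hat K h eps j T (snd gx) (fst gx))\<bar>)"
            using \<omega> unfolding ES_def by blast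
          ultimately show False by (rule leD[THEN notE])
        qed
      qed
      then have "outer_prob M ES \<le> prob Bad"
        unfolding outer_prob_def using Bad(1) by (intro cInf_lower) (auto intro!: bdd_belowI[of _ 0])
      then show ?case using PB unfolding ES_def S_def D_def a_def by linarith
    qed
    then show ?thesis by blast
  qed
  then show ?thesis unfolding Let_def \<theta>_def[symmetric] r_def[symmetric] d_def[symmetric] by blast
qed

end
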